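(* Let $a,b,n,s$ be positive integers with $s\ge n+1$ and $b(s-n)+1\le a\le sb$, and put $c_0=s-\lfloor\frac{a-1}{b}\rfloor$ and $\mu_a^0=a-b(s-c_0)$. Let $m$ be a positive integer and let $\mathcal{F}=\{f_1,\dots,f_s\}$ be a generic set of forms sharing a common degree $d$ in $R=\mathbb{K}[x_0,\dots,x_n]$. For a nonempty subset $B=\{b_1<\cdots<b_h\}\subseteq[c_0]=\{1,\dots,c_0\}$, let $\mathbb{S}_B$ be the set of all solutions in positive integers $(x_1,\dots,x_h)$ of the Diophantine equation $b_1x_1+\cdots+b_hx_h=m\mu_a^0$. (a) If $a$ is not a multiple of $b$, then $$\operatorname{sdefect}_*(I_a(\mathcal{F}^b),m)=\sum_{B=\{b_1<\cdots<b_h\}\subseteq[c_0]}|\mathbb{S}_B|\binom{s}{c_0-b_h}\binom{s-c_0+b_h}{b_h-b_{h-1}}\binom{s-c_0+b_{h-1}}{b_{h-1}-b_{h-2}}\cdots\binom{s-c_0+b_2}{b_2-b_1}.$$ (b) If $a=kb$ is a multiple of $b$, then $I_a(\mathcal{F}^b)=I_{s-c_0+1}(\mathcal{F})^b$, and $$\operatorname{sdefect}_*(I_a(\mathcal{F}^b),m)=\sum_{B=\{b_1<\cdots<b_h\}\subseteq[c_0]}|\mathbb{S}_B|\binom{s}{c_0-b_h}\binom{s-c_0+b_h}{b_h-b_{h-1}}\binom{s-c_0+b_{h-1}}{b_{h-1}-b_{h-2}}\cdots\binom{s-c_0+b_2}{b_2-b_1}-\binom{s}{c_0-1},$$ where,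 since $\mu_a^0=b$ in this case, $\mathbb{S}_B$ is the set of all solutions in positive integers $(x_1,\dots,x_h)$ of the Diophantine equation $b_1x_1+\cdots+b_hx_h=mb$.
   Context: $\mathbb{K}$ is an infinite field; $R$ is standard graded; a form is a homogeneous polynomial of positive degree. A set of forms in $R$ is generic if every subset of size at most $n+1$ forms an $R$-regular sequence. $I_a(\mathcal{F}^b)=\langle f_1^{n_1}\cdots f_s^{n_s}: 0\le n_i\le b,\ \sum_i n_i=a\rangle$ and $I_k(\mathcal{F})=I_k(\mathcal{F}^1)$. For a homogeneous ideal $I$ of $R$ and $m\ge1$, $I^{(m)_*}=\bigcap_{\mathfrak{p}\in\operatorname{Min}(I)}(I^mR_{\mathfrak{p}}\cap R)$ (intersection over the minimal primes of $I$), and $\operatorname{sdefect}_*(I,m)=\mu(I^{(m)_*}/I^m)$, where $\mu$ is the minimal number of generators of a graded module. In the sums, when $h=1$ the product of binomials is just $\binom{s}{c_0-b_1}$. *)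

theory Defs
  imports
    Complex_Main
    "HOL-Library.Poly_Mapping"
    "HOL-Library.Set_Algebras"
    "HOL-Computational_Algebra.Fraction_Field"
begin

section \<open>Ideals of a commutative ring\<close>

text \<open>A commutative ring is a module over itself; its ideals are the submodules, and the ideal
  generated by a set is its linear span.\<close>

global_interpretation ring_ideal: module "(*) :: 'a::comm_ring_1 \<Rightarrow> 'a \<Rightarrow> 'a"
  by unfold_locales (auto simp: algebra_simps)

abbreviation is_ideal :: "'a::comm_ring_1 set \<Rightarrow> bool" where
  "is_ideal \<equiv> module.subspace (*)"

abbreviation ideal_gen :: "'a::comm_ring_1 set \<Rightarrow> 'a set" where
  "ideal_gen \<equiv> module.span (*)"

definition ideal_mult :: "'a::comm_ring_1 set \<Rightarrow> 'a set \<Rightarrow> 'a set" where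
  "ideal_mult I J = ideal_gen {x * y | x y. x \<in> I \<and> y \<in> J}"

primrec ideal_power :: "'a::comm_ring_1 set \<Rightarrow> nat \<Rightarrow> 'a set" where
  "ideal_power I 0 = UNIV"
| "ideal_power I (Suc k) = ideal_mult I (ideal_power I k)"

definition is_prime_ideal :: "'a::comm_ring_1 set \<Rightarrow> bool" where
  "is_prime_ideal P \<longleftrightarrow>
     is_ideal P \<and> P \<noteq> UNIV \<and> (\<forall>x y. x * y \<in> P \<longrightarrow> x \<in> P \<or> y \<in> P)"

definition minimal_primes :: "'a::comm_ring_1 set \<Rightarrow> 'a set set" where
  "minimal_primes I =
     {P. is_prime_ideal P \<and> I \<subseteq> P \<and> (\<forall>Q. is_prime_ideal Q \<and> I \<subseteq> Q \<and> Q \<subseteq> P \<longrightarrow> Q = P)}"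


section \<open>Localization at a prime ideal of a domain, and symbolic powers\<close>

text \<open>For a domain \<open>R\<close>, the ring \<open>R\<^sub>P\<close> is realized inside the fraction field.\<close>

definition localization :: "'a::idom set \<Rightarrow> 'a fract set" where
  "localization P = {Fraction_Field.Fract r u | r u. u \<notin> P}"

text \<open>The ideal \<open>I R\<^sub>P\<close> of \<open>R\<^sub>P\<close> generated by the image of \<open>I\<close>.\<close>

inductive_set extended_ideal :: "'a::idom set \<Rightarrow> 'a set \<Rightarrow> 'a fract set"
  for P I where
  zero: "0 \<in> extended_ideal P I"
| gen: "x \<in> I \<Longrightarrow> Fraction_Field.Fract x 1 \<in> extended_ideal P I"
| add: "y \<in> extended_ideal P I \<Longrightarrow> z \<in> extended_ideal P I \<Longrightarrow> y + z \<in> extended_ideal P I"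
| mult: "q \<in> localization P \<Longrightarrow> y \<in> extended_ideal P I \<Longrightarrow> q * y \<in> extended_ideal P I"

text \<open>The contraction \<open>I R\<^sub>P \<inter> R\<close>.\<close>

definition contracted_ideal :: "'a::idom set \<Rightarrow> 'a set \<Rightarrow> 'a set" where
  "contracted_ideal P I = {r. Fraction_Field.Fract r 1 \<in> extended_ideal P I}"

definition symbolic_power :: "'a::idom set \<Rightarrow> nat \<Rightarrow> 'a set" where
  "symbolic_power I m = (\<Inter>P\<in>minimal_primes I. contracted_ideal P (ideal_power I m))"


section \<open>Minimal number of generators of a quotient module\<close>

text \<open>For ideals \<open>N \<subseteq> M\<close>, the elements of the quotient module \<open>M / N\<close> are the
  cosets \<open>x + N\<close> with \<open>x \<in> M\<close>. Their sum is the elementwise sum of sets from the theory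
  Set-Algebras, and the multiple of a coset \<open>A\<close> by a scalar \<open>r\<close> is \<open>r A + N\<close>.\<close>

definition quot_carrier :: "'a::comm_ring_1 set \<Rightarrow> 'a set \<Rightarrow> 'a set set" where
  "quot_carrier M N = (\<lambda>x. x +o N) ` M"

definition coset_scale :: "'a::comm_ring_1 set \<Rightarrow> 'a \<Rightarrow> 'a set \<Rightarrow> 'a set" where
  "coset_scale N r A = (r *o A) + N"

inductive_set quot_span :: "'a::comm_ring_1 set \<Rightarrow> 'a set set \<Rightarrow> 'a set set"
  for N G where
  zero: "N \<in> quot_span N G"
| gen: "A \<in> G \<Longrightarrow> A \<in> quot_span N G"
| add: "A \<in> quot_span N G \<Longrightarrow> B \<in> quot_span N G \<Longrightarrow> A + B \<in> quot_span N G"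
| scale: "A \<in> quot_span N G \<Longrightarrow> coset_scale N r A \<in> quot_span N G"

text \<open>The least cardinality of a finite generating set of \<open>M / N\<close>. It is used only over
  Noetherian rings, where a finite generating set exists.\<close>

definition min_gens_quot :: "'a::comm_ring_1 set \<Rightarrow> 'a set \<Rightarrow> nat" where
  "min_gens_quot M N =
     (LEAST k. \<exists>G \<subseteq> quot_carrier M N. finite G \<and> card G = k \<and> quot_span N G = quot_carrier M N)"

definition sdefect :: "'a::idom set \<Rightarrow> nat \<Rightarrow> nat" where
  "sdefect I m = min_gens_quot (symbolic_power I m) (ideal_power I m)"


section \<open>Regular sequences\<close>

text \<open>Each entry is a nonzerodivisor modulo the ideal generated by its predecessors, and the
  entries do not generate the unit ideal.\<close>

definition regular_sequence :: "'a::comm_ring_1 list \<Rightarrow> bool" where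
  "regular_sequence fs \<longleftrightarrow>
     (\<forall>i<length fs. \<forall>r. r * fs ! i \<in> ideal_gen (set (take i fs)) \<longrightarrow>
        r \<in> ideal_gen (set (take i fs))) \<and>
     ideal_gen (set fs) \<noteq> UNIV"


section \<open>Polynomial rings and generic sets of forms\<close>

text \<open>The polynomial ring over \<open>'k\<close> whose variables are indexed by \<open>'v\<close>. In the sequel
  \<open>'v\<close> is a finite linearly ordered type with \<open>n + 1\<close> elements, in the role of
  \<open>0 < \<dots> < n\<close>; the order makes the library's integral domain instance available.\<close>

type_synonym ('v, 'k) mpoly = "('v \<Rightarrow>\<^sub>0 nat) \<Rightarrow>\<^sub>0 'k"

definition monom_degree :: "('v \<Rightarrow>\<^sub>0 nat) \<Rightarrow> nat" where
  "monom_degree t = (\<Sum>v\<in>Poly_Mapping.keys t. Poly_Mapping.lookup t v)"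

definition homogeneous :: "nat \<Rightarrow> ('v, 'k::zero) mpoly \<Rightarrow> bool" where
  "homogeneous d p \<longleftrightarrow> (\<forall>t\<in>Poly_Mapping.keys p. monom_degree t = d)"

text \<open>For homogeneous polynomials of positive degree, being a regular sequence does not depend on
  the order, so a set of forms is called regular if some enumeration of it is.\<close>

definition generic_forms :: "nat \<Rightarrow> ('v, 'k::comm_ring_1) mpoly set \<Rightarrow> bool" where
  "generic_forms n F \<longleftrightarrow>
     (\<forall>f\<in>F. \<exists>d>0. homogeneous d f) \<and>
     (\<forall>G\<subseteq>F. finite G \<and> card G \<le> n + 1 \<longrightarrow>
        (\<exists>fs. distinct fs \<and> set fs = G \<and> regular_sequence fs))"

text \<open>\<open>fold_ideal a b F\<close> is \<open>I\<^sub>a(F\<^sup>b)\<close>; the exponents are indexed by the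
  elements of the finite set \<open>F\<close>.\<close>

definition fold_ideal :: "nat \<Rightarrow> nat \<Rightarrow> 'a::comm_ring_1 set \<Rightarrow> 'a set" where
  "fold_ideal a b F =
     ideal_gen {\<Prod>f\<in>F. f ^ e f | e. (\<forall>f\<in>F. e f \<le> b) \<and> (\<Sum>f\<in>F. e f) = a}"


section \<open>The combinatorial data\<close>

text \<open>With \<open>bs = [b\<^sub>1, \<dots>, b\<^sub>h]\<close> the increasing enumeration of \<open>B\<close>, the solutions in
  positive integers of \<open>b\<^sub>1 x\<^sub>1 + \<dots> + b\<^sub>h x\<^sub>h = N\<close>.\<close>

definition dioph_solutions :: "nat set \<Rightarrow> nat \<Rightarrow> nat list set" where
  "dioph_solutions B N =
     (let bs = sorted_list_of_set B in
       {xs. length xs = length bs \<and> (\<forall>x\<in>set xs. 0 < x) \<and> (\<Sum>i<length bs. bs ! i * xs ! i) = N})"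

text \<open>The product of \<open>s choose (c - b\<^sub>h)\<close> and of all
  \<open>(s - c + b\<^sub>i) choose (b\<^sub>i - b\<^bsub>i-1\<^esub>)\<close> for \<open>2 \<le> i \<le> h\<close>. List positions
  start at 0.\<close>

definition binom_product :: "nat \<Rightarrow> nat \<Rightarrow> nat set \<Rightarrow> nat" where
  "binom_product s c B =
     (let bs = sorted_list_of_set B in
       (s choose (c - last bs)) *
       (\<Prod>i = 1..<length bs. (s - c + bs ! i) choose (bs ! i - bs ! (i - 1))))"

end

theory Submission
  imports Defs "HOL-Library.Countable_Set" "HOL-Library.FuncSet"
begin

text \<open>Write \<open>c = c0\<close>, \<open>\<mu> = \<mu>0\<close>, \<open>I = I\<^sub>a(F\<^sup>b)\<close>, and let \<open>f\<^sup>e\<close> be the product of the \<open>f ^ e f\<close>. The minimal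
  primes of \<open>I\<close> are those of the ideals \<open>(C)\<close> with \<open>C \<subseteq> F\<close> of size \<open>c\<close>, and at such a prime \<open>I\<close>
  becomes \<open>(C)\<^sup>\<mu>\<close>. Powers of \<open>(C)\<close> are unmixed, so \<open>symbolic_power I m\<close> is the intersection of all
  \<open>(C)\<close> to the power \<open>M = m \<mu>\<close>, and this is generated by the \<open>f\<^sup>e\<close> for which \<open>e\<close> has sum at least \<open>M\<close> on
  every \<open>C\<close>.

  Both facts rest on a filtration of the ideal of these \<open>f\<^sup>e\<close> by the least weight of \<open>e\<close> on a subset of
  size \<open>c\<close>, the weights being perturbed so that only one subset \<open>D\<close> attains it. The quotients of the
  filtration are sums of copies of \<open>R/(D)\<close>, because in a regular sequence \<open>r f\<^sup>e\<close> can lie in the ideal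
  of the \<open>f ^ (e f + 1)\<close> only if \<open>r\<close> lies in \<open>(D)\<close>. Hence a nonzerodivisor modulo every \<open>(D)\<close> is one
  modulo the whole ideal; the sum over \<open>C\<close> of the products of the \<open>f ^ M\<close> with \<open>f \<notin> C\<close> is such an
  element, and it multiplies the intersection into the ideal.

  The minimal generators \<open>f\<^sup>e\<close> remain independent modulo the maximal ideal, by the same property of
  regular sequences. Their level sets are chains of subsets of \<open>F\<close>, whose sizes and multiplicities are
  the sets \<open>B\<close> and the solutions of the Diophantine equation. Comparing degrees, \<open>I\<^sup>m\<close> contains no
  minimal generator if \<open>\<mu> < b\<close>, and those with a single level set of size \<open>s - c + 1\<close> if \<open>\<mu> = b\<close>.\<close>

section \<open>Nonzerodivisors and regular sequences\<close>

(* This simp rule is associativity read from right to left; with it, algebra_simps loops. *)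
declare ring_ideal.scale_scale [simp del]

text \<open>If \<open>s > n + 1\<close>, the forms satisfy polynomial relations, so facts about
  monomial ideals in independent variables do not carry over to \<open>F\<close> by one flat map.
  What is available is that any \<open>c + 1\<close> forms are regular, since
  \<open>c \<le> n\<close>. Each argument therefore singles out one monomial and one subset
  \<open>D\<close> of size \<open>c\<close>, and reduces modulo powers of the elements of
  \<open>D\<close> until only that monomial is left.

  Ties must be broken because the unperturbed filtration has the wrong quotients: for
  \<open>F = {x, y}\<close> and \<open>c = 1\<close>, passing from least weight 1 to 2 means passing
  from \<open>(x y)\<close> to \<open>(x^2 y^2)\<close>, and the quotient is \<open>R/(x y)\<close>,
  not a sum of copies of \<open>R/(x)\<close> and \<open>R/(y)\<close>.

  Dimension theory is replaced by two devices. Separation by degree does the work of Nakayama's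
  lemma, and minimality of primes over \<open>(C)\<close> comes from a count of monomials: one more
  polynomial than there are variables makes an algebraically dependent list.\<close>

definition nzd :: "'a::comm_ring_1 \<Rightarrow> 'a set \<Rightarrow> bool" where
  "nzd x J \<longleftrightarrow> (\<forall>r. r * x \<in> J \<longrightarrow> r \<in> J)"

text \<open>Separatedness of the quotient by \<open>J\<close> in the \<open>h\<close>-adic topology.
  It is what a local or graded hypothesis contributes when a regular sequence is permuted.\<close>

definition separated :: "'a::comm_ring_1 set \<Rightarrow> 'a \<Rightarrow> bool" where
  "separated J h \<longleftrightarrow> (\<forall>r. (\<forall>k. \<exists>q. r - q * h ^ k \<in> J) \<longrightarrow> r \<in> J)"

text \<open>Regularity in every order. The family is indexed by \<open>\<phi>\<close> so that single
  members can be replaced by powers while the index set stays the same.\<close>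

definition reg_fam :: "('i \<Rightarrow> 'a::comm_ring_1) \<Rightarrow> 'i set \<Rightarrow> bool" where
  "reg_fam \<phi> D \<longleftrightarrow> (\<forall>H\<subseteq>D. \<forall>h\<in>D - H. nzd (\<phi> h) (ideal_gen (\<phi> ` H)))"

definition mon :: "'a set \<Rightarrow> ('a::comm_ring_1 \<Rightarrow> nat) \<Rightarrow> 'a" where
  "mon F e = (\<Prod>f\<in>F. f ^ e f)"

lemma nzdD: "nzd x J \<Longrightarrow> r * x \<in> J \<Longrightarrow> r \<in> J"
  by (auto simp: nzd_def)

lemma nzdI: "(\<And>r. r * x \<in> J \<Longrightarrow> r \<in> J) \<Longrightarrow> nzd x J"
  by (auto simp: nzd_def)

lemma nzd_1: "nzd 1 J"
  by (auto simp: nzd_def)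

lemma nzd_mult: "nzd x J \<Longrightarrow> nzd y J \<Longrightarrow> nzd (x * y) J"
  unfolding nzd_def by (metis mult.assoc)

lemma nzd_power: "nzd x J \<Longrightarrow> nzd (x ^ k) J"
  by (induction k) (auto intro: nzd_1 nzd_mult)

lemma nzd_prod: "(\<And>i. i \<in> A \<Longrightarrow> nzd (g i) J) \<Longrightarrow> nzd (prod g A) J"
  by (induction A rule: infinite_finite_induct) (auto intro: nzd_1 nzd_mult)

lemma ideal_scale_right: "x \<in> ideal_gen S \<Longrightarrow> x * r \<in> ideal_gen S"
  using ring_ideal.span_scale[of x S r] by (simp add: mult.commute)

lemma ideal_gen_insertI: "x - k * a \<in> ideal_gen S \<Longrightarrow> x \<in> ideal_gen (insert a S)"
  unfolding ring_ideal.span_breakdown_eq by blast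

lemma ideal_gen_insertE:
  assumes "x \<in> ideal_gen (insert a S)"
  obtains k where "x - k * a \<in> ideal_gen S"
  using assms unfolding ring_ideal.span_breakdown_eq by blast

lemma ideal_scale_base: "x \<in> S \<Longrightarrow> r * x \<in> ideal_gen S"
  by (rule ring_ideal.span_scale[OF ring_ideal.span_base])

lemma ideal_add_scale: "x \<in> ideal_gen S \<Longrightarrow> y \<in> ideal_gen S \<Longrightarrow> x + r * y \<in> ideal_gen S"
  by (rule ring_ideal.span_add[OF _ ring_ideal.span_scale])

lemma ideal_diff_scale: "x \<in> ideal_gen S \<Longrightarrow> y \<in> ideal_gen S \<Longrightarrow> x - r * y \<in> ideal_gen S"
  by (rule ring_ideal.span_diff[OF _ ring_ideal.span_scale])

lemma nzd_cong_ideal: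
  assumes "nzd x (ideal_gen S)" "x - y \<in> ideal_gen S"
  shows "nzd y (ideal_gen S)"
proof (rule nzdI)
  fix r assume "r * y \<in> ideal_gen S"
  then have "r * y + r * (x - y) \<in> ideal_gen S"
    using assms(2) by (rule ideal_add_scale)
  then have "r * x \<in> ideal_gen S" by (simp add: algebra_simps)
  then show "r \<in> ideal_gen S" by (rule nzdD[OF assms(1)])
qed

text \<open>From \<open>r * g\<close> in the ideal follows \<open>r = r' * h\<close> modulo
  \<open>S\<close>, and cancelling \<open>h\<close> shows that \<open>r'\<close> satisfies the same
  condition as \<open>r\<close>. Iteration makes \<open>r\<close> divisible by every power of
  \<open>h\<close> modulo \<open>S\<close>.\<close>

lemma nzd_insert_imp:
  assumes sep: "separated (ideal_gen S) h"
    and h: "nzd h (ideal_gen S)" and g: "nzd g (ideal_gen (insert h S))"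
  shows "nzd g (ideal_gen S)"
proof (rule nzdI)
  fix r assume r: "r * g \<in> ideal_gen S"
  have "\<exists>q. r - q * h ^ k \<in> ideal_gen S" if "r * g \<in> ideal_gen S" for k r
    using that
  proof (induction k arbitrary: r)
    case 0
    then show ?case by (auto intro!: exI[of _ r] ring_ideal.span_zero)
  next
    case (Suc k)
    have "r * g \<in> ideal_gen (insert h S)"
      using Suc.prems ring_ideal.span_mono[of S "insert h S"] by blast
    then have "r \<in> ideal_gen (insert h S)" by (rule nzdD[OF g])
    then obtain r' where r': "r - r' * h \<in> ideal_gen S"
      by (blast elim: ideal_gen_insertE)
    have "r * g - g * (r - r' * h) \<in> ideal_gen S"
      using Suc.prems(1) r' by (rule ideal_diff_scale)
    then have "(r' * g) * h \<in> ideal_gen S" by (simp add: algebra_simps)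
    then have "r' * g \<in> ideal_gen S" by (rule nzdD[OF h])
    then obtain q where "r' - q * h ^ k \<in> ideal_gen S" using Suc.IH by blast
    with r' have "(r - r' * h) + h * (r' - q * h ^ k) \<in> ideal_gen S"
      by (rule ideal_add_scale)
    then have "r - q * h ^ Suc k \<in> ideal_gen S" by (simp add: algebra_simps)
    then show ?case by blast
  qed
  then show "r \<in> ideal_gen S" using sep r unfolding separated_def by blast
qed

text \<open>One half of a transposition in a regular sequence. Modulo \<open>S\<close>, if
  \<open>r f = k g\<close>, then \<open>k\<close> is a multiple \<open>l f\<close>, and cancelling
  \<open>f\<close> gives \<open>r = l g\<close>.\<close>

lemma nzd_insert_swap:
  assumes f: "nzd f (ideal_gen S)" and g: "nzd g (ideal_gen (insert f S))"
  shows "nzd f (ideal_gen (insert g S))"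
proof (rule nzdI)
  fix r assume "r * f \<in> ideal_gen (insert g S)"
  then obtain k where k: "r * f - k * g \<in> ideal_gen S"
    by (blast elim: ideal_gen_insertE)
  have "- (r * f - k * g) \<in> ideal_gen S" using k by (rule ring_ideal.span_neg)
  then have "k * g \<in> ideal_gen (insert f S)"
    unfolding ring_ideal.span_breakdown_eq by (intro exI[of _ r]) (simp add: algebra_simps)
  then have "k \<in> ideal_gen (insert f S)" by (rule nzdD[OF g])
  then obtain l where l: "k - l * f \<in> ideal_gen S"
    by (blast elim: ideal_gen_insertE)
  have "(r * f - k * g) + g * (k - l * f) \<in> ideal_gen S"
    using k l by (rule ideal_add_scale)
  then have "(r - l * g) * f \<in> ideal_gen S" by (simp add: algebra_simps)
  then have "r - l * g \<in> ideal_gen S" by (rule nzdD[OF f])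
  then show "r \<in> ideal_gen (insert g S)" by (rule ideal_gen_insertI)
qed

text \<open>The power grows by one: \<open>r\<close> is already a multiple
  \<open>r' h^(k+1)\<close>, and after cancelling that power the regularity of \<open>f\<close>
  modulo \<open>h\<close> makes \<open>r'\<close> divisible by \<open>h\<close>.\<close>

lemma nzd_insert_power:
  assumes h: "nzd h (ideal_gen S)" and f: "nzd f (ideal_gen (insert h S))"
  shows "nzd f (ideal_gen (insert (h ^ Suc k) S))"
proof (induction k)
  case 0
  then show ?case using f by simp
next
  case (Suc k)
  show ?case
  proof (rule nzdI)
    fix r assume "r * f \<in> ideal_gen (insert (h ^ Suc (Suc k)) S)"
    then obtain q where q: "r * f - q * h ^ Suc (Suc k) \<in> ideal_gen S"
      by (blast elim: ideal_gen_insertE)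
    then have "r * f \<in> ideal_gen (insert (h ^ Suc k) S)"
      unfolding ring_ideal.span_breakdown_eq
      by (intro exI[of _ "q * h"]) (simp add: algebra_simps)
    then have "r \<in> ideal_gen (insert (h ^ Suc k) S)" by (rule nzdD[OF Suc])
    then obtain r' where r': "r - r' * h ^ Suc k \<in> ideal_gen S"
      by (blast elim: ideal_gen_insertE)
    have "(r * f - q * h ^ Suc (Suc k)) - f * (r - r' * h ^ Suc k) \<in> ideal_gen S"
      using q r' by (rule ideal_diff_scale)
    then have "(r' * f - q * h) * h ^ Suc k \<in> ideal_gen S" by (simp add: algebra_simps)
    then have "r' * f - q * h \<in> ideal_gen S" by (rule nzdD[OF nzd_power[OF h]])
    then have "r' * f \<in> ideal_gen (insert h S)" by (rule ideal_gen_insertI)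
    then have "r' \<in> ideal_gen (insert h S)" by (rule nzdD[OF f])
    then obtain l where l: "r' - l * h \<in> ideal_gen S"
      by (blast elim: ideal_gen_insertE)
    have "(r - r' * h ^ Suc k) + h ^ Suc k * (r' - l * h) \<in> ideal_gen S"
      using r' l by (rule ideal_add_scale)
    then have "r - l * h ^ Suc (Suc k) \<in> ideal_gen S" by (simp add: algebra_simps)
    then show "r \<in> ideal_gen (insert (h ^ Suc (Suc k)) S)"
      by (rule ideal_gen_insertI)
  qed
qed

section \<open>Families that are regular in every order\<close>

lemma reg_famD: "reg_fam \<phi> D \<Longrightarrow> H \<subseteq> D \<Longrightarrow> h \<in> D \<Longrightarrow> h \<notin> H \<Longrightarrow> nzd (\<phi> h) (ideal_gen (\<phi> ` H))"
  by (auto simp: reg_fam_def)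

lemma reg_fam_mono: "reg_fam \<phi> D \<Longrightarrow> D' \<subseteq> D \<Longrightarrow> reg_fam \<phi> D'"
  by (auto simp: reg_fam_def)

lemma reg_fam_upd_power:
  assumes "reg_fam \<phi> D" "h \<in> D"
  shows "reg_fam (\<phi>(h := \<phi> h ^ Suc k)) D"
  unfolding reg_fam_def
proof (intro allI impI ballI)
  fix H g assume H: "H \<subseteq> D" and g: "g \<in> D - H"
  let ?\<psi> = "\<phi>(h := \<phi> h ^ Suc k)"
  have im: "?\<psi> ` (H - {h}) = \<phi> ` (H - {h})" by (intro image_cong) auto
  show "nzd (?\<psi> g) (ideal_gen (?\<psi> ` H))"
  proof (cases "h \<in> H")
    case True
    then have "H = insert h (H - {h})" by auto
    then have "?\<psi> ` H = insert (?\<psi> h) (?\<psi> ` (H - {h}))" by (metis image_insert)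
    then have eq: "?\<psi> ` H = insert (\<phi> h ^ Suc k) (\<phi> ` (H - {h}))" using im by simp
    have eq2: "\<phi> ` H = insert (\<phi> h) (\<phi> ` (H - {h}))" using True by auto
    have "nzd (\<phi> h) (ideal_gen (\<phi> ` (H - {h})))"
      using assms H by (intro reg_famD[of \<phi> D]) auto
    moreover have "nzd (\<phi> g) (ideal_gen (\<phi> ` H))"
      using assms H g by (intro reg_famD[of \<phi> D]) auto
    ultimately have "nzd (\<phi> g) (ideal_gen (insert (\<phi> h ^ Suc k) (\<phi> ` (H - {h}))))"
      unfolding eq2 by (rule nzd_insert_power)
    then show ?thesis using True g unfolding eq by auto
  next
    case False
    then have eq: "?\<psi> ` H = \<phi> ` H" by (intro image_cong) auto
    have "nzd (\<phi> g) (ideal_gen (\<phi> ` H))"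
      using assms H g by (intro reg_famD[of \<phi> D]) auto
    then show ?thesis unfolding eq by (auto intro: nzd_power simp del: power_Suc)
  qed
qed

lemma reg_fam_powers:
  assumes "reg_fam (\<lambda>f. f) D" "finite E" "E \<subseteq> D"
  shows "reg_fam (\<lambda>f. if f \<in> E then f ^ Suc (e f) else f) D"
  using assms(2,3)
proof (induction E)
  case empty
  then show ?case using assms(1) by simp
next
  case (insert h E)
  have eq: "(\<lambda>f. if f \<in> insert h E then f ^ Suc (e f) else f) =
     (\<lambda>f. if f \<in> E then f ^ Suc (e f) else f)(h := (\<lambda>f. if f \<in> E then f ^ Suc (e f) else f) h ^ Suc (e h))"
    using insert.hyps by (auto simp: fun_eq_iff)
  show ?case unfolding eq using insert by (intro reg_fam_upd_power) auto
qed

text \<open>The generators \<open>f^(e f + 1)\<close> are turned into \<open>f\<close> one at a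
  time, each time cancelling the factor \<open>f^(e f)\<close>, a nonzerodivisor modulo the other
  generators. In the induction, \<open>E\<close> holds the elements whose generator is still a
  power.\<close>

lemma reg_fam_mon_mem:
  assumes reg: "reg_fam (\<lambda>f. f) D" and "finite D"
    and r: "r * mon D e \<in> ideal_gen ((\<lambda>f. f ^ Suc (e f)) ` D)"
  shows "r \<in> ideal_gen D"
proof -
  let ?\<phi> = "\<lambda>E f. if f \<in> E then f ^ Suc (e f) else f"
  have "\<forall>r. r * mon E e \<in> ideal_gen (?\<phi> E ` D) \<longrightarrow> r \<in> ideal_gen D" if "finite E" "E \<subseteq> D" for E
    using that
  proof (induction E)
    case empty
    then show ?case by (simp add: mon_def)
  next
    case (insert h E)
    show ?case
    proof (intro allI impI)
      fix r assume r: "r * mon (insert h E) e \<in> ideal_gen (?\<phi> (insert h E) ` D)"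
      let ?J = "ideal_gen (?\<phi> E ` (D - {h}))"
      have "?\<phi> (insert h E) ` (D - {h}) = ?\<phi> E ` (D - {h})"
        by (intro image_cong) auto
      moreover have "D = insert h (D - {h})" using insert.prems by auto
      then have "?\<phi> (insert h E) ` D = insert (?\<phi> (insert h E) h) (?\<phi> (insert h E) ` (D - {h}))"
        by (rule ssubst[where P = "\<lambda>X. ?\<phi> (insert h E) ` X = _"]) (rule image_insert)
      ultimately have eq: "?\<phi> (insert h E) ` D = insert (h ^ Suc (e h)) (?\<phi> E ` (D - {h}))"
        by simp
      have "D = insert h (D - {h})" using insert.prems by auto
      then have "?\<phi> E ` D = insert (?\<phi> E h) (?\<phi> E ` (D - {h}))"
        by (rule ssubst[where P = "\<lambda>X. ?\<phi> E ` X = _"]) (rule image_insert)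
      then have eq2: "?\<phi> E ` D = insert h (?\<phi> E ` (D - {h}))"
        using insert.hyps by simp
      have "nzd (?\<phi> E h) ?J"
        using insert.prems insert.hyps by (intro reg_famD[OF reg_fam_powers[OF reg]]) auto
      then have hz: "nzd (h ^ e h) ?J" using insert.hyps by (intro nzd_power) auto
      obtain q where "r * mon (insert h E) e - q * h ^ Suc (e h) \<in> ?J"
        using r unfolding eq by (blast elim: ideal_gen_insertE)
      then have "(r * mon E e - q * h) * h ^ e h \<in> ?J"
        using insert.hyps by (simp add: mon_def algebra_simps)
      then have "r * mon E e - q * h \<in> ?J" by (rule nzdD[OF hz])
      then have "r * mon E e \<in> ideal_gen (?\<phi> E ` D)"
        unfolding eq2 by (rule ideal_gen_insertI)
      then show "r \<in> ideal_gen D" using insert by auto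
    qed
  qed
  from this[of D] assms(2) have "r * mon D e \<in> ideal_gen (?\<phi> D ` D) \<longrightarrow> r \<in> ideal_gen D"
    by blast
  moreover have "?\<phi> D ` D = (\<lambda>f. f ^ Suc (e f)) ` D" by (intro image_cong) auto
  ultimately show ?thesis using r by simp
qed

text \<open>The last element \<open>g\<close> is regular modulo all of \<open>gs\<close>; dropping
  elements of \<open>gs\<close> one by one through \<open>nzd_insert_imp\<close> gives all subsets.
  If \<open>g\<close> is among the generators, it is exchanged with \<open>f\<close> by
  \<open>nzd_insert_swap\<close>.\<close>

lemma reg_fam_of_regular_list:
  assumes "distinct fs"
    and "\<And>i. i < length fs \<Longrightarrow> nzd (fs ! i) (ideal_gen (set (take i fs)))"
    and sep: "\<And>H h. H \<subseteq> set fs \<Longrightarrow> h \<in> set fs \<Longrightarrow> separated (ideal_gen H) h"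
  shows "reg_fam (\<lambda>f. f) (set fs)"
  using assms
proof (induction fs rule: rev_induct)
  case Nil
  then show ?case by (simp add: reg_fam_def)
next
  case (snoc g gs)
  have IH: "reg_fam (\<lambda>f. f) (set gs)"
  proof (rule snoc.IH)
    fix i assume "i < length gs"
    then show "nzd (gs ! i) (ideal_gen (set (take i gs)))"
      using snoc.prems(2)[of i] by (simp add: nth_append)
  next
    fix H h assume "H \<subseteq> set gs" "h \<in> set gs"
    then show "separated (ideal_gen H) h" by (intro snoc.prems(3)) auto
  qed (use snoc.prems(1) in auto)
  have g0: "nzd g (ideal_gen (set gs))" using snoc.prems(2)[of "length gs"] by simp
  have g: "nzd g (ideal_gen (set gs - K))" if "K \<subseteq> set gs" for K
    using finite_subset[OF that finite_set] that
  proof (induction K rule: finite_induct)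
    case empty
    then show ?case using g0 by simp
  next
    case (insert h K)
    let ?H = "set gs - insert h K"
    have "insert h ?H = set gs - K" using insert by auto
    then have "nzd g (ideal_gen (insert h ?H))" using insert by auto
    moreover have "nzd h (ideal_gen ?H)"
      using reg_famD[OF IH, of ?H h] insert by auto
    moreover have "separated (ideal_gen ?H) h"
      by (rule snoc.prems(3)) (use insert in auto)
    ultimately show ?case using nzd_insert_imp by blast
  qed
  have g': "nzd g (ideal_gen H)" if "H \<subseteq> set gs" for H
  proof -
    have "set gs - (set gs - H) = H" using that by auto
    then show ?thesis using g[of "set gs - H"] by auto
  qed
  show ?case unfolding reg_fam_def
  proof (intro allI impI ballI)
    fix H f assume H: "H \<subseteq> set (gs @ [g])" and f: "f \<in> set (gs @ [g]) - H"
    have gn: "g \<notin> set gs" using snoc.prems by auto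
    show "nzd f (ideal_gen ((\<lambda>f. f) ` H))"
    proof (cases "f = g")
      case True
      then show ?thesis using H f by (auto intro!: g')
    next
      case fg: False
      show ?thesis
      proof (cases "g \<in> H")
        case False
        then show ?thesis using H f fg reg_famD[OF IH, of H f] by auto
      next
        case True
        let ?H = "H - {g}"
        have eq: "H = insert g ?H" using True by auto
        have "nzd f (ideal_gen ?H)" using H f fg reg_famD[OF IH, of ?H f] by auto
        moreover have "nzd g (ideal_gen (insert f ?H))" using H f fg by (intro g') auto
        ultimately have "nzd f (ideal_gen (insert g ?H))" by (rule nzd_insert_swap)
        then show ?thesis using eq by simp
      qed
    qed
  qed
qed

lemma ideal_gen_imageE:
  assumes "x \<in> ideal_gen (\<phi> ` A)"
  obtains A0 r where "finite A0" "A0 \<subseteq> A" "x = (\<Sum>a\<in>A0. r a * \<phi> a)"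
proof -
  have "\<exists>A0 r. finite A0 \<and> A0 \<subseteq> A \<and> x = (\<Sum>a\<in>A0. r a * \<phi> a)"
    using assms
  proof (induction rule: ring_ideal.span_induct_alt)
    case base
    show ?case by (intro exI[of _ "{}"]) simp
  next
    case (step c x y)
    then obtain A0 r a where A0: "finite A0" "A0 \<subseteq> A" "y = (\<Sum>a\<in>A0. r a * \<phi> a)"
      and a: "a \<in> A" "x = \<phi> a" by blast
    let ?r = "r(a := c + (if a \<in> A0 then r a else 0))"
    have "(\<Sum>b\<in>insert a A0. ?r b * \<phi> b) = ?r a * \<phi> a + (\<Sum>b\<in>A0 - {a}. ?r b * \<phi> b)"
      using A0(1) by (simp add: sum.insert_remove)
    also have "(\<Sum>b\<in>A0 - {a}. ?r b * \<phi> b) = (\<Sum>b\<in>A0 - {a}. r b * \<phi> b)"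
      by (intro sum.cong) auto
    also have "?r a * \<phi> a + \<dots> = c * x + y"
      using A0(1) unfolding A0(3) a(2)
      by (auto simp: sum.remove[of A0 a] distrib_right add.assoc)
    finally show ?case using A0(1,2) a(1)
      by (intro exI[of _ "insert a A0"] exI[of _ ?r]) auto
  qed
  then show ?thesis using that by blast
qed

section \<open>Monomials in the elements of \<open>F\<close>\<close>

lemma mon_add: "mon F (\<lambda>j. e j + g j) = mon F e * mon F g"
  by (simp add: mon_def power_add prod.distrib)

lemma mon_cong: "(\<And>j. j \<in> F \<Longrightarrow> e j = g j) \<Longrightarrow> mon F e = mon F g"
  by (simp add: mon_def)

lemma mon_le: "(\<And>j. j \<in> F \<Longrightarrow> e j \<le> g j) \<Longrightarrow> mon F g = mon F (\<lambda>j. g j - e j) * mon F e"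
  unfolding mon_add[symmetric] by (rule mon_cong) simp

lemma mon_split: "finite F \<Longrightarrow> D \<subseteq> F \<Longrightarrow> mon F e = mon (F - D) e * mon D e"
  unfolding mon_def by (rule prod.subset_diff) auto

lemma mon_upd_Suc:
  assumes "finite F" "f \<in> F"
  shows "mon F (e(f := Suc (e f))) = f * mon F e"
  using assms by (simp add: mon_def prod.remove[of F f] mult.assoc)

lemma mon_mem_factor: "finite F \<Longrightarrow> f \<in> F \<Longrightarrow> k \<le> e f \<Longrightarrow> \<exists>r. mon F e = r * f ^ k"
  unfolding mon_def by (metis dvd_def dvd_prodI dvd_trans le_imp_power_dvd mult.commute)

lemma mon_mem_irr:
  assumes "finite F" "D \<subseteq> F" "j \<in> D" "e j < g j"
  shows "mon F g \<in> ideal_gen ((\<lambda>f. f ^ Suc (e f)) ` D)"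
proof -
  obtain r where "mon F g = r * j ^ Suc (e j)"
    using mon_mem_factor[of F j "Suc (e j)" g] assms by auto
  then show ?thesis using assms(3)
    by (auto intro!: ideal_scale_base simp del: power_Suc)
qed

lemma mon_mem_ideal:
  assumes "e \<in> X" "\<And>j. j \<in> F \<Longrightarrow> e j \<le> g j"
  shows "mon F g \<in> ideal_gen (mon F ` X)"
  using assms mon_le[of F e g] by (auto intro!: ideal_scale_base)

section \<open>Subsets of least weight\<close>

text \<open>\<open>D - C\<close> and \<open>C - D\<close> have equal size, and the largest value
  \<open>t\<close> on the first lies below every value on the second.\<close>

lemma sum_less_of_lower:
  fixes v :: "'b \<Rightarrow> nat"
  assumes fin: "finite F" and sub: "D \<subseteq> F" "C \<subseteq> F" and card: "card C = card D" and ne: "C \<noteq> D"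
    and low: "\<And>i j. i \<in> D \<Longrightarrow> j \<in> F - D \<Longrightarrow> v i < v j"
  shows "sum v D < sum v C"
proof -
  have finC: "finite C" "finite D" using fin sub finite_subset by auto
  have cd: "card (D - C) = card (C - D)"
    using finC card by (simp add: card_Diff_subset_Int Int_commute)
  have "D - C \<noteq> {}"
  proof
    assume "D - C = {}"
    then have "D \<subseteq> C" by auto
    then show False using card_subset_eq[OF finC(1)] card ne by auto
  qed
  define t where "t = Max (v ` (D - C))"
  have "t \<in> v ` (D - C)" unfolding t_def using finC \<open>D - C \<noteq> {}\<close> by (intro Max_in) auto
  then have t: "t < v j" if "j \<in> C - D" for j using low that sub by auto
  have "sum v (D - C) \<le> (\<Sum>i\<in>D - C. t)"
    using finC by (intro sum_mono) (auto simp: t_def)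
  also have "\<dots> < (\<Sum>i\<in>D - C. Suc t)"
    using finC \<open>D - C \<noteq> {}\<close> by (intro sum_strict_mono) auto
  also have "\<dots> = (\<Sum>i\<in>C - D. Suc t)" using cd by simp
  also have "\<dots> \<le> sum v (C - D)" using t by (intro sum_mono) (auto simp: Suc_le_eq)
  finally have "sum v (D - C) + sum v (C \<inter> D) < sum v (C - D) + sum v (C \<inter> D)" by simp
  moreover have "sum v (D - C) + sum v (C \<inter> D) = sum v D"
    using sum.Int_Diff[OF finC(2), of v C] by (simp add: Int_commute)
  moreover have "sum v (C - D) + sum v (C \<inter> D) = sum v C"
    using sum.Int_Diff[OF finC(1), of v D] by simp
  ultimately show ?thesis by simp
qed

lemma exists_lower_subset:
  fixes v :: "'b \<Rightarrow> nat"
  assumes "finite F" "inj_on v F" "c \<le> card F"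
  shows "\<exists>D\<subseteq>F. card D = c \<and> (\<forall>i\<in>D. \<forall>j\<in>F - D. v i < v j)"
  using assms(3)
proof (induction c)
  case 0
  then show ?case by (intro exI[of _ "{}"]) auto
next
  case (Suc c)
  then obtain D where D: "D \<subseteq> F" "card D = c" "\<forall>i\<in>D. \<forall>j\<in>F - D. v i < v j" by auto
  have "finite D" using D assms finite_subset by auto
  have "F - D \<noteq> {}" using D Suc.prems by (auto simp: Diff_eq_empty_iff)
  then obtain j where j: "j \<in> F - D" "\<And>i. i \<in> F - D \<Longrightarrow> v j \<le> v i"
    using ex_min_if_finite[of "v ` (F - D)"] assms(1) by (metis finite_Diff arg_min_if_finite(1) arg_min_least)
  have "v j < v i" if "i \<in> F - insert j D" for i
    using j(2)[of i] inj_onD[OF assms(2), of j i] that j(1) by fastforce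
  then show ?case using D j \<open>finite D\<close> by (intro exI[of _ "insert j D"]) auto
qed

section \<open>Star configuration ideals\<close>

text \<open>The set \<open>F\<close> may have more elements than the ring has variables, so its elements do not behave like
  independent variables; any \<open>c + 1\<close> of them do.\<close>

locale star =
  fixes F :: "'a::comm_ring_1 set" and c :: nat
  assumes finF: "finite F" and c_le: "c \<le> card F"
    and reg: "\<And>D. D \<subseteq> F \<Longrightarrow> card D = c \<Longrightarrow> reg_fam (\<lambda>f. f) D"
    and nzd_F: "\<And>D f. D \<subseteq> F \<Longrightarrow> card D = c \<Longrightarrow> f \<in> F - D \<Longrightarrow> nzd f (ideal_gen D)"
begin

definition expo :: "nat \<Rightarrow> ('a \<Rightarrow> nat) set" where
  "expo M = {e. \<forall>C\<subseteq>F. card C = c \<longrightarrow> M \<le> sum e C}"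

definition star_ideal :: "nat \<Rightarrow> 'a set" where
  "star_ideal M = ideal_gen (mon F ` expo M)"

definition iota :: "'a \<Rightarrow> nat" where "iota = to_nat_on F"

text \<open>Larger than every sum of \<open>iota\<close> over a subset of \<open>F\<close>, so the
  tie-breaking never reverses a strict inequality between sums of exponents.\<close>

definition scl :: nat where "scl = Suc (sum iota F)"

text \<open>The summand \<open>iota j\<close> breaks ties, so that exactly one subset has least weight.\<close>

definition wgt :: "('a \<Rightarrow> nat) \<Rightarrow> 'a \<Rightarrow> nat" where
  "wgt e j = scl * e j + iota j"

definition order_of :: "('a \<Rightarrow> nat) \<Rightarrow> nat" where
  "order_of e = Min (sum (wgt e) ` {C. C \<subseteq> F \<and> card C = c})"

definition low :: "('a \<Rightarrow> nat) \<Rightarrow> 'a set \<Rightarrow> bool" where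
  "low e D \<longleftrightarrow> D \<subseteq> F \<and> card D = c \<and> (\<forall>i\<in>D. \<forall>j\<in>F - D. wgt e i < wgt e j)"

text \<open>On \<open>F\<close>, the least exponent that equals \<open>e\<close> on \<open>D\<close>
  and has \<open>D\<close> as its lowest subset. It is to depend only on the values of
  \<open>e\<close> on \<open>D\<close>, whence the default 0 outside \<open>F\<close>.\<close>

definition can :: "'a set \<Rightarrow> ('a \<Rightarrow> nat) \<Rightarrow> 'a \<Rightarrow> nat" where
  "can D e j = (if j \<in> D then e j else if j \<in> F then (LEAST k. \<forall>i\<in>D. wgt e i < scl * k + iota j) else 0)"

text \<open>These monomials generate \<open>filt k\<close> modulo \<open>filt (Suc k)\<close>; each
  is determined by its lowest subset and its values there.\<close>

definition can_set :: "nat \<Rightarrow> ('a \<Rightarrow> nat) set" where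
  "can_set k = {e. order_of e = k \<and> (\<exists>D. low e D \<and> e = can D e)}"

definition filt :: "nat \<Rightarrow> 'a set" where
  "filt k = ideal_gen (mon F ` {e. k \<le> order_of e})"

lemma scl_pos: "0 < scl"
  by (simp add: scl_def)

lemma iota_less: "j \<in> F \<Longrightarrow> iota j < scl"
  unfolding scl_def using member_le_sum[of j F iota] finF by auto

lemma sum_iota_less: "C \<subseteq> F \<Longrightarrow> sum iota C < scl"
  unfolding scl_def using sum_mono2[of F C iota] finF by auto

lemma inj_wgt: "inj_on (wgt e) F"
proof (rule inj_onI)
  fix i j assume ij: "i \<in> F" "j \<in> F" "wgt e i = wgt e j"
  have "iota i = wgt e i mod scl" using iota_less[OF ij(1)] by (simp add: wgt_def)
  also have "\<dots> = iota j" using iota_less[OF ij(2)] ij(3) by (simp add: wgt_def)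
  finally show "i = j"
    using ij finF inj_on_to_nat_on[OF countable_finite[OF finF]] by (auto simp: iota_def dest: inj_onD)
qed

lemma low_ex: "\<exists>D. low e D"
  using exists_lower_subset[OF finF inj_wgt c_le, of e] by (auto simp: low_def)

lemma low_less: "low e D \<Longrightarrow> C \<subseteq> F \<Longrightarrow> card C = c \<Longrightarrow> C \<noteq> D \<Longrightarrow> sum (wgt e) D < sum (wgt e) C"
  by (rule sum_less_of_lower[OF finF]) (auto simp: low_def)

lemma fin_subsets: "finite {C. C \<subseteq> F \<and> card C = c}"
  using finF by simp

lemma order_of_le: "C \<subseteq> F \<Longrightarrow> card C = c \<Longrightarrow> order_of e \<le> sum (wgt e) C"
  unfolding order_of_def using fin_subsets by (intro Min_le) auto

lemma order_of_low: "low e D \<Longrightarrow> order_of e = sum (wgt e) D"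
  unfolding order_of_def
proof (rule Min_eqI)
  assume D: "low e D"
  show "sum (wgt e) D \<le> y" if "y \<in> sum (wgt e) ` {C. C \<subseteq> F \<and> card C = c}" for y
  proof -
    obtain C where C: "y = sum (wgt e) C" "C \<subseteq> F" "card C = c" using \<open>y \<in> _\<close> by blast
    show ?thesis using low_less[OF D C(2,3)] unfolding C(1) by (cases "C = D") (auto intro: less_imp_le)
  qed
  show "sum (wgt e) D \<in> sum (wgt e) ` {C. C \<subseteq> F \<and> card C = c}"
    using D by (auto simp: low_def)
qed (use fin_subsets in auto)

lemma low_if_min:
  assumes "D \<subseteq> F" "card D = c" "sum (wgt e) D \<le> order_of e"
  shows "low e D"
proof -
  obtain D' where D': "low e D'" using low_ex by blast
  then have "D = D'" using low_less[OF D' assms(1,2)] order_of_low[OF D'] assms(3) by auto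
  then show ?thesis using D' by simp
qed

lemma low_unique: "low e D \<Longrightarrow> low e D' \<Longrightarrow> D = D'"
  using low_less[of e D D'] low_less[of e D' D] unfolding low_def by fastforce

text \<open>The summands \<open>iota\<close> over a subset add up to less than \<open>scl\<close>,
  so thresholds that are multiples of \<open>scl\<close> see only the unperturbed sums.\<close>

lemma order_of_ge_iff: "scl * M \<le> order_of e \<longleftrightarrow> e \<in> expo M"
proof
  assume *: "scl * M \<le> order_of e"
  show "e \<in> expo M" unfolding expo_def
  proof (intro CollectI allI impI)
    fix C assume C: "C \<subseteq> F" "card C = c"
    have "scl * M \<le> sum (wgt e) C" using * order_of_le[OF C, of e] by simp
    also have "\<dots> < scl * sum e C + scl"
      using sum_iota_less[OF C(1)] by (simp add: wgt_def sum.distrib sum_distrib_left)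
    also have "\<dots> = scl * Suc (sum e C)" by simp
    finally show "M \<le> sum e C" by (simp only: mult_less_cancel1 less_Suc_eq_le)
  qed
next
  assume *: "e \<in> expo M"
  obtain D where D: "low e D" using low_ex by blast
  then have "M \<le> sum e D" using * by (auto simp: expo_def low_def)
  then have "scl * M \<le> scl * sum e D" by simp
  also have "\<dots> \<le> sum (wgt e) D" by (simp add: wgt_def sum.distrib sum_distrib_left)
  finally show "scl * M \<le> order_of e" using order_of_low[OF D] by simp
qed

section \<open>Canonical exponents and their lowest subsets\<close>

lemma can_cong: "(\<And>i. i \<in> D \<Longrightarrow> e i = e' i) \<Longrightarrow> can D e = can D e'"
  by (auto simp: can_def wgt_def fun_eq_iff)

lemma can_eq: "j \<in> D \<Longrightarrow> can D e j = e j"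
  by (simp add: can_def)

lemma can_low:
  assumes "D \<subseteq> F" "card D = c"
  shows "low (can D e) D"
  unfolding low_def
proof (intro conjI ballI)
  fix i j assume i: "i \<in> D" and j: "j \<in> F - D"
  have finD: "finite D" using assms finF finite_subset by auto
  let ?P = "\<lambda>k. \<forall>i\<in>D. wgt e i < scl * k + iota j"
  \<comment> \<open>Some value must satisfy the condition for \<open>LEAST\<close> to be meaningful;
    a sum over \<open>D\<close> bounds each of its terms.\<close>
  have "?P (Suc (sum (wgt e) D))"
  proof
    fix i assume "i \<in> D"
    then have "wgt e i \<le> sum (wgt e) D" using finD by (intro member_le_sum) auto
    also have "\<dots> < Suc (sum (wgt e) D)" by simp
    also have "\<dots> \<le> scl * Suc (sum (wgt e) D)" by (simp add: scl_def)
    finally show "wgt e i < scl * Suc (sum (wgt e) D) + iota j" by simp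
  qed
  then have "?P (LEAST k. ?P k)" by (rule LeastI)
  then have "wgt e i < scl * can D e j + iota j" using i j by (simp add: can_def)
  then show "wgt (can D e) i < wgt (can D e) j" using i by (simp add: wgt_def can_eq)
qed (use assms in auto)

lemma can_le:
  assumes "low e D" "j \<in> F"
  shows "can D e j \<le> e j"
proof (cases "j \<in> D")
  case False
  then have "\<forall>i\<in>D. wgt e i < scl * e j + iota j" using assms by (auto simp: low_def wgt_def)
  then show ?thesis using False assms(2) by (auto simp: can_def intro: Least_le)
qed (simp add: can_eq)

lemma order_of_can:
  assumes "low e D"
  shows "order_of (can D e) = order_of e"
proof -
  have "low (can D e) D" using assms by (intro can_low) (auto simp: low_def)
  then show ?thesis using order_of_low[OF assms] order_of_low[of "can D e" D]
    by (simp add: wgt_def can_eq cong: sum.cong)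
qed

lemma can_in_can_set: "low e D \<Longrightarrow> can D e \<in> can_set (order_of e)"
  unfolding can_set_def using order_of_can can_low can_cong[of D "can D e" e]
  by (auto simp: low_def can_eq intro!: exI[of _ D])

text \<open>The weight of \<open>D\<close> under \<open>g\<close> is at most its weight under
  \<open>e\<close>, which is the order of \<open>e\<close> and so at most the order of
  \<open>g\<close>. All these inequalities are then equalities.\<close>

lemma le_on_low:
  assumes e: "low e D" and "order_of e \<le> order_of g" and le: "\<And>j. j \<in> D \<Longrightarrow> g j \<le> e j"
  shows "low g D" "\<And>j. j \<in> D \<Longrightarrow> g j = e j" "order_of g = order_of e"
proof -
  have D: "D \<subseteq> F" "card D = c" using e by (auto simp: low_def)
  have finD: "finite D" using D finF finite_subset by auto
  have le': "wgt g j \<le> wgt e j" if "j \<in> D" for j using le[OF that] by (simp add: wgt_def)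
  then have s: "sum (wgt g) D \<le> sum (wgt e) D" by (rule sum_mono)
  also have "\<dots> = order_of e" using order_of_low[OF e] by simp
  finally show g: "low g D" using assms(2) by (intro low_if_min D) simp
  show eq: "order_of g = order_of e"
    using s assms(2) order_of_low[OF g] order_of_low[OF e] by simp
  show "g j = e j" if "j \<in> D" for j
  proof (rule ccontr)
    assume "g j \<noteq> e j"
    then have "wgt g j < wgt e j" using le[OF that] by (simp add: wgt_def scl_pos)
    then have "sum (wgt g) D < sum (wgt e) D"
      using le' that finD by (intro sum_strict_mono_ex1) auto
    then show False using order_of_low[OF g] order_of_low[OF e] eq by simp
  qed
qed

text \<open>Here uniqueness of the lowest subset is decisive: \<open>D\<close> gains weight, and
  every other subset was strictly heavier already.\<close>

lemma order_of_upd_Suc: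
  assumes "low e D" "j \<in> D"
  shows "order_of e < order_of (e(j := Suc (e j)))"
proof -
  let ?e = "e(j := Suc (e j))"
  obtain D' where D': "low ?e D'" using low_ex by blast
  have finD: "finite D" "finite D'" using D' assms finF finite_subset by (auto simp: low_def)
  have le: "wgt e i \<le> wgt ?e i" for i by (simp add: wgt_def)
  have "sum (wgt e) D < sum (wgt ?e) D'"
  proof (cases "D' = D")
    case True
    have "wgt e j < wgt ?e j" by (simp add: wgt_def scl_pos)
    then show ?thesis unfolding True using le assms(2) finD by (intro sum_strict_mono_ex1) auto
  next
    case False
    then have "sum (wgt e) D < sum (wgt e) D'"
      using low_less[OF assms(1)] D' by (auto simp: low_def)
    also have "\<dots> \<le> sum (wgt ?e) D'" by (intro sum_mono le)
    finally show ?thesis .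
  qed
  then show ?thesis using order_of_low[OF assms(1)] order_of_low[OF D'] by simp
qed

section \<open>The filtration and its quotients\<close>

lemma filt_eq: "filt k = ideal_gen (mon F ` can_set k \<union> mon F ` {e. Suc k \<le> order_of e})" (is "_ = ?R")
proof
  have "mon F e \<in> ?R" if "k \<le> order_of e" for e
  proof (cases "k = order_of e")
    case True
    obtain D where D: "low e D" using low_ex by blast
    then have "mon F e \<in> ideal_gen (mon F ` can_set k)"
      unfolding True by (intro mon_mem_ideal[OF can_in_can_set] can_le)
    then show ?thesis using ring_ideal.span_mono[of "mon F ` can_set k"] by blast
  next
    case False
    then show ?thesis using that by (intro ring_ideal.span_base) auto
  qed
  then show "filt k \<subseteq> ?R" unfolding filt_def by (intro ring_ideal.span_minimal) auto
  show "?R \<subseteq> filt k" unfolding filt_def by (intro ring_ideal.span_mono) (auto simp: can_set_def)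
qed

lemma ideal_times_mon_filt:
  assumes "low e D" "r \<in> ideal_gen D"
  shows "r * mon F e \<in> filt (Suc (order_of e))"
  using assms(2)
proof (induction rule: ring_ideal.span_induct_alt)
  case base
  then show ?case by (simp add: filt_def ring_ideal.span_zero)
next
  case (step a f y)
  have "f * mon F e = mon F (e(f := Suc (e f)))"
    using step(1) assms(1) finF by (intro mon_upd_Suc[symmetric]) (auto simp: low_def)
  also have "\<dots> \<in> filt (Suc (order_of e))"
    unfolding filt_def using order_of_upd_Suc[OF assms(1) step(1)]
    by (intro ring_ideal.span_base) auto
  finally have "y * mon F e + a * (f * mon F e) \<in> filt (Suc (order_of e))"
    using step(2) unfolding filt_def by (intro ideal_add_scale)
  moreover have "(a * f + y) * mon F e = y * mon F e + a * (f * mon F e)"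
    by (simp add: algebra_simps)
  ultimately show ?case by simp
qed

text \<open>By \<open>le_on_low\<close>, a monomial of at least the same order that nowhere exceeds
  \<open>e\<close> on \<open>D\<close> agrees with it there. The powers \<open>f^(e f + 1)\<close>
  thus remove all other monomials and isolate that of \<open>e\<close>.\<close>

lemma irr_mem:
  assumes e: "low e D" and g: "order_of e \<le> order_of g" and "\<not> (low g D \<and> (\<forall>j\<in>D. g j = e j))"
  shows "mon F g \<in> ideal_gen ((\<lambda>f. f ^ Suc (e f)) ` D)"
proof -
  have "\<exists>j\<in>D. e j < g j" using le_on_low[OF e g] assms(3) by (meson not_less)
  then show ?thesis using e finF by (auto intro!: mon_mem_irr simp: low_def simp del: power_Suc)
qed

text \<open>For each canonical \<open>e\<close> in a representation of \<open>r\<close>, reduction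
  modulo the powers \<open>f^(e f + 1)\<close> with \<open>f \<in> D\<close> removes all other terms
  of \<open>u * r\<close>. What remains forces the coefficient of \<open>e\<close> into
  \<open>(D)\<close>, and then its term has higher order.\<close>

lemma filt_step:
  assumes u: "\<And>D. D \<subseteq> F \<Longrightarrow> card D = c \<Longrightarrow> nzd u (ideal_gen D)"
    and r: "r \<in> filt k" and ur: "u * r \<in> filt (Suc k)"
  shows "r \<in> filt (Suc k)"
proof -
  obtain x y where xy: "r = x + y" "x \<in> ideal_gen (mon F ` can_set k)" "y \<in> filt (Suc k)"
    using r filt_eq[of k] ring_ideal.span_Un[of "mon F ` can_set k"] filt_def[of "Suc k"] by auto
  obtain A \<rho> where A: "finite A" "A \<subseteq> can_set k" "x = (\<Sum>e\<in>A. \<rho> e * mon F e)"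
    using xy(2) by (rule ideal_gen_imageE)
  have "\<rho> e * mon F e \<in> filt (Suc k)" if e: "e \<in> A" for e
  proof -
    obtain D where D: "low e D" "e = can D e" and ek: "order_of e = k"
      using e A(2) by (auto simp: can_set_def)
    let ?I = "(\<lambda>f. f ^ Suc (e f)) ` D"
    have DF: "D \<subseteq> F" "card D = c" "finite D" using D finF finite_subset by (auto simp: low_def)
    have sub: "filt (Suc k) \<subseteq> ideal_gen ?I" unfolding filt_def
    proof (intro ring_ideal.span_minimal)
      show "mon F ` {e. Suc k \<le> order_of e} \<subseteq> ideal_gen ?I"
      proof (intro image_subsetI irr_mem[OF D(1)] notI)
        fix g assume "g \<in> {e. Suc k \<le> order_of e}" "low g D \<and> (\<forall>j\<in>D. g j = e j)"
        then show False using le_on_low(3)[OF D(1), of g] ek by simp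
      qed (use ek in auto)
    qed auto
    \<comment> \<open>Another canonical exponent with the same lowest subset cannot agree with
      \<open>e\<close> on \<open>D\<close>, because \<open>D\<close> and the values on
      \<open>D\<close> determine it.\<close>
    have oth: "mon F g \<in> ideal_gen ?I" if "g \<in> A - {e}" for g
    proof (rule irr_mem[OF D(1)])
      show "\<not> (low g D \<and> (\<forall>j\<in>D. g j = e j))"
      proof
        assume *: "low g D \<and> (\<forall>j\<in>D. g j = e j)"
        obtain D' where "low g D'" "g = can D' g"
          using \<open>g \<in> A - {e}\<close> A(2) by (auto simp: can_set_def)
        then have "g = can D g" using low_unique * by blast
        also have "\<dots> = can D e" using * by (intro can_cong) auto
        finally show False using D(2) that by simp
      qed
    qed (use that A(2) ek in \<open>auto simp: can_set_def\<close>)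
    have "u * (\<rho> e * mon F e) = u * r - u * y - (\<Sum>g\<in>A - {e}. u * \<rho> g * mon F g)"
      unfolding xy(1) A(3) using A(1) e
      by (simp add: sum.remove[of A e] algebra_simps sum_distrib_left)
    also have "\<dots> \<in> ideal_gen ?I"
      using sub ur xy(3) oth
      by (intro ring_ideal.span_diff ring_ideal.span_sum) (auto intro: ring_ideal.span_scale simp del: power_Suc)
    finally have "(\<rho> e * (u * mon (F - D) e)) * mon D e \<in> ideal_gen ?I"
      unfolding mon_split[OF finF DF(1)] by (simp add: ac_simps)
    then have *: "\<rho> e * (u * mon (F - D) e) \<in> ideal_gen D"
      by (rule reg_fam_mon_mem[OF reg[OF DF(1,2)] DF(3)])
    have "nzd (mon (F - D) e) (ideal_gen D)"
      unfolding mon_def using nzd_F[OF DF(1,2)] by (intro nzd_prod nzd_power) auto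
    then have "nzd (u * mon (F - D) e) (ideal_gen D)" using u[OF DF(1,2)] by (intro nzd_mult)
    then have "\<rho> e \<in> ideal_gen D" using * by (rule nzdD)
    then show ?thesis using ideal_times_mon_filt[OF D(1)] ek by simp
  qed
  then have "x \<in> filt (Suc k)" unfolding A(3) filt_def by (rule ring_ideal.span_sum)
  then show ?thesis using xy unfolding filt_def by (auto intro: ring_ideal.span_add)
qed

lemma star_ideal_eq_filt: "star_ideal M = filt (scl * M)"
  unfolding star_ideal_def filt_def order_of_ge_iff by simp

lemma filt_antimono: "k \<le> l \<Longrightarrow> filt l \<subseteq> filt k"
  unfolding filt_def by (intro ring_ideal.span_mono) auto

lemma filt_0: "filt 0 = UNIV"
proof -
  have "mon F (\<lambda>_. 0) \<in> filt 0" unfolding filt_def by (intro ring_ideal.span_base) auto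
  then have "1 \<in> filt 0" by (simp add: mon_def)
  then have "x * 1 \<in> filt 0" for x unfolding filt_def by (rule ring_ideal.span_scale)
  then show ?thesis by auto
qed

text \<open>The element \<open>r\<close> climbs by \<open>filt_step\<close> from
  \<open>filt 0\<close>, which is the whole ring.\<close>

lemma nzd_star_ideal:
  assumes u: "\<And>D. D \<subseteq> F \<Longrightarrow> card D = c \<Longrightarrow> nzd u (ideal_gen D)"
  shows "nzd u (star_ideal M)"
proof (rule nzdI)
  fix r assume "r * u \<in> star_ideal M"
  then have ur: "u * r \<in> filt (scl * M)" by (simp add: star_ideal_eq_filt mult.commute)
  have "r \<in> filt k" if "k \<le> scl * M" for k
    using that
  proof (induction k)
    case 0
    then show ?case by (simp add: filt_0)
  next
    case (Suc k)
    show ?case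
    proof (rule filt_step)
      show "nzd u (ideal_gen D)" if "D \<subseteq> F" "card D = c" for D using that by (rule u)
      show "u * r \<in> filt (Suc k)" using ur filt_antimono[OF Suc.prems] by blast
    qed (use Suc in auto)
  qed
  then show "r \<in> star_ideal M" by (simp add: star_ideal_eq_filt)
qed

lemma star_ideal_0: "star_ideal 0 = UNIV"
  using filt_0 by (simp add: star_ideal_eq_filt)

text \<open>The hypothesis places \<open>r\<close> in the \<open>M\<close>-th power of every
  \<open>(C)\<close>. The factor \<open>?m C\<close> carries that power into the star ideal, and
  modulo \<open>(D)\<close> the sum \<open>u\<close> of these factors reduces to the nonzerodivisor
  \<open>?m D\<close>.\<close>

lemma inter_sub_star_ideal:
  assumes r: "\<And>C. C \<subseteq> F \<Longrightarrow> card C = c \<Longrightarrow> r \<in> ideal_gen (mon C ` {e. M \<le> sum e C})"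
  shows "r \<in> star_ideal M"
proof (cases "M = 0")
  \<comment> \<open>For \<open>M = 0\<close> every \<open>?m C\<close> is 1, and the reduction of
    \<open>u\<close> modulo \<open>(D)\<close> breaks down.\<close>
  case True
  then show ?thesis by (simp add: star_ideal_0)
next
  case False
  let ?m = "\<lambda>C. mon (F - C) (\<lambda>_. M)"
  define u where "u = (\<Sum>C | C \<subseteq> F \<and> card C = c. ?m C)"
  have "?m C * r \<in> star_ideal M" if C: "C \<subseteq> F" "card C = c" for C
    using r[OF C]
  proof (induction rule: ring_ideal.span_induct_alt)
    case base
    then show ?case by (simp add: star_ideal_def ring_ideal.span_zero)
  next
    case (step a x y)
    then obtain e where e: "x = mon C e" "M \<le> sum e C" by auto
    \<comment> \<open>A subset of size \<open>c\<close> other than \<open>C\<close> has an element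
      outside \<open>C\<close>, where the exponent is already \<open>M\<close>.\<close>
    let ?g = "\<lambda>j. if j \<in> C then e j else M"
    have "mon F ?g = ?m C * x"
      unfolding mon_split[OF finF C(1)] e(1) using mon_cong[of C ?g e] mon_cong[of "F - C" ?g "\<lambda>_. M"]
      by simp
    moreover have "?g \<in> expo M" unfolding expo_def
    proof (intro CollectI allI impI)
      fix C' assume C': "C' \<subseteq> F" "card C' = c"
      show "M \<le> sum ?g C'"
      proof (cases "C' \<subseteq> C")
        case True
        then have "C' = C" using C C' finF card_subset_eq finite_subset by metis
        then show ?thesis using e(2) by simp
      next
        case False
        then obtain j where "j \<in> C'" "j \<notin> C" by auto
        moreover have "finite C'" using C' finF finite_subset by auto
        ultimately show ?thesis using member_le_sum[of j C' ?g] by auto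
      qed
    qed
    then have "mon F ?g \<in> star_ideal M"
      unfolding star_ideal_def by (intro ring_ideal.span_base imageI)
    ultimately have "?m C * x \<in> star_ideal M" by simp
    then have "?m C * y + a * (?m C * x) \<in> star_ideal M"
      using step(2) unfolding star_ideal_def by (intro ideal_add_scale)
    moreover have "?m C * (a * x + y) = ?m C * y + a * (?m C * x)"
      by (simp add: algebra_simps)
    ultimately show ?case by simp
  qed
  then have "u * r \<in> star_ideal M"
    unfolding u_def sum_distrib_right star_ideal_def by (intro ring_ideal.span_sum) auto
  moreover have "nzd u (ideal_gen D)" if D: "D \<subseteq> F" "card D = c" for D
  proof (rule nzd_cong_ideal)
    show "nzd (?m D) (ideal_gen D)"
      unfolding mon_def using nzd_F[OF D] by (intro nzd_prod nzd_power) auto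
    have "?m C \<in> ideal_gen D" if C: "C \<subseteq> F" "card C = c" "C \<noteq> D" for C
    proof -
      have "\<not> D \<subseteq> C" using C D finF card_subset_eq finite_subset by metis
      then obtain f where f: "f \<in> D" "f \<notin> C" by auto
      then obtain q where "?m C = q * f ^ 1"
        using mon_mem_factor[of "F - C" f 1 "\<lambda>_. M"] False finF D by auto
      then show ?thesis using f(1) by (auto intro!: ideal_scale_base)
    qed
    then have "(\<Sum>C\<in>{C. C \<subseteq> F \<and> card C = c} - {D}. ?m C) \<in> ideal_gen D"
      by (intro ring_ideal.span_sum) auto
    moreover have "u = ?m D + (\<Sum>C\<in>{C. C \<subseteq> F \<and> card C = c} - {D}. ?m C)"
      unfolding u_def using fin_subsets D by (intro sum.remove) auto
    ultimately show "?m D - u \<in> ideal_gen D" using ring_ideal.span_neg by fastforce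
  qed
  ultimately show ?thesis using nzdD[OF nzd_star_ideal, of u r M] by (simp add: mult.commute)
qed

end

section \<open>Prime ideals\<close>

lemma prime_idealD: "is_prime_ideal P \<Longrightarrow> x * y \<in> P \<Longrightarrow> x \<in> P \<or> y \<in> P"
  by (auto simp: is_prime_ideal_def)

lemma prime_ideal_one:
  assumes "is_prime_ideal P"
  shows "1 \<notin> P"
proof
  assume "1 \<in> P"
  then have "x * 1 \<in> P" for x
    using assms by (auto simp: is_prime_ideal_def dest: ring_ideal.subspace_scale)
  then show False using assms by (auto simp: is_prime_ideal_def)
qed

lemma prime_ideal_power: "is_prime_ideal P \<Longrightarrow> x ^ k \<in> P \<Longrightarrow> x \<in> P"
  by (induction k) (auto dest: prime_idealD simp: prime_ideal_one)

lemma prime_ideal_prod: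
  assumes "is_prime_ideal P" "prod g A \<in> P"
  shows "\<exists>i\<in>A. g i \<in> P"
  using assms(2)
proof (induction A rule: infinite_finite_induct)
  case (insert x A)
  then show ?case using prime_idealD[OF assms(1)] by auto
qed (use prime_ideal_one[OF assms(1)] in auto)

lemma ideal_gen_sub_prime: "is_prime_ideal P \<Longrightarrow> S \<subseteq> P \<Longrightarrow> ideal_gen S \<subseteq> P"
  by (intro ring_ideal.span_minimal) (auto simp: is_prime_ideal_def)

lemma exists_prime_ideal:
  fixes Q T :: "'a::comm_ring_1 set"
  assumes Q: "is_ideal Q" and one: "1 \<in> T" and mult: "\<And>x y. x \<in> T \<Longrightarrow> y \<in> T \<Longrightarrow> x * y \<in> T"
    and disj: "Q \<inter> T = {}"
  obtains P where "is_prime_ideal P" "Q \<subseteq> P" "P \<inter> T = {}"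
proof -
  let ?A = "{I. is_ideal I \<and> Q \<subseteq> I \<and> I \<inter> T = {}}"
  have "\<exists>M\<in>?A. \<forall>X\<in>?A. M \<subseteq> X \<longrightarrow> X = M"
  proof (rule subset_Zorn_nonempty)
    show "?A \<noteq> {}" using Q disj by auto
  next
    fix \<C> assume ne: "\<C> \<noteq> {}" and ch: "subset.chain ?A \<C>"
    then have sub: "\<C> \<subseteq> ?A" and lin: "\<And>X Y. X \<in> \<C> \<Longrightarrow> Y \<in> \<C> \<Longrightarrow> X \<subseteq> Y \<or> Y \<subseteq> X"
      by (auto simp: subset_chain_def)
    have "is_ideal (\<Union>\<C>)"
    proof (rule ring_ideal.subspaceI)
      show "0 \<in> \<Union>\<C>" using ne sub ring_ideal.subspace_0 by fastforce
    next
      fix x y assume "x \<in> \<Union>\<C>" "y \<in> \<Union>\<C>"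
      then obtain X Y where XY: "X \<in> \<C>" "Y \<in> \<C>" "x \<in> X" "y \<in> Y" by auto
      then obtain Z where Z: "Z \<in> \<C>" "x \<in> Z" "y \<in> Z" using lin[of X Y] by auto
      then have "x + y \<in> Z" using sub by (intro ring_ideal.subspace_add) auto
      then show "x + y \<in> \<Union>\<C>" using Z by auto
    next
      fix r x assume "x \<in> \<Union>\<C>"
      then obtain X where X: "X \<in> \<C>" "x \<in> X" by auto
      then have "r * x \<in> X" using sub by (intro ring_ideal.subspace_scale) auto
      then show "r * x \<in> \<Union>\<C>" using X by auto
    qed
    then show "\<Union>\<C> \<in> ?A" using ne sub by auto
  qed
  then obtain P where P: "is_ideal P" "Q \<subseteq> P" "P \<inter> T = {}"
    and max: "\<And>X. is_ideal X \<Longrightarrow> P \<subseteq> X \<Longrightarrow> X \<inter> T = {} \<Longrightarrow> X = P" by auto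
  have spanP: "ideal_gen P = P" using P(1) by simp
  have meet: "\<exists>t\<in>T. \<exists>k. t - k * x \<in> P" if "x \<notin> P" for x
  proof -
    let ?X = "ideal_gen (insert x P)"
    have "P \<subseteq> ?X" "x \<in> ?X" by (auto intro: ring_ideal.span_base)
    then have "?X \<inter> T \<noteq> {}" using max[of ?X] that P(2) by auto
    then obtain t where "t \<in> T" "t \<in> ?X" by auto
    then show ?thesis using spanP by (metis ideal_gen_insertE)
  qed
  have "is_prime_ideal P" unfolding is_prime_ideal_def
  proof (intro conjI allI impI)
    show "P \<noteq> UNIV" using P(3) one by auto
    fix x y assume xy: "x * y \<in> P"
    show "x \<in> P \<or> y \<in> P"
    proof (rule ccontr)
      assume "\<not> (x \<in> P \<or> y \<in> P)"
      then obtain t k s l where t: "t \<in> T" "t - k * x \<in> P" and s: "s \<in> T" "s - l * y \<in> P"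
        using meet by blast
      have "s * (t - k * x) + k * x * (s - l * y) + (k * l) * (x * y) \<in> P"
        using ring_ideal.subspace_scale[OF P(1) t(2), of s] ring_ideal.subspace_scale[OF P(1) s(2), of "k * x"]
          ring_ideal.subspace_scale[OF P(1) xy, of "k * l"] by (intro ring_ideal.subspace_add[OF P(1)])
      moreover have "s * (t - k * x) + k * x * (s - l * y) + (k * l) * (x * y) = t * s"
        by (simp add: algebra_simps)
      ultimately show False using mult[OF t(1) s(1)] P(3) by auto
    qed
  qed (use P in auto)
  then show ?thesis using that P by blast
qed

text \<open>If the claim failed, the products of powers of \<open>x\<close> with elements outside
  \<open>P\<close> would avoid \<open>I\<close>. A prime over \<open>I\<close> avoiding them lies in
  \<open>P\<close> but omits \<open>x\<close>, against minimality.\<close>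

lemma minimal_prime_zero_divisor:
  assumes P: "P \<in> minimal_primes I" and I: "is_ideal I" and x: "x \<in> P"
  shows "\<exists>y k. y \<notin> P \<and> y * x ^ k \<in> I"
proof (rule ccontr)
  assume none: "\<not> ?thesis"
  have prime: "is_prime_ideal P" using P by (simp add: minimal_primes_def)
  let ?T = "{y * x ^ k | y k. y \<notin> P}"
  obtain P' where P': "is_prime_ideal P'" "I \<subseteq> P'" "P' \<inter> ?T = {}"
  proof (rule exists_prime_ideal[OF I, of ?T])
    show "1 \<in> ?T" using prime_ideal_one[OF prime] by (intro CollectI exI[of _ 1] exI[of _ 0]) simp
    show "a * b \<in> ?T" if "a \<in> ?T" "b \<in> ?T" for a b
    proof -
      obtain y k z l where "a = y * x ^ k" "y \<notin> P" "b = z * x ^ l" "z \<notin> P"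
        using \<open>a \<in> ?T\<close> \<open>b \<in> ?T\<close> by blast
      then have "a * b = (y * z) * x ^ (k + l)" "y * z \<notin> P"
        using prime_idealD[OF prime] by (auto simp: power_add ac_simps)
      then show ?thesis by blast
    qed
    show "I \<inter> ?T = {}" using none by blast
  qed
  have "y \<in> P" if "y \<in> P'" for y
  proof (rule ccontr)
    assume "y \<notin> P"
    then have "y * x ^ 0 \<in> ?T" by blast
    then show False using P'(3) that by auto
  qed
  then have "P' = P" using P P' by (auto simp: minimal_primes_def)
  moreover have "1 * x ^ 1 \<in> ?T" using prime_ideal_one[OF prime] by blast
  ultimately show False using P'(3) x by auto
qed

lemma contracted_ideal_eq:
  fixes P :: "'a::idom set"
  assumes P: "is_prime_ideal P" and J: "is_ideal J"
  shows "contracted_ideal P J = {r. \<exists>u. u \<notin> P \<and> u * r \<in> J}"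
proof -
  have P0: "u \<noteq> 0" if "u \<notin> P" for u
    using P that by (auto simp: is_prime_ideal_def dest: ring_ideal.subspace_0)
  have ex: "\<exists>x u. y = Fraction_Field.Fract x u \<and> x \<in> J \<and> u \<notin> P" if "y \<in> extended_ideal P J" for y
    using that
  proof induction
    case zero
    then show ?case using ring_ideal.subspace_0[OF J] prime_ideal_one[OF P]
      by (intro exI[of _ 0] exI[of _ 1]) (simp add: Zero_fract_def)
  next
    case (gen x)
    then show ?case using prime_ideal_one[OF P] by blast
  next
    case (add y z)
    then obtain x u x' u' where *: "y = Fraction_Field.Fract x u" "x \<in> J" "u \<notin> P"
      "z = Fraction_Field.Fract x' u'" "x' \<in> J" "u' \<notin> P" by blast
    have "y + z = Fraction_Field.Fract (x * u' + x' * u) (u * u')" using * P0 by simp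
    moreover have "x * u' + x' * u \<in> J"
      using ring_ideal.subspace_add[OF J ring_ideal.subspace_scale[OF J *(2)] ring_ideal.subspace_scale[OF J *(5)], of u' u]
      by (simp add: mult.commute)
    ultimately show ?case using * prime_idealD[OF P] by blast
  next
    case (mult q y)
    then obtain x u r w where *: "y = Fraction_Field.Fract x u" "x \<in> J" "u \<notin> P"
      "q = Fraction_Field.Fract r w" "w \<notin> P" by (auto simp: localization_def)
    have "q * y = Fraction_Field.Fract (r * x) (w * u)" using * by simp
    then show ?case using * prime_idealD[OF P] ring_ideal.subspace_scale[OF J *(2)] by blast
  qed
  show ?thesis
  proof (intro set_eqI iffI)
    fix r assume "r \<in> contracted_ideal P J"
    then obtain x u where *: "Fraction_Field.Fract r 1 = Fraction_Field.Fract x u" "x \<in> J" "u \<notin> P"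
      using ex[of "Fraction_Field.Fract r 1"] unfolding contracted_ideal_def by blast
    then have "u * r = x" using P0[of u] by (simp add: eq_fract mult.commute)
    then show "r \<in> {r. \<exists>u. u \<notin> P \<and> u * r \<in> J}" using * by auto
  next
    fix r assume "r \<in> {r. \<exists>u. u \<notin> P \<and> u * r \<in> J}"
    then obtain u where u: "u \<notin> P" "u * r \<in> J" by auto
    have "Fraction_Field.Fract 1 u * Fraction_Field.Fract (u * r) 1 \<in> extended_ideal P J"
      using u by (intro extended_ideal.mult extended_ideal.gen) (auto simp: localization_def)
    moreover have "Fraction_Field.Fract 1 u * Fraction_Field.Fract (u * r) 1 = Fraction_Field.Fract r 1"
      using P0[OF u(1)] by (simp add: eq_fract mult.commute)
    ultimately show "r \<in> contracted_ideal P J" by (simp add: contracted_ideal_def)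
  qed
qed

section \<open>Polynomial expressions\<close>

text \<open>With \<open>U\<close> the set of nonzero constants, every value at \<open>hs\<close> of a nonzero polynomial belongs to
  \<open>nonzero_values U hs\<close>: split off the least power of the first variable. Since the other terms play no
  role, \<open>z\<close> may be arbitrary.\<close>

primrec nonzero_values :: "'a::comm_ring_1 set \<Rightarrow> 'a list \<Rightarrow> 'a set" where
  "nonzero_values U [] = U"
| "nonzero_values U (h # hs) = {h ^ i * (a + h * z) | i a z. a \<in> nonzero_values U hs}"

definition list_mon :: "'a::comm_ring_1 list \<Rightarrow> nat list \<Rightarrow> 'a" where
  "list_mon ys \<alpha> = prod_list (map2 (^) ys \<alpha>)"

lemma list_mon_simps [simp]:
  "list_mon [] [] = 1" "list_mon (y # ys) (k # \<alpha>) = y ^ k * list_mon ys \<alpha>"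
  by (simp_all add: list_mon_def)

definition exps :: "nat \<Rightarrow> nat \<Rightarrow> nat list set" where
  "exps N l = {\<alpha>. set \<alpha> \<subseteq> {..N} \<and> length \<alpha> = l}"

lemma finite_exps [simp]: "finite (exps N l)"
  unfolding exps_def by (rule finite_lists_length_eq) simp

lemma card_exps: "card (exps N l) = Suc N ^ l"
  unfolding exps_def by (subst card_lists_length_eq) auto

lemma sum_exps_Suc:
  "(\<Sum>\<alpha>\<in>exps N (Suc l). g \<alpha>) = (\<Sum>i\<le>N. \<Sum>\<alpha>\<in>exps N l. g (i # \<alpha>))"
proof -
  have "(\<Sum>\<alpha>\<in>exps N (Suc l). g \<alpha>) = (\<Sum>(\<alpha>, i)\<in>exps N l \<times> {..N}. g (i # \<alpha>))"
    unfolding exps_def lists_length_Suc_eq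
    by (subst sum.reindex) (auto simp: inj_on_def intro!: sum.cong)
  also have "\<dots> = (\<Sum>\<alpha>\<in>exps N l. \<Sum>i\<le>N. g (i # \<alpha>))"
    by (simp add: sum.cartesian_product)
  also have "\<dots> = (\<Sum>i\<le>N. \<Sum>\<alpha>\<in>exps N l. g (i # \<alpha>))" by (rule sum.swap)
  finally show ?thesis .
qed

lemma sum_in_nonzero_values:
  assumes "\<And>\<alpha>. \<kappa> \<alpha> \<in> insert 0 U" "\<alpha> \<in> exps N (length ys)" "\<kappa> \<alpha> \<noteq> 0"
  shows "(\<Sum>\<alpha>\<in>exps N (length ys). \<kappa> \<alpha> * list_mon ys \<alpha>) \<in> nonzero_values U ys"
  using assms
proof (induction ys arbitrary: \<kappa> \<alpha>)
  case Nil
  have "exps N 0 = {[]}" by (auto simp: exps_def)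
  then show ?case using Nil.prems by auto
next
  case (Cons y ys)
  define b where "b i = (\<Sum>\<alpha>\<in>exps N (length ys). \<kappa> (i # \<alpha>) * list_mon ys \<alpha>)" for i
  let ?P = "\<lambda>i. \<exists>\<alpha>\<in>exps N (length ys). i \<le> N \<and> \<kappa> (i # \<alpha>) \<noteq> 0"
  have "\<exists>i. ?P i" using Cons.prems(2,3) by (cases \<alpha>) (auto simp: exps_def)
  then have least: "?P (LEAST i. ?P i)" by (rule LeastI_ex)
  define i where "i = (LEAST i. ?P i)"
  have bi: "b i \<in> nonzero_values U ys"
  proof -
    obtain \<beta> where "\<beta> \<in> exps N (length ys)" "\<kappa> (i # \<beta>) \<noteq> 0"
      using least unfolding i_def[symmetric] by blast
    then show ?thesis
      unfolding b_def using Cons.prems(1) by (intro Cons.IH[of "\<lambda>\<alpha>. \<kappa> (i # \<alpha>)"]) auto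
  qed
  have iN: "i \<le> N" using least by (auto simp: i_def)
  have b0: "b j = 0" if "j < i" for j
  proof -
    have "\<not> ?P j" using that unfolding i_def by (rule not_less_Least)
    then show ?thesis using that iN unfolding b_def by (intro sum.neutral) auto
  qed
  have "(\<Sum>\<alpha>\<in>exps N (length (y # ys)). \<kappa> \<alpha> * list_mon (y # ys) \<alpha>) = (\<Sum>j\<le>N. y ^ j * b j)"
    by (simp add: sum_exps_Suc b_def sum_distrib_left mult.left_commute)
  also have "\<dots> = (\<Sum>j\<in>{i..N}. y ^ j * b j)"
    by (rule sum.mono_neutral_right) (auto simp: b0)
  also have "\<dots> = y ^ i * b i + (\<Sum>j\<in>{Suc i..N}. y ^ j * b j)"
    using iN by (simp add: sum.atLeast_Suc_atMost)
  also have "(\<Sum>j\<in>{Suc i..N}. y ^ j * b j) = (\<Sum>j\<in>{Suc i..N}. y ^ i * (y * (y ^ (j - Suc i) * b j)))"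
  proof (intro sum.cong refl)
    fix j assume "j \<in> {Suc i..N}"
    then have "y ^ j = y ^ i * (y * y ^ (j - Suc i))"
      by (simp flip: power_Suc power_add)
    then show "y ^ j * b j = y ^ i * (y * (y ^ (j - Suc i) * b j))" by (simp add: mult.assoc)
  qed
  also have "y ^ i * b i + \<dots> = y ^ i * (b i + y * (\<Sum>j\<in>{Suc i..N}. y ^ (j - Suc i) * b j))"
    by (simp add: distrib_left sum_distrib_left)
  finally show ?case using bi by auto
qed

text \<open>A strong form of algebraic independence: the value of a nonzero polynomial is even
  regular modulo \<open>S\<close>. Modulo \<open>h\<close> only the summand \<open>b\<close> is
  left, and separation removes \<open>h\<close> from the ideal again.\<close>

lemma nonzero_values_nzd:
  assumes "\<And>u. u \<in> U \<Longrightarrow> u dvd 1" "distinct hs" "set hs \<inter> S = {}" "reg_fam (\<lambda>f. f) (S \<union> set hs)"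
    and "\<And>H h. H \<subseteq> S \<union> set hs \<Longrightarrow> h \<in> set hs \<Longrightarrow> separated (ideal_gen H) h"
    and "a \<in> nonzero_values U hs"
  shows "nzd a (ideal_gen S)"
  using assms(2-)
proof (induction hs arbitrary: S a)
  case Nil
  then obtain v where v: "a * v = 1" using assms(1)[of a] by (auto elim: dvdE)
  show ?case
  proof (rule nzdI)
    fix r assume "r * a \<in> ideal_gen S"
    then have "(r * a) * v \<in> ideal_gen S" by (rule ideal_scale_right)
    then show "r \<in> ideal_gen S" using v by (simp add: mult.assoc)
  qed
next
  case (Cons h hs)
  obtain i b z where a: "a = h ^ i * (b + h * z)" "b \<in> nonzero_values U hs"
    using Cons.prems(5) by auto
  have h: "nzd h (ideal_gen S)" using reg_famD[OF Cons.prems(3), of S h] Cons.prems(2) by auto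
  have eq: "S \<union> set (h # hs) = insert h S \<union> set hs" by auto
  have "nzd b (ideal_gen (insert h S))"
  proof (rule Cons.IH)
    show "separated (ideal_gen H) h'" if "H \<subseteq> insert h S \<union> set hs" "h' \<in> set hs" for H h'
      using that by (intro Cons.prems(4)) auto
  qed (use Cons.prems(1-3) a(2) eq in auto)
  moreover have "- z * h \<in> ideal_gen (insert h S)" by (intro ideal_scale_base) auto
  then have "b - (b + h * z) \<in> ideal_gen (insert h S)" by (simp add: mult.commute)
  ultimately have "nzd (b + h * z) (ideal_gen (insert h S))" by (rule nzd_cong_ideal)
  moreover have "separated (ideal_gen S) h" by (rule Cons.prems(4)) auto
  ultimately have "nzd (b + h * z) (ideal_gen S)" using h nzd_insert_imp by blast
  then show ?case unfolding a(1) using h by (intro nzd_mult nzd_power)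
qed

text \<open>Each variable in \<open>cs\<close> is stripped by cancelling its power and then reducing
  modulo it.\<close>

lemma nonzero_values_strip:
  assumes "distinct cs" "set cs \<inter> S = {}" "reg_fam (\<lambda>f. f) (S \<union> set cs)"
    and "a \<in> nonzero_values U (cs @ hs)" "a \<in> ideal_gen S"
  shows "\<exists>b\<in>nonzero_values U hs. b \<in> ideal_gen (S \<union> set cs)"
  using assms
proof (induction cs arbitrary: S a)
  case Nil
  then show ?case by auto
next
  case (Cons h cs)
  obtain i b z where a: "a = h ^ i * (b + h * z)" "b \<in> nonzero_values U (cs @ hs)"
    using Cons.prems(4) by auto
  have h: "nzd h (ideal_gen S)" using reg_famD[OF Cons.prems(3), of S h] Cons.prems(2) by auto
  have eq: "S \<union> set (h # cs) = insert h S \<union> set cs" by auto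
  have "(b + h * z) * h ^ i \<in> ideal_gen S" using Cons.prems(5) a(1) by (simp add: mult.commute)
  then have "b + h * z \<in> ideal_gen S" by (rule nzdD[OF nzd_power[OF h]])
  then have "b - (- z) * h \<in> ideal_gen S" by (simp add: mult.commute)
  then have "b \<in> ideal_gen (insert h S)" by (rule ideal_gen_insertI)
  then have "\<exists>b\<in>nonzero_values U hs. b \<in> ideal_gen (insert h S \<union> set cs)"
    using Cons.prems(1-3) a(2) eq by (intro Cons.IH[of "insert h S" b]) auto
  then show ?case using eq by simp
qed

section \<open>Linear systems\<close>

lemma exists_nontrivial_solution:
  fixes A :: "'i \<Rightarrow> 'e \<Rightarrow> 'k::field"
  assumes "finite I" "finite E" "card I < card E"
  shows "\<exists>\<kappa>. (\<exists>e\<in>E. \<kappa> e \<noteq> 0) \<and> (\<forall>i\<in>I. (\<Sum>e\<in>E. \<kappa> e * A i e) = 0)"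
  using assms
proof (induction I arbitrary: E A rule: finite_induct)
  case empty
  then show ?case by (intro exI[of _ "\<lambda>_. 1"]) (auto simp: card_gt_0_iff)
next
  case (insert i I)
  show ?case
  proof (cases "\<forall>e\<in>E. A i e = 0")
    case True
    obtain \<kappa> where "\<exists>e\<in>E. \<kappa> e \<noteq> 0" "\<forall>i\<in>I. (\<Sum>e\<in>E. \<kappa> e * A i e) = 0"
      using insert.IH[of E A] insert.prems insert.hyps by auto
    then show ?thesis using True by (intro exI[of _ \<kappa>]) auto
  next
    case False
    then obtain p where p: "p \<in> E" "A i p \<noteq> 0" by auto
    \<comment> \<open>Gaussian elimination with pivot \<open>p\<close>: a multiple of equation
      \<open>i\<close> is subtracted from equation \<open>j\<close>.\<close>
    let ?B = "\<lambda>j e. A j e - A j p * A i e / A i p"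
    have "card I < card (E - {p})" using insert.prems insert.hyps p by simp
    then obtain \<kappa> where nz: "\<exists>e\<in>E - {p}. \<kappa> e \<noteq> 0"
      and sol: "\<forall>j\<in>I. (\<Sum>e\<in>E - {p}. \<kappa> e * ?B j e) = 0"
      using insert.IH[of "E - {p}" ?B] insert.prems by auto
    define s where "s = (\<Sum>e\<in>E - {p}. \<kappa> e * A i e)"
    let ?\<mu> = "\<kappa>(p := - s / A i p)"
    have tot: "(\<Sum>e\<in>E. ?\<mu> e * A j e) = - s / A i p * A j p + (\<Sum>e\<in>E - {p}. \<kappa> e * A j e)" for j
      using insert.prems(1) p by (simp add: sum.remove[of E p])
    have "(\<Sum>e\<in>E. ?\<mu> e * A j e) = 0" if "j \<in> insert i I" for j
    proof (cases "j = i")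
      case True
      then show ?thesis using p unfolding tot by (simp add: s_def)
    next
      case False
      then have "(\<Sum>e\<in>E - {p}. \<kappa> e * A j e) - A j p / A i p * s = 0"
        using sol that unfolding s_def
        by (simp add: right_diff_distrib sum_subtractf sum_distrib_left ac_simps)
      then show ?thesis unfolding tot by (simp add: field_simps)
    qed
    then show ?thesis using nz by (intro exI[of _ ?\<mu>]) auto
  qed
qed

section \<open>Homogeneous polynomials\<close>

lemma monom_degree_UNIV: "monom_degree t = (\<Sum>v\<in>UNIV. Poly_Mapping.lookup t (v::'v::finite))"
  unfolding monom_degree_def by (rule sum.mono_neutral_left) (auto simp: in_keys_iff)

lemma monom_degree_add: "monom_degree (s + t) = monom_degree s + monom_degree (t :: 'v::finite \<Rightarrow>\<^sub>0 nat)"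
  by (simp add: monom_degree_UNIV lookup_add sum.distrib)

lemma monom_degree_0 [simp]: "monom_degree 0 = 0"
  by (simp add: monom_degree_def)

lemma homogeneous_mult:
  fixes p q :: "('v::finite, 'k::comm_ring_1) mpoly"
  assumes "homogeneous d p" "homogeneous d' q"
  shows "homogeneous (d + d') (p * q)"
  using assms keys_mult[of p q] by (fastforce simp: homogeneous_def monom_degree_add)

lemma homogeneous_power:
  fixes p :: "('v::finite, 'k::comm_ring_1) mpoly"
  assumes "homogeneous d p"
  shows "homogeneous (k * d) (p ^ k)"
proof (induction k)
  case 0
  then show ?case by (simp add: homogeneous_def)
next
  case (Suc k)
  then show ?case using homogeneous_mult[OF assms Suc] by simp
qed

lemma lookup_mult_0:
  fixes p q :: "('v, 'k::comm_ring_1) mpoly"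
  shows "Poly_Mapping.lookup (p * q) 0 = Poly_Mapping.lookup p 0 * Poly_Mapping.lookup q 0"
proof -
  have *: "(0 = l + t) = (l = 0 \<and> t = 0)" for l t :: "'v \<Rightarrow>\<^sub>0 nat"
    by (auto simp: poly_mapping_eq_iff lookup_add fun_eq_iff plus_poly_mapping.rep_eq)
  have "(\<Sum>t. Poly_Mapping.lookup q t when 0 = l + t) = (Poly_Mapping.lookup q 0 when l = 0)" for l :: "'v \<Rightarrow>\<^sub>0 nat"
    by (cases "l = 0") (simp_all add: *)
  then show ?thesis by (simp add: lookup_mult mult_when)
qed

lemma lookup_0_homogeneous: "homogeneous d p \<Longrightarrow> 0 < d \<Longrightarrow> Poly_Mapping.lookup p 0 = 0"
  by (force simp: homogeneous_def in_keys_iff)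

lemma lookup_0_ideal_gen:
  fixes S :: "('v, 'k::comm_ring_1) mpoly set"
  assumes "\<And>f. f \<in> S \<Longrightarrow> Poly_Mapping.lookup f 0 = 0" "p \<in> ideal_gen S"
  shows "Poly_Mapping.lookup p 0 = 0"
  using assms(2)
  by (induction rule: ring_ideal.span_induct_alt) (auto simp: lookup_add lookup_mult_0 assms(1))

section \<open>Truncation by degree\<close>

definition trunc :: "nat \<Rightarrow> ('v, 'k::zero) mpoly \<Rightarrow> ('v, 'k) mpoly" where
  "trunc k p = Poly_Mapping.mapp (\<lambda>t x. x when monom_degree t < k) p"

lemma lookup_trunc: "Poly_Mapping.lookup (trunc k p) t = (Poly_Mapping.lookup p t when monom_degree t < k)"
  by (auto simp: trunc_def lookup_mapp when_def in_keys_iff)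

lemma trunc_0 [simp]: "trunc 0 p = 0"
  by (rule poly_mapping_eqI) (simp add: lookup_trunc)

lemma trunc_zero [simp]: "trunc k 0 = 0"
  by (rule poly_mapping_eqI) (simp add: lookup_trunc)

lemma trunc_add: "trunc k (p + q) = trunc k p + trunc k (q :: ('v, 'k::comm_ring_1) mpoly)"
  by (rule poly_mapping_eqI) (simp add: lookup_trunc lookup_add when_def)

lemma trunc_diff: "trunc k (p - q) = trunc k p - trunc k (q :: ('v, 'k::comm_ring_1) mpoly)"
  by (rule poly_mapping_eqI) (simp add: lookup_trunc lookup_minus when_def)

text \<open>For \<open>k < d\<close> the difference \<open>k - d\<close> is 0 and both sides vanish,
  since every term of \<open>p * h\<close> has degree at least \<open>d\<close>.\<close>

lemma trunc_mult:
  fixes p h :: "('v::finite, 'k::comm_ring_1) mpoly"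
  assumes "homogeneous d h"
  shows "trunc k (p * h) = trunc (k - d) p * h"
proof (rule poly_mapping_eqI)
  fix t
  have "(Poly_Mapping.lookup p l * (\<Sum>q. Poly_Mapping.lookup h q when t = l + q) when monom_degree t < k) =
      (Poly_Mapping.lookup p l when monom_degree l < k - d) * (\<Sum>q. Poly_Mapping.lookup h q when t = l + q)" for l
  proof (cases "\<exists>q. Poly_Mapping.lookup h q \<noteq> 0 \<and> t = l + q")
    case True
    then obtain q where q: "Poly_Mapping.lookup h q \<noteq> 0" "t = l + q" by blast
    then have "monom_degree q = d" using assms by (auto simp: homogeneous_def in_keys_iff)
    then have "monom_degree t < k \<longleftrightarrow> monom_degree l < k - d" using q(2) by (auto simp: monom_degree_add)
    then show ?thesis by (simp add: when_def)
  next
    case False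
    then have "(Poly_Mapping.lookup h q when t = l + q) = 0" for q by (auto simp: when_def)
    then have "(\<Sum>q. Poly_Mapping.lookup h q when t = l + q) = 0" by (simp only: Sum_any.neutral)
    then show ?thesis by (simp only: mult_zero_right zero_when)
  qed
  then have "(\<Sum>l. Poly_Mapping.lookup p l * (\<Sum>q. Poly_Mapping.lookup h q when t = l + q) when monom_degree t < k) =
    (\<Sum>l. (Poly_Mapping.lookup p l when monom_degree l < k - d) * (\<Sum>q. Poly_Mapping.lookup h q when t = l + q))"
    by (intro Sum_any.cong)
  then show "Poly_Mapping.lookup (trunc k (p * h)) t = Poly_Mapping.lookup (trunc (k - d) p * h) t"
    unfolding lookup_trunc lookup_mult by (simp only: Sum_any_when_independent)
qed

lemma trunc_ideal_gen:
  fixes S :: "('v::finite, 'k::comm_ring_1) mpoly set"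
  assumes "\<And>f. f \<in> S \<Longrightarrow> \<exists>d. homogeneous d f" "p \<in> ideal_gen S"
  shows "trunc k p \<in> ideal_gen S"
  using assms(2)
proof (induction rule: ring_ideal.span_induct_alt)
  case base
  then show ?case by (simp add: ring_ideal.span_zero)
next
  case (step c x y)
  then obtain d where "homogeneous d x" using assms(1) by blast
  then show ?case using step
    by (auto simp: trunc_add trunc_mult intro!: ring_ideal.span_add ideal_scale_base)
qed

text \<open>Truncation below a degree \<open>K\<close> that exceeds all degrees in \<open>r\<close>
  fixes \<open>r\<close>, preserves the ideal, and kills \<open>q * h^K\<close>, whose terms have
  degree at least \<open>K\<close> because \<open>0 < d\<close>.\<close>

lemma separated_homogeneous:
  fixes S :: "('v::finite, 'k::comm_ring_1) mpoly set"
  assumes S: "\<And>f. f \<in> S \<Longrightarrow> \<exists>d. homogeneous d f" and h: "homogeneous d h" "0 < d"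
  shows "separated (ideal_gen S) h"
  unfolding separated_def
proof (intro allI impI)
  fix r assume r: "\<forall>k. \<exists>q. r - q * h ^ k \<in> ideal_gen S"
  define K where "K = Suc (\<Sum>t\<in>Poly_Mapping.keys r. monom_degree t)"
  have "monom_degree t < K" if "t \<in> Poly_Mapping.keys r" for t
    unfolding K_def using that member_le_sum[of t "Poly_Mapping.keys r" monom_degree] by simp
  then have rK: "trunc K r = r"
    by (intro poly_mapping_eqI) (auto simp: lookup_trunc when_def in_keys_iff)
  obtain q where "r - q * h ^ K \<in> ideal_gen S" using r by blast
  then have "trunc K (r - q * h ^ K) \<in> ideal_gen S" by (rule trunc_ideal_gen[rotated]) (rule S)
  moreover have "trunc K (q * h ^ K) = 0"
    using h by (simp add: trunc_mult[OF homogeneous_power[OF h(1)]])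
  ultimately show "r \<in> ideal_gen S" by (simp add: trunc_diff rK)
qed

section \<open>Algebraic dependence\<close>

text \<open>Each variable is bounded separately, so that the admissible monomials form a box, which
  \<open>box_card\<close> counts.\<close>

definition deg_le :: "nat \<Rightarrow> ('v, 'k::zero) mpoly \<Rightarrow> bool" where
  "deg_le k p \<longleftrightarrow> (\<forall>t\<in>Poly_Mapping.keys p. \<forall>v. Poly_Mapping.lookup t v \<le> k)"

lemma deg_le_mult:
  fixes p q :: "('v, 'k::comm_ring_1) mpoly"
  assumes "deg_le k p" "deg_le l q"
  shows "deg_le (k + l) (p * q)"
  unfolding deg_le_def
proof (intro ballI allI)
  fix t v assume "t \<in> Poly_Mapping.keys (p * q)"
  then obtain s r where "t = s + r" "s \<in> Poly_Mapping.keys p" "r \<in> Poly_Mapping.keys q"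
    using keys_mult[of p q] by blast
  then show "Poly_Mapping.lookup t v \<le> k + l"
    using assms by (auto simp: deg_le_def lookup_add add_mono)
qed

lemma deg_le_1: "deg_le k (1 :: ('v, 'k::comm_ring_1) mpoly)"
  by (simp add: deg_le_def)

lemma deg_le_mono: "deg_le k p \<Longrightarrow> k \<le> l \<Longrightarrow> deg_le l p"
  unfolding deg_le_def using order_trans by blast

lemma deg_le_power:
  fixes p :: "('v, 'k::comm_ring_1) mpoly"
  assumes "deg_le k p"
  shows "deg_le (i * k) (p ^ i)"
proof (induction i)
  case (Suc i)
  then show ?case using deg_le_mult[OF assms Suc] by simp
qed (simp add: deg_le_1)

lemma deg_le_list_mon:
  fixes ys :: "('v, 'k::comm_ring_1) mpoly list"
  assumes "length ys = length \<alpha>" "\<And>y. y \<in> set ys \<Longrightarrow> deg_le D y" "set \<alpha> \<subseteq> {..N}"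
  shows "deg_le (length ys * (N * D)) (list_mon ys \<alpha>)"
  using assms
proof (induction ys \<alpha> rule: list_induct2)
  case Nil
  then show ?case by (simp add: deg_le_1)
next
  case (Cons y ys i \<alpha>)
  have "deg_le (N * D) (y ^ i)"
    using Cons.prems by (intro deg_le_mono[OF deg_le_power[of D y i]]) auto
  then show ?case using deg_le_mult[OF _ Cons.IH, of "N * D" "y ^ i"] Cons.prems by simp
qed

lemma exists_deg_le: "\<exists>k. deg_le k (p :: ('v::finite, 'k::zero) mpoly)"
proof -
  have "deg_le (\<Sum>t\<in>Poly_Mapping.keys p. monom_degree t) p" unfolding deg_le_def
  proof (intro ballI allI)
    fix t v assume t: "t \<in> Poly_Mapping.keys p"
    have "Poly_Mapping.lookup t v \<le> monom_degree t"
      unfolding monom_degree_UNIV by (intro member_le_sum) auto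
    also have "\<dots> \<le> (\<Sum>t\<in>Poly_Mapping.keys p. monom_degree t)"
      using t by (intro member_le_sum) auto
    finally show "Poly_Mapping.lookup t v \<le> \<dots>" .
  qed
  then show ?thesis by blast
qed

lemma box_card:
  fixes k :: nat
  shows "finite {t :: 'v::finite \<Rightarrow>\<^sub>0 nat. \<forall>v. Poly_Mapping.lookup t v \<le> k}" (is "finite ?B")
    and "card {t :: 'v::finite \<Rightarrow>\<^sub>0 nat. \<forall>v. Poly_Mapping.lookup t v \<le> k} \<le> Suc k ^ card (UNIV :: 'v set)"
proof -
  let ?X = "PiE UNIV (\<lambda>_. {..k}) :: ('v \<Rightarrow> nat) set"
  have inj: "inj_on Poly_Mapping.lookup ?B" by (rule inj_onI) (simp only: lookup_inject)
  have sub: "Poly_Mapping.lookup ` ?B \<subseteq> ?X" by (auto simp: PiE_def extensional_def)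
  have fin: "finite ?X" by (intro finite_PiE) auto
  show "finite ?B" using inj_on_finite[OF inj sub fin] .
  show "card ?B \<le> Suc k ^ card (UNIV :: 'v set)"
    using card_inj_on_le[OF inj sub fin] by (simp add: card_PiE)
qed

lemma single_eq_0_iff: "Poly_Mapping.single k c = 0 \<longleftrightarrow> c = 0"
  by (metis lookup_single_eq lookup_zero single_zero)

text \<open>With \<open>n\<close> the number of variables, there are \<open>(N + 1)^(n + 1)\<close>
  monomials in \<open>ys\<close> with exponents at most \<open>N\<close>, but they lie in a space
  whose dimension grows only like \<open>N^n\<close>.\<close>

lemma algebraic_dependence:
  fixes ys :: "('v::{finite,linorder}, 'k::field) mpoly list"
  assumes l: "length ys = Suc (card (UNIV :: 'v set))"
  shows "\<exists>N \<kappa>. (\<exists>\<alpha>\<in>exps N (length ys). \<kappa> \<alpha> \<noteq> 0) \<and>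
    (\<Sum>\<alpha>\<in>exps N (length ys). Poly_Mapping.single 0 (\<kappa> \<alpha>) * list_mon ys \<alpha>) = 0"
proof -
  define n where "n = card (UNIV :: 'v set)"
  obtain D0 where D0: "\<And>y. deg_le (D0 y) (y :: ('v, 'k) mpoly)" using exists_deg_le by metis
  define D where "D = (\<Sum>y\<in>set ys. D0 y)"
  have D: "deg_le D y" if "y \<in> set ys" for y
    unfolding D_def using that by (intro deg_le_mono[OF D0] member_le_sum) auto
  define L where "L = length ys"
  \<comment> \<open>For this \<open>N\<close>,
    \<open>(L N D + 1)^n \<le> (L D + 1)^n (N + 1)^n = N (N + 1)^n\<close>, which is less than
    \<open>(N + 1)^(n + 1)\<close>.\<close>
  define N where "N = Suc (L * D) ^ n"
  define B where "B = {t :: 'v \<Rightarrow>\<^sub>0 nat. \<forall>v. Poly_Mapping.lookup t v \<le> L * (N * D)}"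
  have finB: "finite B" unfolding B_def by (rule box_card)
  have "card B \<le> Suc (L * (N * D)) ^ n" unfolding B_def n_def by (rule box_card)
  also have "\<dots> \<le> (Suc (L * D) * Suc N) ^ n" by (intro power_mono) (simp_all add: algebra_simps)
  also have "\<dots> = N * Suc N ^ n" by (simp only: power_mult_distrib N_def)
  also have "\<dots> < Suc N * Suc N ^ n" by simp
  also have "\<dots> = card (exps N L)" by (simp add: card_exps L_def l n_def)
  finally obtain \<kappa> where \<kappa>: "\<exists>\<alpha>\<in>exps N L. \<kappa> \<alpha> \<noteq> 0"
    "\<forall>t\<in>B. (\<Sum>\<alpha>\<in>exps N L. \<kappa> \<alpha> * Poly_Mapping.lookup (list_mon ys \<alpha>) t) = 0"
    using exists_nontrivial_solution[OF finB finite_exps, of N L "\<lambda>t \<alpha>. Poly_Mapping.lookup (list_mon ys \<alpha>) t"]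
    by auto
  have "(\<Sum>\<alpha>\<in>exps N L. Poly_Mapping.single 0 (\<kappa> \<alpha>) * list_mon ys \<alpha>) = 0"
  proof (rule poly_mapping_eqI)
    fix t
    have *: "Poly_Mapping.lookup (Poly_Mapping.single 0 c * p) t = c * Poly_Mapping.lookup p t"
      for c and p :: "('v, 'k) mpoly"
      unfolding mult_map_scale_conv_mult[symmetric] by (simp add: map.rep_eq when_def)
    have "(\<Sum>\<alpha>\<in>exps N L. \<kappa> \<alpha> * Poly_Mapping.lookup (list_mon ys \<alpha>) t) = 0"
    proof (cases "t \<in> B")
      case False
      have "Poly_Mapping.lookup (list_mon ys \<alpha>) t = 0" if "\<alpha> \<in> exps N L" for \<alpha>
      proof -
        have "deg_le (L * (N * D)) (list_mon ys \<alpha>)"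
          unfolding L_def using that D by (intro deg_le_list_mon) (auto simp: exps_def L_def)
        then show ?thesis using False by (auto simp: deg_le_def B_def in_keys_iff)
      qed
      then show ?thesis by simp
    qed (use \<kappa> in auto)
    then show "Poly_Mapping.lookup (\<Sum>\<alpha>\<in>exps N L. Poly_Mapping.single 0 (\<kappa> \<alpha>) * list_mon ys \<alpha>) t
        = Poly_Mapping.lookup 0 t"
      by (simp add: lookup_sum *)
  qed
  then show ?thesis using \<kappa>(1) unfolding L_def by blast
qed

section \<open>Minimal primes of complete intersections\<close>

text \<open>The ring has too few variables for an element \<open>x\<close> of \<open>P\<close> outside \<open>P'\<close> to be algebraically
  independent of the maximal regular sequence \<open>G\<close>. Reducing a relation modulo \<open>C\<close> and then dividing
  by powers of \<open>x\<close> produces a nonzerodivisor modulo \<open>C\<close> in \<open>P\<close>.\<close>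

lemma prime_minimal_over:
  fixes G C :: "('v::{finite,linorder}, 'k::field) mpoly set"
  assumes G: "reg_fam (\<lambda>f. f) G" "card G = card (UNIV :: 'v set)" and C: "C \<subseteq> G"
    and sep: "\<And>H h. H \<subseteq> G \<Longrightarrow> h \<in> G \<Longrightarrow> separated (ideal_gen H) h"
    and P: "is_prime_ideal P" "\<And>u. u \<in> P \<Longrightarrow> \<not> nzd u (ideal_gen C)"
    and P': "is_prime_ideal P'" "C \<subseteq> P'" "P' \<subseteq> P"
  shows "P' = P"
proof (rule ccontr)
  assume "P' \<noteq> P"
  then obtain x where x: "x \<in> P" "x \<notin> P'" using P'(3) by auto
  have finG: "finite G" using G(2) by (intro card_ge_0_finite) (simp add: card_gt_0_iff)
  obtain cs where cs: "set cs = C" "distinct cs"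
    using finite_distinct_list[OF finite_subset[OF C finG]] by blast
  obtain hs where hs: "set hs = G - C" "distinct hs" using finite_distinct_list[of "G - C"] finG by blast
  \<comment> \<open>The order matters: \<open>cs\<close> is stripped by reduction modulo
    \<open>C\<close>, then the power of \<open>x\<close> is cancelled modulo the prime
    \<open>P'\<close>, and the value \<open>a\<close> involves \<open>hs\<close> only.\<close>
  let ?ys = "cs @ x # hs"
  let ?U = "{Poly_Mapping.single 0 c | c. c \<noteq> 0} :: ('v, 'k) mpoly set"
  have "length cs + length hs = card G"
    using cs hs C finG by (metis card_Diff_subset card_mono distinct_card finite_subset le_add_diff_inverse)
  then have "length ?ys = Suc (card (UNIV :: 'v set))" using G(2) by simp
  then obtain N \<kappa> where \<kappa>: "\<exists>\<alpha>\<in>exps N (length ?ys). \<kappa> \<alpha> \<noteq> (0 :: 'k)"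
    "(\<Sum>\<alpha>\<in>exps N (length ?ys). Poly_Mapping.single 0 (\<kappa> \<alpha>) * list_mon ?ys \<alpha>) = 0"
    using algebraic_dependence by blast
  have "(\<Sum>\<alpha>\<in>exps N (length ?ys). Poly_Mapping.single 0 (\<kappa> \<alpha>) * list_mon ?ys \<alpha>) \<in> nonzero_values ?U ?ys"
  proof -
    obtain \<alpha> where "\<alpha> \<in> exps N (length ?ys)" "\<kappa> \<alpha> \<noteq> 0" using \<kappa>(1) by blast
    moreover have "Poly_Mapping.single 0 (\<kappa> \<alpha>) \<in> insert 0 ?U" for \<alpha> by (cases "\<kappa> \<alpha> = 0") auto
    ultimately show ?thesis
      by (intro sum_in_nonzero_values[of "\<lambda>\<alpha>. Poly_Mapping.single 0 (\<kappa> \<alpha>)" ?U \<alpha> N ?ys])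
        (simp_all add: single_eq_0_iff)
  qed
  then have "0 \<in> nonzero_values ?U (cs @ x # hs)" using \<kappa>(2) by simp
  then have "\<exists>b\<in>nonzero_values ?U (x # hs). b \<in> ideal_gen ({} \<union> set cs)"
    using cs reg_fam_mono[OF G(1) C] by (intro nonzero_values_strip) auto
  then obtain i a z where a: "a \<in> nonzero_values ?U hs" "x ^ i * (a + x * z) \<in> ideal_gen C"
    using cs by auto
  have "x ^ i * (a + x * z) \<in> P'" using a(2) ideal_gen_sub_prime[OF P'(1,2)] by blast
  then have "a + x * z \<in> P'" using prime_idealD[OF P'(1)] prime_ideal_power[OF P'(1)] x(2) by blast
  then have "a + x * z \<in> P" using P'(3) by blast
  moreover have idP: "is_ideal P" using P(1) by (simp add: is_prime_ideal_def)
  ultimately have "(a + x * z) - z * x \<in> P"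
    using x(1) by (intro ring_ideal.subspace_diff ring_ideal.subspace_scale)
  then have "a \<in> P" by (simp add: mult.commute)
  moreover have "nzd a (ideal_gen C)"
  proof (rule nonzero_values_nzd[OF _ hs(2) _ _ _ a(1)])
    show "u dvd 1" if u: "u \<in> ?U" for u
    proof -
      obtain c where "u = Poly_Mapping.single 0 c" "c \<noteq> 0" using u by blast
      then have "u * Poly_Mapping.single 0 (1 / c) = 1" by (simp add: mult_single)
      then show ?thesis by (metis dvd_triv_left)
    qed
    have CG: "C \<union> set hs = G" using hs C by auto
    show "reg_fam (\<lambda>f. f) (C \<union> set hs)" using G CG by simp
    show "separated (ideal_gen H) h" if "H \<subseteq> C \<union> set hs" "h \<in> set hs" for H h
      using that sep CG hs by auto
  qed (use hs in auto)
  ultimately show False using P(2) by blast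
qed

section \<open>Generic forms as star configurations\<close>

lemma generic_forms_homogeneous: "generic_forms n F \<Longrightarrow> f \<in> F \<Longrightarrow> \<exists>d>0. homogeneous d f"
  unfolding generic_forms_def by blast

lemma generic_forms_separated:
  fixes F :: "('v::{finite,linorder}, 'k::field) mpoly set"
  assumes "generic_forms n F" "H \<subseteq> F" "h \<in> F"
  shows "separated (ideal_gen H) h"
proof -
  obtain d where "0 < d" "homogeneous d h" using generic_forms_homogeneous[OF assms(1,3)] by blast
  moreover have "\<exists>d. homogeneous d f" if "f \<in> H" for f
    using generic_forms_homogeneous[OF assms(1), of f] assms(2) that by blast
  ultimately show ?thesis by (intro separated_homogeneous)
qed

lemma generic_forms_reg_fam:
  fixes F :: "('v::{finite,linorder}, 'k::field) mpoly set"
  assumes "generic_forms n F" "G \<subseteq> F" "finite G" "card G \<le> n + 1"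
  shows "reg_fam (\<lambda>f. f) G"
proof -
  obtain fs where fs: "distinct fs" "set fs = G" "regular_sequence fs"
    using assms unfolding generic_forms_def by blast
  have "reg_fam (\<lambda>f. f) (set fs)"
  proof (rule reg_fam_of_regular_list[OF fs(1)])
    show "nzd (fs ! i) (ideal_gen (set (take i fs)))" if "i < length fs" for i
      using fs(3) that by (simp add: regular_sequence_def nzd_def)
    show "separated (ideal_gen H) h" if "H \<subseteq> set fs" "h \<in> set fs" for H h
      using that fs(2) assms(2) by (intro generic_forms_separated[OF assms(1)]) auto
  qed
  then show ?thesis using fs(2) by simp
qed

text \<open>\<open>D\<close> together with one more form has \<open>c + 1 \<le> n + 1\<close>
  elements, a size for which genericity gives regularity.\<close>

lemma generic_forms_star:
  fixes F :: "('v::{finite,linorder}, 'k::field) mpoly set"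
  assumes "generic_forms n F" "finite F" "c \<le> n" "c \<le> card F"
  shows "star F c"
proof
  fix D assume D: "D \<subseteq> F" "card D = c"
  then have finD: "finite D" using assms finite_subset by blast
  show "reg_fam (\<lambda>f. f) D" using assms D finD by (intro generic_forms_reg_fam) auto
  fix f assume f: "f \<in> F - D"
  have "reg_fam (\<lambda>f. f) (insert f D)" using assms D finD f by (intro generic_forms_reg_fam) auto
  from reg_famD[OF this, of D f] show "nzd f (ideal_gen D)" using f by auto
qed (use assms in auto)

lemma (in star) star_sub:
  assumes "C \<subseteq> F" "card C = c"
  shows "star C c"
proof
  fix D f assume "D \<subseteq> C" "card D = c" "f \<in> C - D"
  then show "nzd f (ideal_gen D)" using assms by (intro nzd_F) auto
qed (use assms finF reg finite_subset in auto)

text \<open>For \<open>F = C\<close> there is only one subset of size \<open>c\<close>, and the star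
  ideal is the \<open>M\<close>-th power of \<open>(C)\<close>. This is the unmixedness of powers of
  a complete intersection.\<close>

lemma (in star) nzd_power_ideal:
  assumes C: "C \<subseteq> F" "card C = c" and u: "nzd u (ideal_gen C)"
  shows "nzd u (ideal_gen (mon C ` {e. M \<le> sum e C}))"
proof -
  have finC: "finite C" using C finF finite_subset by auto
  interpret C: star C c using C by (rule star_sub)
  have D: "D \<subseteq> C \<Longrightarrow> card D = c \<Longrightarrow> D = C" for D
    using card_subset_eq[OF finC, of D] C(2) by simp
  have "C.expo M = {e. M \<le> sum e C}"
  proof (intro set_eqI iffI)
    fix e assume "e \<in> C.expo M"
    then show "e \<in> {e. M \<le> sum e C}" using C(2) unfolding C.expo_def by simp
  next
    fix e assume "e \<in> {e. M \<le> sum e C}"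
    then show "e \<in> C.expo M" unfolding C.expo_def using D by blast
  qed
  then have "C.star_ideal M = ideal_gen (mon C ` {e. M \<le> sum e C})" by (simp add: C.star_ideal_def)
  moreover have "nzd u (C.star_ideal M)"
  proof (rule C.nzd_star_ideal)
    show "nzd u (ideal_gen D)" if "D \<subseteq> C" "card D = c" for D using D[OF that] u by simp
  qed
  ultimately show ?thesis by simp
qed

text \<open>If \<open>r\<close> is missing from the \<open>M\<close>-th power of \<open>(C)\<close>,
  its annihilator modulo that power contains no element regular modulo \<open>(C)\<close>. A prime
  over the annihilator that avoids all such elements still sees \<open>r\<close> after localization,
  and \<open>prime_minimal_over\<close> makes it minimal over \<open>(C)\<close>.\<close>

lemma exists_minimal_prime:
  fixes F C :: "('v::{finite,linorder}, 'k::field) mpoly set"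
  assumes gen: "generic_forms n F" "finite F" "n + 1 \<le> card F" and n: "card (UNIV :: 'v set) = n + 1"
    and c: "c \<le> n" and C: "C \<subseteq> F" "card C = c"
    and r: "r \<notin> ideal_gen (mon C ` {e. M \<le> sum e C})"
  shows "\<exists>P. is_prime_ideal P \<and> C \<subseteq> P \<and> (\<forall>f\<in>F - C. f \<notin> P) \<and>
    (\<forall>u. u * r \<in> ideal_gen (mon C ` {e. M \<le> sum e C}) \<longrightarrow> u \<in> P) \<and>
    (\<forall>P'. is_prime_ideal P' \<longrightarrow> C \<subseteq> P' \<longrightarrow> P' \<subseteq> P \<longrightarrow> P' = P)"
proof -
  interpret star F c using gen c by (intro generic_forms_star) auto
  have finC: "finite C" using C finF finite_subset by auto
  let ?S = "mon C ` {e. M \<le> sum e C}"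
  let ?Q = "{u. u * r \<in> ideal_gen ?S}"
  let ?T = "{u. nzd u (ideal_gen C)}"
  have Q: "is_ideal ?Q"
    by (rule ring_ideal.subspaceI)
      (auto simp: ring_ideal.span_zero distrib_right mult.assoc intro: ring_ideal.span_add ring_ideal.span_scale)
  have "u \<notin> ?Q" if "u \<in> ?T" for u
    using nzdD[OF nzd_power_ideal[OF C, of u M], of r] that r by (auto simp: mult.commute)
  then have "?Q \<inter> ?T = {}" by blast
  then obtain P where P: "is_prime_ideal P" "?Q \<subseteq> P" "P \<inter> ?T = {}"
    using exists_prime_ideal[OF Q, of ?T] nzd_1 nzd_mult by (metis (no_types, lifting) mem_Collect_eq)
  have CP: "C \<subseteq> P"
  proof
    fix f assume f: "f \<in> C"
    let ?e = "\<lambda>j. if j = f then M else 0"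
    have "mon C ?e = f ^ M"
      using f finC by (simp add: mon_def if_distrib prod.remove[of C f])
    moreover have "?e \<in> {e. M \<le> sum e C}" using f finC by simp
    then have "mon C ?e \<in> ideal_gen ?S" by (intro ring_ideal.span_base imageI)
    ultimately have "f ^ M \<in> ideal_gen ?S" by simp
    then have "f ^ M \<in> ?Q" by (simp add: ideal_scale_right)
    then show "f \<in> P" using P prime_ideal_power by blast
  qed
  \<comment> \<open>Enlarging \<open>C\<close> to as many forms as there are variables supplies the
    maximal regular sequence for \<open>prime_minimal_over\<close>.\<close>
  obtain G where G: "C \<subseteq> G" "G \<subseteq> F" "card G = n + 1"
    using exists_subset_between[of C "n + 1" F] C c gen by auto
  have finG: "finite G" using G finF finite_subset by auto
  show ?thesis
  proof (intro exI[of _ P] conjI ballI allI impI P(1) CP)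
    show "f \<notin> P" if "f \<in> F - C" for f using nzd_F[OF C that] P(3) by auto
    show "u \<in> P" if "u * r \<in> ideal_gen ?S" for u using that P(2) by blast
    show "P' = P" if P': "is_prime_ideal P'" "C \<subseteq> P'" "P' \<subseteq> P" for P'
    proof (rule prime_minimal_over[OF _ _ G(1) _ P(1) _ P'])
      show "reg_fam (\<lambda>f. f) G" using gen G finG by (intro generic_forms_reg_fam) auto
      show "card G = card (UNIV :: 'v set)" using G n by simp
      show "separated (ideal_gen H) h" if "H \<subseteq> G" "h \<in> G" for H h
        using that G by (intro generic_forms_separated[OF gen(1)]) auto
    qed (use P in auto)
  qed
qed

section \<open>Powers of monomial ideals\<close>

lemma ideal_mult_gen:
  "ideal_mult (ideal_gen S) (ideal_gen T) = ideal_gen {x * y | x y. x \<in> S \<and> y \<in> (T :: 'a::comm_ring_1 set)}"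
    (is "_ = ideal_gen ?U")
proof
  have "x * y \<in> ideal_gen ?U" if x: "x \<in> ideal_gen S" and y: "y \<in> ideal_gen T" for x y
    using x
  proof (induction rule: ring_ideal.span_induct_alt)
    case base
    then show ?case by (simp add: ring_ideal.span_zero)
  next
    case (step c s x)
    have "s * y \<in> ideal_gen ?U"
      using y
    proof (induction rule: ring_ideal.span_induct_alt)
      case base
      then show ?case by (simp add: ring_ideal.span_zero)
    next
      case (step d t y)
      have "s * t \<in> ideal_gen ?U" using \<open>s \<in> S\<close> step(1) by (intro ring_ideal.span_base) auto
      from ideal_add_scale[OF step(2) this, of d] show ?case by (simp add: algebra_simps)
    qed
    from ideal_add_scale[OF step(2) this, of c] show ?case by (simp add: algebra_simps)
  qed
  then show "ideal_mult (ideal_gen S) (ideal_gen T) \<subseteq> ideal_gen ?U"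
    unfolding ideal_mult_def by (intro ring_ideal.span_minimal) auto
  show "ideal_gen ?U \<subseteq> ideal_mult (ideal_gen S) (ideal_gen T)"
    unfolding ideal_mult_def by (intro ring_ideal.span_mono) (auto intro: ring_ideal.span_base)
qed

text \<open>The \<open>m\<close>-fold sumset, hence the exponents of products of \<open>m\<close>
  generators.\<close>

primrec nfold :: "('a \<Rightarrow> nat) set \<Rightarrow> nat \<Rightarrow> ('a \<Rightarrow> nat) set" where
  "nfold X 0 = {\<lambda>_. 0}"
| "nfold X (Suc m) = {\<lambda>j. e j + g j | e g. e \<in> X \<and> g \<in> nfold X m}"

lemma ideal_power_mon: "ideal_power (ideal_gen (mon F ` X)) m = ideal_gen (mon F ` nfold X m)"
proof (induction m)
  case 0
  have "x * 1 \<in> ideal_gen (mon F ` nfold X 0)" for x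
    by (intro ideal_scale_base) (simp add: mon_def)
  then show ?case by auto
next
  case (Suc m)
  have "{x * y | x y. x \<in> mon F ` X \<and> y \<in> mon F ` nfold X m} = mon F ` nfold X (Suc m)"
    by (force simp: mon_add)
  then show ?case by (simp only: ideal_power.simps Suc ideal_mult_gen)
qed

lemma exists_sub_sum:
  fixes h :: "'b \<Rightarrow> nat"
  assumes "finite C" "k \<le> sum h C"
  shows "\<exists>g\<le>h. sum g C = k"
  using assms(2)
proof (induction k)
  case 0
  then show ?case by (intro exI[of _ "\<lambda>_. 0"]) (auto simp: le_fun_def)
next
  case (Suc k)
  then obtain g where g: "g \<le> h" "sum g C = k" by auto
  have "\<exists>j\<in>C. g j < h j"
  proof (rule ccontr)
    assume "\<not> ?thesis"
    then have "sum h C \<le> sum g C" by (intro sum_mono) (auto simp: not_less)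
    then show False using g Suc.prems by simp
  qed
  then obtain j where j: "j \<in> C" "g j < h j" by auto
  have "sum (g(j := Suc (g j))) C = Suc (sum g C)"
    using assms(1) j by (simp add: sum.remove[of C j])
  then show ?case using g j by (intro exI[of _ "g(j := Suc (g j))"]) (auto simp: le_fun_def)
qed

text \<open>Parts of sum \<open>\<mu>\<close> on \<open>C\<close> are split off \<open>h\<close> one
  after another, each filled up by \<open>b\<close> outside \<open>C\<close>. For
  \<open>fold_exps\<close> this means that the product of the \<open>f^(m b)\<close> with
  \<open>f \<notin> C\<close> carries the power \<open>m \<mu>\<close> of \<open>(C)\<close> into
  \<open>I^m\<close>.\<close>

lemma nfold_split:
  fixes h :: "'b \<Rightarrow> nat"
  assumes "finite C" "sum h C = m * \<mu>"
    and X: "\<And>g. g \<le> h \<Longrightarrow> sum g C = \<mu> \<Longrightarrow> (\<lambda>j. if j \<in> C then g j else b) \<in> X"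
  shows "(\<lambda>j. if j \<in> C then h j else m * b) \<in> nfold X m"
  using assms(2,3)
proof (induction m arbitrary: h)
  case 0
  then show ?case using assms(1) by (auto simp: fun_eq_iff)
next
  case (Suc m)
  then obtain g where g: "g \<le> h" "sum g C = \<mu>" using exists_sub_sum[OF assms(1), of \<mu> h] by auto
  have le: "g j \<le> h j" for j using g by (auto simp: le_fun_def)
  let ?h = "\<lambda>j. h j - g j"
  have "sum ?h C = sum h C - sum g C" using le by (intro sum_subtractf_nat) auto
  then have s: "sum ?h C = m * \<mu>" using Suc.prems(1) g by simp
  have "(\<lambda>j. if j \<in> C then ?h j else m * b) \<in> nfold X m"
  proof (rule Suc.IH[OF s])
    fix g' assume "g' \<le> ?h" "sum g' C = \<mu>"
    moreover from this(1) have "g' \<le> h" by (auto simp: le_fun_def intro: order_trans)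
    ultimately show "(\<lambda>j. if j \<in> C then g' j else b) \<in> X" using Suc.prems(2) by blast
  qed
  moreover have "(\<lambda>j. if j \<in> C then h j else Suc m * b) =
      (\<lambda>j. (if j \<in> C then g j else b) + (if j \<in> C then ?h j else m * b))"
    using le by (auto simp: fun_eq_iff)
  ultimately show ?case using Suc.prems(2)[OF g] by auto
qed

section \<open>The symbolic powers\<close>

definition fold_exps :: "nat \<Rightarrow> nat \<Rightarrow> 'a set \<Rightarrow> ('a \<Rightarrow> nat) set" where
  "fold_exps a b F = {e. (\<forall>f\<in>F. e f \<le> b) \<and> sum e F = a}"

lemma fold_ideal_eq: "fold_ideal a b F = ideal_gen (mon F ` fold_exps a b F)"
  unfolding fold_ideal_def fold_exps_def mon_def by (rule arg_cong[of _ _ ideal_gen]) auto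

lemma fold_exps_sum_ge:
  assumes "finite F" "e \<in> fold_exps (b * (card F - c) + \<mu>) b F" "C \<subseteq> F" "card C = c"
  shows "\<mu> \<le> sum e C"
proof -
  have "sum e (F - C) \<le> card (F - C) * b"
    using assms(2) sum_bounded_above[of "F - C" e b] by (auto simp: fold_exps_def)
  moreover have "card (F - C) = card F - c" using assms by (metis card_Diff_subset finite_subset)
  moreover have "sum e F = sum e (F - C) + sum e C"
    using assms by (intro sum.subset_diff) auto
  ultimately show ?thesis using assms(2) by (auto simp: fold_exps_def mult.commute)
qed

lemma nfold_sum_ge:
  assumes "\<And>e. e \<in> X \<Longrightarrow> \<mu> \<le> sum e C" "e \<in> nfold X m"
  shows "m * \<mu> \<le> sum e C"
  using assms(2)
proof (induction m arbitrary: e)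
  case (Suc m)
  then obtain g h where "e = (\<lambda>j. g j + h j)" "g \<in> X" "h \<in> nfold X m" by auto
  then show ?case using assms(1)[of g] Suc.IH[of h] by (simp add: sum.distrib add_mono)
qed simp

text \<open>If fewer than \<open>c\<close> forms lay in \<open>P\<close>, at least
  \<open>card F - c + 1\<close> would lie outside. As \<open>\<mu> \<le> b\<close>, exponents up to
  \<open>b\<close> on these reach the required sum and give a generator outside
  \<open>P\<close>.\<close>

lemma prime_contains_fold_ideal:
  assumes "is_prime_ideal P" "finite F" "c \<le> card F" "\<mu> \<le> b"
    and "fold_ideal (b * (card F - c) + \<mu>) b F \<subseteq> P"
  shows "\<exists>C\<subseteq>F. card C = c \<and> C \<subseteq> P"
proof -
  let ?U = "F - P" and ?a = "b * (card F - c) + \<mu>"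
  have "\<not> ?a \<le> card ?U * b"
  proof
    assume *: "?a \<le> card ?U * b"
    have "\<exists>g\<le>(\<lambda>j. if j \<in> ?U then b else 0). sum g F = ?a"
    proof (rule exists_sub_sum[OF assms(2)])
      have "(\<Sum>j\<in>F. if j \<in> ?U then b else 0) = (\<Sum>j\<in>?U. b)"
        using assms(2) by (intro sum.mono_neutral_cong_right) auto
      then show "?a \<le> (\<Sum>j\<in>F. if j \<in> ?U then b else 0)" using * by simp
    qed
    then obtain g where g: "g \<le> (\<lambda>j. if j \<in> ?U then b else 0)" "sum g F = ?a" by blast
    have le: "g j \<le> (if j \<in> ?U then b else 0)" for j using le_funD[OF g(1), of j] by simp
    have "g j \<le> b" for j using le[of j] by (simp split: if_splits)
    then have "g \<in> fold_exps ?a b F" using g(2) by (simp add: fold_exps_def)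
    then have "mon F g \<in> P" using assms(5) unfolding fold_ideal_eq by (meson imageI ring_ideal.span_base subsetD)
    then obtain f where f: "f \<in> F" "f ^ g f \<in> P"
      using prime_ideal_prod[OF assms(1), of "\<lambda>f. f ^ g f" F] by (auto simp: mon_def)
    then have "f \<in> P" using prime_ideal_power[OF assms(1)] by blast
    then have "g f = 0" using le[of f] by simp
    then show False using f prime_ideal_one[OF assms(1)] by simp
  qed
  then have "card ?U * b < (card F - c) * b + b" using assms(4) by (simp add: mult.commute)
  also have "\<dots> = Suc (card F - c) * b" by simp
  finally have "card ?U < Suc (card F - c)" by (simp only: mult_less_cancel2)
  moreover have "card F = card ?U + card (F \<inter> P)"
    using assms(2) by (metis Diff_Int card_Diff_subset_Int Int_lower1 card_mono le_add_diff_inverse2 finite_Int)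
  ultimately have "c \<le> card (F \<inter> P)" using assms(3) by simp
  then obtain C where "C \<subseteq> F \<inter> P" "card C = c" by (rule obtain_subset_with_card_n)
  then show ?thesis by blast
qed

theorem symbolic_power_fold_ideal:
  fixes F :: "('v::{finite,linorder}, 'k::field) mpoly set"
  assumes gen: "generic_forms n F" "finite F" "n + 1 \<le> card F" and n: "card (UNIV :: 'v set) = n + 1"
    and c: "c \<le> n" and \<mu>: "1 \<le> \<mu>" "\<mu> \<le> b" and a: "a = b * (card F - c) + \<mu>"
  shows "symbolic_power (fold_ideal a b F) m = star.star_ideal F c (m * \<mu>)"
proof -
  interpret star F c using gen c by (intro generic_forms_star) auto
  let ?I = "fold_ideal a b F" and ?X = "fold_exps a b F"
  have Im: "ideal_power ?I m = ideal_gen (mon F ` nfold ?X m)"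
    by (simp add: fold_ideal_eq ideal_power_mon)
  have idI: "is_ideal ?I" by (simp add: fold_ideal_eq)
  have contr: "contracted_ideal P (ideal_power ?I m) = {r. \<exists>u. u \<notin> P \<and> u * r \<in> ideal_power ?I m}"
    if "is_prime_ideal P" for P using that by (intro contracted_ideal_eq) (simp_all add: Im)
  have sub_C: "?I \<subseteq> ideal_gen C" if C: "C \<subseteq> F" "card C = c" for C
    unfolding fold_ideal_eq
  proof (intro ring_ideal.span_minimal image_subsetI)
    fix e assume "e \<in> ?X"
    then have "\<mu> \<le> sum e C" using fold_exps_sum_ge[OF gen(2), of e b c \<mu> C] C a by simp
    then have "\<exists>f\<in>C. e f \<noteq> 0" using \<mu>(1) by (metis not_one_le_zero order_trans sum.neutral)
    then obtain f where f: "f \<in> C" "1 \<le> e f" by (auto simp: Suc_le_eq)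
    then obtain r where "mon F e = r * f ^ 1" using mon_mem_factor[of F f 1 e] gen(2) C by auto
    then show "mon F e \<in> ideal_gen C" using f by (auto intro: ideal_scale_base)
  qed auto
  have sub_P: "\<exists>C\<subseteq>F. card C = c \<and> C \<subseteq> P" if "is_prime_ideal P" "?I \<subseteq> P" for P
    using prime_contains_fold_ideal[OF that(1) gen(2) c_le \<mu>(2)] that(2) a by simp
  show ?thesis
  proof (intro equalityI subsetI)
    fix r assume r: "r \<in> symbolic_power ?I m"
    show "r \<in> star_ideal (m * \<mu>)"
    proof (rule inter_sub_star_ideal)
      fix C assume C: "C \<subseteq> F" "card C = c"
      let ?Q = "ideal_gen (mon C ` {e. m * \<mu> \<le> sum e C})"
      show "r \<in> ?Q"
      proof (rule ccontr)
        assume nr: "r \<notin> ?Q"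
        from exists_minimal_prime[OF gen n c C nr]
        obtain P where PP: "is_prime_ideal P \<and> C \<subseteq> P \<and> (\<forall>f\<in>F - C. f \<notin> P) \<and>
            (\<forall>u. u * r \<in> ?Q \<longrightarrow> u \<in> P) \<and>
            (\<forall>P'. is_prime_ideal P' \<longrightarrow> C \<subseteq> P' \<longrightarrow> P' \<subseteq> P \<longrightarrow> P' = P)" ..
        then have P: "is_prime_ideal P" "C \<subseteq> P" "\<And>f. f \<in> F - C \<Longrightarrow> f \<notin> P"
          "\<And>u. u * r \<in> ?Q \<Longrightarrow> u \<in> P"
          "\<And>P'. is_prime_ideal P' \<Longrightarrow> C \<subseteq> P' \<Longrightarrow> P' \<subseteq> P \<Longrightarrow> P' = P"
          by simp_all
        have "P \<in> minimal_primes ?I" unfolding minimal_primes_def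
        proof (intro CollectI conjI allI impI)
          show "?I \<subseteq> P" using sub_C[OF C] ideal_gen_sub_prime[OF P(1,2)] by blast
          fix P' assume P': "is_prime_ideal P' \<and> ?I \<subseteq> P' \<and> P' \<subseteq> P"
          then obtain C' where C': "C' \<subseteq> F" "card C' = c" "C' \<subseteq> P'" using sub_P by blast
          \<comment> \<open>The prime \<open>P\<close> contains no form outside \<open>C\<close>,
            and \<open>P'\<close> lies inside \<open>P\<close>.\<close>
          then have "C' \<subseteq> C" using P(3) P' by blast
          then have "C' = C" using C C' gen(2) by (metis card_subset_eq finite_subset)
          then show "P' = P" using P(5) P' C' by blast
        qed (rule P(1))
        then have "r \<in> contracted_ideal P (ideal_power ?I m)"
          using r by (simp add: symbolic_power_def)
        then obtain u where u: "u \<notin> P" "u * r \<in> ideal_power ?I m" using contr[OF P(1)] by blast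
        have "ideal_power ?I m \<subseteq> ?Q" unfolding Im
        proof (intro ring_ideal.span_minimal image_subsetI)
          fix e assume e: "e \<in> nfold ?X m"
          have "m * \<mu> \<le> sum e C"
            using fold_exps_sum_ge[OF gen(2) _ C] a by (intro nfold_sum_ge[OF _ e]) auto
          then show "mon F e \<in> ?Q"
            unfolding mon_split[OF gen(2) C(1)] by (intro ideal_scale_base) auto
        qed auto
        then show False using u P(4) by blast
      qed
    qed
  next
    fix r assume r: "r \<in> star_ideal (m * \<mu>)"
    show "r \<in> symbolic_power ?I m" unfolding symbolic_power_def
    proof
      fix P assume Pmin: "P \<in> minimal_primes ?I"
      then have P: "is_prime_ideal P" "?I \<subseteq> P" by (auto simp: minimal_primes_def)
      then obtain C where C: "C \<subseteq> F" "card C = c" "C \<subseteq> P" using sub_P by blast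
      have finC: "finite C" using C gen(2) finite_subset by blast
      have "P \<in> minimal_primes (ideal_gen C)"
        using Pmin sub_C[OF C(1,2)] ideal_gen_sub_prime[OF P(1) C(3)] P(1)
        unfolding minimal_primes_def by blast
      then have zd: "\<exists>y k. y \<notin> P \<and> y * x ^ k \<in> ideal_gen C" if "x \<in> P" for x
        using that by (intro minimal_prime_zero_divisor) auto
      \<comment> \<open>A form outside \<open>C\<close> is regular modulo \<open>(C)\<close>,
        whereas an element of a minimal prime over \<open>(C)\<close> has a power that is sent into
        \<open>(C)\<close> by some factor outside \<open>P\<close>.\<close>
      have FC: "f \<notin> P" if f: "f \<in> F - C" for f
      proof
        assume "f \<in> P"
        then obtain y k where "y \<notin> P" "y * f ^ k \<in> ideal_gen C" using zd by blast
        then show False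
          using nzdD[OF nzd_power[OF nzd_F[OF C(1,2) f]]] ideal_gen_sub_prime[OF P(1) C(3)] by blast
      qed
      \<comment> \<open>Each of the \<open>m\<close> factors of a generator of \<open>I^m\<close>
        may use the full exponent \<open>b\<close> outside \<open>C\<close>; the resulting
        multiplier is a unit at \<open>P\<close>.\<close>
      let ?d = "\<lambda>j. if j \<in> C then 0 else m * b"
      have "mon F ?d \<notin> P"
      proof
        assume "mon F ?d \<in> P"
        then obtain f where "f \<in> F" "f ^ ?d f \<in> P"
          using prime_ideal_prod[OF P(1), of "\<lambda>f. f ^ ?d f" F] by (auto simp: mon_def)
        then show False
          using FC[of f] prime_ideal_one[OF P(1)] prime_ideal_power[OF P(1), of f "?d f"]
          by (cases "f \<in> C") auto
      qed
      moreover have "mon F ?d * r \<in> ideal_power ?I m"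
        using r unfolding star_ideal_def Im
      proof (induction rule: ring_ideal.span_induct_alt)
        case base
        then show ?case by (simp add: ring_ideal.span_zero)
      next
        case (step k x y)
        then obtain e where e: "e \<in> expo (m * \<mu>)" "x = mon F e" by blast
        then have "m * \<mu> \<le> sum e C" using C by (simp add: expo_def)
        then obtain h where h: "h \<le> e" "sum h C = m * \<mu>" using exists_sub_sum[OF finC] by blast
        have nf: "(\<lambda>j. if j \<in> C then h j else m * b) \<in> nfold ?X m"
        proof (rule nfold_split[OF finC h(2)])
          fix g assume g: "g \<le> h" "sum g C = \<mu>"
          have "g j \<le> b" if "j \<in> C" for j
            using member_le_sum[of j C g] that finC g(2) \<mu>(2) by simp
          moreover have "(\<Sum>j\<in>F. if j \<in> C then g j else b) = (\<Sum>j\<in>F - C. b) + sum g C"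
            using gen(2) C(1) by (subst sum.subset_diff[of C F]) (auto intro!: arg_cong2[of _ _ _ _ "(+)"] sum.cong)
          ultimately show "(\<lambda>j. if j \<in> C then g j else b) \<in> ?X"
            using g(2) C finC a by (simp add: fold_exps_def card_Diff_subset mult.commute)
        qed
        have "mon F (\<lambda>j. ?d j + e j) \<in> ideal_gen (mon F ` nfold ?X m)"
          using le_funD[OF h(1)] by (intro mon_mem_ideal[OF nf]) auto
        then have "mon F ?d * x \<in> ideal_gen (mon F ` nfold ?X m)" unfolding e(2) by (simp only: mon_add)
        from ideal_add_scale[OF step(2) this, of k] show ?case by (simp add: algebra_simps)
      qed
      ultimately show "r \<in> contracted_ideal P (ideal_power ?I m)" using contr[OF P(1)] by blast
    qed
  qed
qed

section \<open>Minimal monomial generators\<close>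

text \<open>These are the exponents for which the \<open>c\<close> least entries have sum \<open>M\<close> and all other entries are
  equal to the largest of them, which is \<open>t\<close>.\<close>

definition min_exps :: "'a set \<Rightarrow> nat \<Rightarrow> nat \<Rightarrow> ('a \<Rightarrow> nat) set" where
  "min_exps F c M = {e. (\<forall>j. j \<notin> F \<longrightarrow> e j = 0) \<and>
     (\<exists>t. (\<forall>j\<in>F. e j \<le> t) \<and> card F - c < card {j\<in>F. e j = t} \<and> sum e F = M + (card F - c) * t)}"

text \<open>More than \<open>card F - c\<close> entries equal \<open>t\<close>. Setting
  \<open>card F - c\<close> of them aside leaves \<open>D\<close>, and a further entry equal to
  \<open>t\<close> stays in \<open>D\<close> as the witness \<open>i\<close>.\<close>

lemma min_exps_low:
  assumes F: "finite F" "c \<le> card F" and e: "\<And>j. j \<in> F \<Longrightarrow> e j \<le> t"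
    "card F - c < card {j\<in>F. e j = t}" "sum e F = M + (card F - c) * t"
  obtains D i where "D \<subseteq> F" "card D = c" "i \<in> D" "e i = t" "\<And>j. j \<in> F - D \<Longrightarrow> e j = t" "sum e D = M"
proof -
  obtain K where K: "K \<subseteq> {j\<in>F. e j = t}" "card K = card F - c"
    using e(2) obtain_subset_with_card_n[of "card F - c" "{j\<in>F. e j = t}"] by auto
  have finK: "finite K" using K F by (auto intro: finite_subset)
  have "\<not> {j\<in>F. e j = t} \<subseteq> K"
    using card_mono[OF finK, of "{j\<in>F. e j = t}"] e(2) K by auto
  then obtain i where i: "i \<in> F" "e i = t" "i \<notin> K" by auto
  have KF: "K \<subseteq> F" using K by auto
  have "sum e F = sum e (F - K) + sum e K" using F KF by (intro sum.subset_diff) auto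
  moreover have "sum e K = (\<Sum>j\<in>K. t)" using K by (intro sum.cong) auto
  ultimately have "sum e (F - K) = M" using e(3) K by simp
  moreover have "card (F - K) = c" using F K KF finK by (simp add: card_Diff_subset)
  moreover have "F - (F - K) = K" using KF by auto
  ultimately show ?thesis using that[of "F - K" i] i K by auto
qed

lemma finite_min_exps:
  assumes "finite F" "c \<le> card F"
  shows "finite (min_exps F c M)"
proof (rule finite_subset)
  show "min_exps F c M \<subseteq> {e. \<forall>j. (j \<in> F \<longrightarrow> e j \<in> {..M}) \<and> (j \<notin> F \<longrightarrow> e j = 0)}"
  proof
    fix e assume e: "e \<in> min_exps F c M"
    then obtain t where t: "\<And>j. j \<in> F \<Longrightarrow> e j \<le> t" "card F - c < card {j\<in>F. e j = t}"
      "sum e F = M + (card F - c) * t" by (auto simp: min_exps_def)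
    obtain D i where D: "D \<subseteq> F" "card D = c" "i \<in> D" "e i = t"
      "\<And>j. j \<in> F - D \<Longrightarrow> e j = t" "sum e D = M"
      by (rule min_exps_low[OF assms t]) auto
    have "t \<le> M" using member_le_sum[of i D e] D assms finite_subset by auto
    then show "e \<in> {e. \<forall>j. (j \<in> F \<longrightarrow> e j \<in> {..M}) \<and> (j \<notin> F \<longrightarrow> e j = 0)}"
      using e t(1) by (fastforce simp: min_exps_def)
  qed
  show "finite {e. \<forall>j. (j \<in> F \<longrightarrow> e j \<in> {..M}) \<and> (j \<notin> F \<longrightarrow> e j = 0)}"
    using assms by (intro finite_set_of_finite_funs) auto
qed

context star
begin

lemma min_exps_sub_expo: "min_exps F c M \<subseteq> expo M"
proof
  fix e assume "e \<in> min_exps F c M"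
  then obtain t where t: "\<And>j. j \<in> F \<Longrightarrow> e j \<le> t" "sum e F = M + (card F - c) * t"
    by (auto simp: min_exps_def)
  show "e \<in> expo M" unfolding expo_def
  proof (intro CollectI allI impI)
    fix C assume C: "C \<subseteq> F" "card C = c"
    have "sum e (F - C) \<le> card (F - C) * t"
      using t(1) sum_bounded_above[of "F - C" e t] by auto
    moreover have "card (F - C) = card F - c" using C finF by (metis card_Diff_subset finite_subset)
    moreover have "sum e F = sum e (F - C) + sum e C" using C finF by (intro sum.subset_diff) auto
    ultimately show "M \<le> sum e C" using t(2) by simp
  qed
qed

text \<open>Among the exponents below \<open>g\<close> with all sums at least \<open>M\<close>, one
  of least total is taken. Each positive entry then lies in a subset of sum exactly
  \<open>M\<close>, and exchanges of single elements force all entries outside a lightest subset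
  \<open>D\<close> to equal the maximum on \<open>D\<close>.\<close>

lemma min_exps_below:
  assumes g: "g \<in> expo M" and M: "0 < M" and c: "0 < c"
  shows "\<exists>e\<in>min_exps F c M. \<forall>j\<in>F. e j \<le> g j"
proof -
  let ?P = "\<lambda>e. e \<in> expo M \<and> (\<forall>j. j \<notin> F \<longrightarrow> e j = 0) \<and> (\<forall>j\<in>F. e j \<le> g j)"
  have "?P (\<lambda>j. if j \<in> F then g j else 0)"
  proof (intro conjI)
    have "sum (\<lambda>j. if j \<in> F then g j else 0) C = sum g C" if "C \<subseteq> F" for C
      using that by (intro sum.cong) auto
    then show "(\<lambda>j. if j \<in> F then g j else 0) \<in> expo M" using g by (simp add: expo_def)
  qed auto
  from ex_has_least_nat[of ?P, OF this, of "\<lambda>e. sum e F"]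
  obtain e where "?P e \<and> (\<forall>e'. ?P e' \<longrightarrow> sum e F \<le> sum e' F)" ..
  then have e: "e \<in> expo M" "\<And>j. j \<notin> F \<Longrightarrow> e j = 0" "\<And>j. j \<in> F \<Longrightarrow> e j \<le> g j"
    and min: "\<And>e'. ?P e' \<Longrightarrow> sum e F \<le> sum e' F" by simp_all
  have eM: "M \<le> sum e C" if "C \<subseteq> F" "card C = c" for C using e(1) that by (auto simp: expo_def)
  have fin: "finite C" if "C \<subseteq> F" for C using that finF finite_subset by blast
  have tight: "\<exists>C\<subseteq>F. card C = c \<and> j \<in> C \<and> sum e C = M" if j: "j \<in> F" "0 < e j" for j
  proof -
    let ?e = "e(j := e j - 1)"
    have "sum ?e F < sum e F" using finF j by (intro sum_strict_mono_ex1) auto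
    have "\<not> ?P ?e"
    proof
      assume "?P ?e"
      from min[OF this] show False using \<open>sum ?e F < sum e F\<close> by linarith
    qed
    moreover have "?e i \<le> g i" if "i \<in> F" for i using e(3)[OF that] by auto
    moreover have "?e i = 0" if "i \<notin> F" for i using e(2)[OF that] j that by auto
    ultimately have "?e \<notin> expo M" by blast
    then obtain C where C: "C \<subseteq> F" "card C = c" "sum ?e C < M" by (auto simp: expo_def not_le)
    have "j \<in> C"
    proof (rule ccontr)
      assume "j \<notin> C"
      then have "sum ?e C = sum e C" by (intro sum.cong) auto
      then show False using C eM[of C] by simp
    qed
    then have "sum e C = Suc (sum ?e C)" using fin[OF C(1)] j by (simp add: sum.remove[of C j])
    then have "sum e C = M" using C eM[of C] by simp
    then show ?thesis using C \<open>j \<in> C\<close> by blast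
  qed
  obtain D where D: "D \<subseteq> F" "card D = c" "\<And>C. C \<subseteq> F \<Longrightarrow> card C = c \<Longrightarrow> sum e D \<le> sum e C"
  proof -
    obtain D0 where "D0 \<subseteq> F" "card D0 = c" using c_le by (rule obtain_subset_with_card_n)
    then show ?thesis
      using ex_has_least_nat[of "\<lambda>C. C \<subseteq> F \<and> card C = c" D0 "sum e"] that by blast
  qed
  have "\<exists>j\<in>F. 0 < e j"
  proof (rule ccontr)
    assume "\<not> ?thesis"
    then have "sum e D = 0" using D(1) by (intro sum.neutral) auto
    then show False using eM[OF D(1,2)] M by simp
  qed
  then have DM: "sum e D = M" using tight D(3) eM[OF D(1,2)] by (metis order_antisym)
  have finD: "finite D" and Dne: "D \<noteq> {}" using fin D c by auto
  define t where "t = Max (e ` D)"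
  have tD: "e j \<le> t" if "j \<in> D" for j unfolding t_def using that finD by (intro Max_ge) auto
  have "t \<in> e ` D" unfolding t_def using finD Dne by (intro Max_in) auto
  then obtain i where i: "i \<in> D" "e i = t" by blast
  have swap: "sum e (insert k (C - {l})) + e l = sum e C + e k" "card (insert k (C - {l})) = c"
    if "C \<subseteq> F" "card C = c" "l \<in> C" "k \<notin> C" for C k l
    using that fin[of C] c by (simp_all add: sum.remove[of C l])
  have tF: "e j = t" if j: "j \<in> F - D" for j
  proof (rule antisym)
    have "sum e D \<le> sum e (insert j (D - {i}))"
      using D j i swap(2)[of D i j] by (intro D(3)) auto
    then show "t \<le> e j" using swap(1)[of D i j] D i j by simp
    show "e j \<le> t"
    proof (rule ccontr)
      \<comment> \<open>An entry above \<open>t\<close> lies in a subset of sum \<open>M\<close>;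
        exchanging it for an element of \<open>D\<close> would push that sum below
        \<open>M\<close>.\<close>
      assume *: "\<not> e j \<le> t"
      then obtain C where C: "C \<subseteq> F" "card C = c" "j \<in> C" "sum e C = M" using tight[of j] j by auto
      have "\<not> D \<subseteq> C" using card_subset_eq[OF fin[OF C(1)]] C D j by auto
      then obtain k where k: "k \<in> D" "k \<notin> C" by auto
      have "M \<le> sum e (insert k (C - {j}))"
        using C k D swap(2)[of C j k] by (intro eM) auto
      then show False using swap(1)[of C j k] C k tD[of k] * by simp
    qed
  qed
  have "e \<in> min_exps F c M" unfolding min_exps_def
  proof (intro CollectI conjI allI impI exI[of _ t] ballI)
    show "e j = 0" if "j \<notin> F" for j using e(2) that .
    show "e j \<le> t" if "j \<in> F" for j using tD tF that by (cases "j \<in> D") auto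
    have cd: "card (F - D) = card F - c" using D finD by (simp add: card_Diff_subset)
    have "card F - c < card (insert i (F - D))" using i cd finF by simp
    also have "\<dots> \<le> card {j \<in> F. e j = t}" using finF tF i D by (intro card_mono) auto
    finally show "card F - c < card {j \<in> F. e j = t}" .
    have "sum e F = sum e (F - D) + sum e D" using D finF by (intro sum.subset_diff) auto
    moreover have "sum e (F - D) = (\<Sum>j\<in>F - D. t)" using tF by (intro sum.cong) auto
    ultimately show "sum e F = M + (card F - c) * t" using DM cd by simp
  qed
  then show ?thesis using e(3) by blast
qed

text \<open>The witness \<open>D\<close> has sum \<open>M\<close> and contains an entry equal to
  \<open>t\<close>. As \<open>M\<close> cannot be undercut, \<open>e'\<close> agrees with
  \<open>e\<close> on \<open>D\<close>; a larger top value of \<open>e'\<close> would occur only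
  outside \<open>D\<close>, where there are too few elements; the total then fixes the rest.\<close>

lemma min_exps_irr:
  assumes "e \<in> min_exps F c M"
  shows "\<exists>D\<subseteq>F. card D = c \<and>
    (\<forall>e'\<in>min_exps F c M. (\<forall>j\<in>D. e' j \<le> e j) \<longrightarrow> e' = e)"
proof -
  obtain t where t: "\<And>j. j \<in> F \<Longrightarrow> e j \<le> t" "card F - c < card {j\<in>F. e j = t}"
    "sum e F = M + (card F - c) * t" and e0: "\<And>j. j \<notin> F \<Longrightarrow> e j = 0"
    using assms by (auto simp: min_exps_def)
  obtain D i where D: "D \<subseteq> F" "card D = c" "i \<in> D" "e i = t"
    "\<And>j. j \<in> F - D \<Longrightarrow> e j = t" "sum e D = M"
    by (rule min_exps_low[OF finF c_le t]) auto
  have finD: "finite D" using D finF finite_subset by auto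
  have "e' = e" if e': "e' \<in> min_exps F c M" and le: "\<forall>j\<in>D. e' j \<le> e j" for e'
  proof -
    obtain t' where t': "\<And>j. j \<in> F \<Longrightarrow> e' j \<le> t'" "card F - c < card {j\<in>F. e' j = t'}"
      "sum e' F = M + (card F - c) * t'" and e'0: "\<And>j. j \<notin> F \<Longrightarrow> e' j = 0"
      using e' by (auto simp: min_exps_def)
    have M: "M \<le> sum e' D" using min_exps_sub_expo e' D by (auto simp: expo_def)
    have eqD: "e' j = e j" if j: "j \<in> D" for j
    proof (rule ccontr)
      assume "e' j \<noteq> e j"
      then have "e' j < e j" using le j by (simp add: le_neq_implies_less)
      then have "sum e' D < sum e D" using finD le j by (intro sum_strict_mono_ex1) auto
      then show False using M D(6) by simp
    qed
    have cd: "card (F - D) = card F - c" using D finD by (simp add: card_Diff_subset)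
    have "t' = t"
    proof (rule ccontr)
      assume "t' \<noteq> t"
      moreover have "t \<le> t'" using t'(1)[of i] eqD[of i] D by auto
      ultimately have "t < t'" by simp
      have "{j\<in>F. e' j = t'} \<subseteq> F - D"
      proof
        fix j assume j: "j \<in> {j\<in>F. e' j = t'}"
        have "j \<notin> D"
        proof
          assume "j \<in> D"
          then have "t' \<le> t" using eqD[of j] j t(1)[of j] by simp
          then show False using \<open>t < t'\<close> by simp
        qed
        then show "j \<in> F - D" using j by simp
      qed
      then have "card {j\<in>F. e' j = t'} \<le> card F - c" using finF cd by (metis card_mono finite_Diff)
      then show False using t'(2) by simp
    qed
    have "sum e' F = sum e' (F - D) + sum e' D" using D finF by (intro sum.subset_diff) auto
    moreover have "sum e' D = M" using eqD D(6) by (simp cong: sum.cong)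
    ultimately have s: "sum e' (F - D) = (\<Sum>j\<in>F - D. t)" using t'(3) \<open>t' = t\<close> cd by simp
    have "e' j = t" if j: "j \<in> F - D" for j
    proof (rule ccontr)
      assume "e' j \<noteq> t"
      then have "e' j < t" using t'(1)[of j] \<open>t' = t\<close> j by simp
      then have "sum e' (F - D) < (\<Sum>j\<in>F - D. t)"
        using finF j t'(1) \<open>t' = t\<close> by (intro sum_strict_mono_ex1) auto
      then show False using s by simp
    qed
    then show ?thesis using eqD D(5) e0 e'0 by (metis DiffI ext)
  qed
  then show ?thesis using D by blast
qed

lemma star_ideal_eq_min_exps:
  assumes "0 < M" "0 < c"
  shows "star_ideal M = ideal_gen (mon F ` min_exps F c M)"
proof
  show "star_ideal M \<subseteq> ideal_gen (mon F ` min_exps F c M)" unfolding star_ideal_def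
  proof (intro ring_ideal.span_minimal image_subsetI)
    fix g assume "g \<in> expo M"
    then obtain e where "e \<in> min_exps F c M" "\<forall>j\<in>F. e j \<le> g j" using min_exps_below assms by blast
    then show "mon F g \<in> ideal_gen (mon F ` min_exps F c M)" by (intro mon_mem_ideal) auto
  qed auto
  show "ideal_gen (mon F ` min_exps F c M) \<subseteq> star_ideal M"
    unfolding star_ideal_def using min_exps_sub_expo by (intro ring_ideal.span_mono) auto
qed

text \<open>By \<open>min_exps_irr\<close>, all other terms vanish modulo the powers
  \<open>f^(e f + 1)\<close> with \<open>f \<in> D\<close>. For forms, membership in
  \<open>(D)\<close> makes the constant term 0, so no minimal generator is redundant.\<close>

lemma min_exps_relation:
  assumes rel: "(\<Sum>e\<in>min_exps F c M. \<rho> e * mon F e) = 0" and e: "e \<in> min_exps F c M"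
  shows "\<exists>D\<subseteq>F. \<rho> e \<in> ideal_gen D"
proof -
  from min_exps_irr[OF e] obtain D where "D \<subseteq> F \<and> card D = c \<and>
    (\<forall>e'\<in>min_exps F c M. (\<forall>j\<in>D. e' j \<le> e j) \<longrightarrow> e' = e)" ..
  then have D: "D \<subseteq> F" "card D = c"
    "\<And>e'. e' \<in> min_exps F c M \<Longrightarrow> (\<And>j. j \<in> D \<Longrightarrow> e' j \<le> e j) \<Longrightarrow> e' = e"
    by simp_all
  let ?I = "ideal_gen ((\<lambda>f. f ^ Suc (e f)) ` D)"
  have oth: "mon F e' \<in> ?I" if "e' \<in> min_exps F c M - {e}" for e'
  proof -
    have "\<exists>j\<in>D. e j < e' j"
    proof (rule ccontr)
      assume "\<not> ?thesis"
      then have "e' = e" using that by (intro D(3)) (auto simp: not_less)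
      then show False using that by simp
    qed
    then obtain j where "j \<in> D" "e j < e' j" by blast
    then show ?thesis using finF D(1) by (intro mon_mem_irr) auto
  qed
  have "\<rho> e * mon F e = - (\<Sum>e'\<in>min_exps F c M - {e}. \<rho> e' * mon F e')"
    using rel sum.remove[OF finite_min_exps[OF finF c_le] e, of "\<lambda>e. \<rho> e * mon F e"]
    by (simp add: add_eq_0_iff2)
  also have "\<dots> \<in> ?I"
    using oth by (intro ring_ideal.span_neg ring_ideal.span_sum ring_ideal.span_scale)
  finally have "(\<rho> e * mon (F - D) e) * mon D e \<in> ?I"
    unfolding mon_split[OF finF D(1)] by (simp add: mult.assoc)
  then have *: "\<rho> e * mon (F - D) e \<in> ideal_gen D"
    by (rule reg_fam_mon_mem[OF reg[OF D(1,2)] finite_subset[OF D(1) finF]])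
  have "nzd (mon (F - D) e) (ideal_gen D)"
    unfolding mon_def using nzd_F[OF D(1,2)] by (intro nzd_prod nzd_power) auto
  from nzdD[OF this *] show ?thesis using D(1) by blast
qed

end

section \<open>The minimal number of generators\<close>

lemma coset_add:
  assumes "is_ideal N"
  shows "(x +o N) + (y +o N) = (x + y) +o N"
proof (intro set_eqI iffI)
  fix z assume "z \<in> (x +o N) + (y +o N)"
  then obtain n n' where "n \<in> N" "n' \<in> N" "z = (x + n) + (y + n')"
    by (auto simp: set_plus_def elt_set_plus_def)
  then show "z \<in> (x + y) +o N"
    using ring_ideal.subspace_add[OF assms, of n n'] by (auto simp: elt_set_plus_def intro!: bexI[of _ "n + n'"])
next
  fix z assume "z \<in> (x + y) +o N"
  then obtain n where "n \<in> N" "z = (x + 0) + (y + n)" by (auto simp: elt_set_plus_def)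
  then show "z \<in> (x +o N) + (y +o N)"
    using ring_ideal.subspace_0[OF assms] unfolding set_plus_def elt_set_plus_def by blast
qed

lemma coset_scale_coset:
  assumes "is_ideal N"
  shows "coset_scale N r (x +o N) = (r * x) +o N"
proof (intro set_eqI iffI)
  fix z assume "z \<in> coset_scale N r (x +o N)"
  then obtain n n' where n: "n \<in> N" "n' \<in> N" "z = r * (x + n) + n'"
    by (auto simp: coset_scale_def set_plus_def elt_set_plus_def elt_set_times_def)
  then have "z = r * x + (r * n + n')" by (simp add: algebra_simps)
  moreover have "r * n + n' \<in> N"
    using n ring_ideal.subspace_add[OF assms] ring_ideal.subspace_scale[OF assms] by blast
  ultimately show "z \<in> (r * x) +o N" by (auto simp: elt_set_plus_def)
next
  fix z assume "z \<in> (r * x) +o N"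
  then obtain n where n: "n \<in> N" "z = r * (x + 0) + n" by (auto simp: elt_set_plus_def)
  then show "z \<in> coset_scale N r (x +o N)"
    using ring_ideal.subspace_0[OF assms]
    unfolding coset_scale_def set_plus_def elt_set_plus_def elt_set_times_def by blast
qed

lemma coset_cong:
  assumes "is_ideal N" "x - y \<in> N"
  shows "x +o N = y +o N"
proof -
  have "x +o N \<subseteq> y +o N" if "x - y \<in> N" for x y
  proof
    fix z assume "z \<in> x +o N"
    then obtain n where n: "n \<in> N" "z = y + ((x - y) + n)" by (auto simp: elt_set_plus_def)
    then show "z \<in> y +o N" using ring_ideal.subspace_add[OF assms(1) that n(1)]
      unfolding elt_set_plus_def by blast
  qed
  moreover have "y - x \<in> N" using ring_ideal.subspace_neg[OF assms] by simp
  ultimately show ?thesis using assms(2) by blast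
qed

lemma coset_self: "is_ideal N \<Longrightarrow> x \<in> x +o N"
  using ring_ideal.subspace_0[of N] by (force simp: elt_set_plus_def)

lemma coset_zero: "0 +o N = (N :: 'a::comm_ring_1 set)"
  by (auto simp: elt_set_plus_def)

lemma quot_span_cosets:
  assumes N: "is_ideal N" and L: "is_ideal L" and G: "G \<subseteq> quot_carrier L N" and A: "A \<in> quot_span N G"
  shows "A \<in> quot_carrier L N"
  using A
proof induction
  case zero
  have "0 +o N \<in> quot_carrier L N"
    unfolding quot_carrier_def using ring_ideal.subspace_0[OF L] by (rule imageI)
  then show ?case by (simp only: coset_zero)
next
  case (gen A)
  then show ?case using G by blast
next
  case (add A B)
  then obtain x y where "x \<in> L" "y \<in> L" "A = x +o N" "B = y +o N" by (auto simp: quot_carrier_def)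
  then show ?case using ring_ideal.subspace_add[OF L] coset_add[OF N] by (auto simp: quot_carrier_def)
next
  case (scale A r)
  then obtain x where "x \<in> L" "A = x +o N" by (auto simp: quot_carrier_def)
  then show ?case using ring_ideal.subspace_scale[OF L] coset_scale_coset[OF N] by (auto simp: quot_carrier_def)
qed

text \<open>Comparing cosets with \<open>K\<close> as sets avoids a choice of
  representatives.\<close>

lemma quot_span_sub:
  assumes K: "is_ideal K" "N \<subseteq> K" and G: "\<And>A. A \<in> G \<Longrightarrow> A \<subseteq> K" and A: "A \<in> quot_span N G"
  shows "A \<subseteq> K"
  using A
proof induction
  case (add A B)
  then show ?case using ring_ideal.subspace_add[OF K(1)] by (auto simp: set_plus_def)
next
  case (scale A r)
  then have "r * x + y \<in> K" if "x \<in> A" "y \<in> N" for x y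
    using that K ring_ideal.subspace_add[OF K(1)] ring_ideal.subspace_scale[OF K(1)] by blast
  then show ?case by (auto simp: coset_scale_def set_plus_def elt_set_times_def)
qed (use K G in auto)

text \<open>Lower bound: if \<open>G\<close> had fewer elements than \<open>E\<close>, some nonzero linear functional of the constant
  terms of the coefficients would vanish on representatives of \<open>G\<close>, hence on the whole module.\<close>

lemma min_gens_quot_eq_card:
  fixes \<phi> :: "'i \<Rightarrow> ('v, 'k::field) mpoly"
  assumes finA: "finite A" and E: "E \<subseteq> A" and N: "is_ideal N"
    and ind: "\<And>\<rho> a. (\<Sum>a\<in>A. \<rho> a * \<phi> a) = 0 \<Longrightarrow> a \<in> A \<Longrightarrow> Poly_Mapping.lookup (\<rho> a) 0 = 0"
    and N_sub: "\<And>x. x \<in> N \<Longrightarrow>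
      \<exists>\<rho>. x = (\<Sum>a\<in>A. \<rho> a * \<phi> a) \<and> (\<forall>a\<in>E. Poly_Mapping.lookup (\<rho> a) 0 = 0)"
    and N_sup: "\<And>a. a \<in> A - E \<Longrightarrow> \<phi> a \<in> N"
  shows "min_gens_quot (ideal_gen (\<phi> ` A)) N = card E"
proof -
  let ?L = "ideal_gen (\<phi> ` A)" and ?c = "\<lambda>p. Poly_Mapping.lookup p 0"
  have finE: "finite E" using finA E finite_subset by blast
  have rep: "\<exists>\<rho>. x = (\<Sum>a\<in>A. \<rho> a * \<phi> a)" if x: "x \<in> ?L" for x
  proof -
    obtain A0 r where r: "finite A0" "A0 \<subseteq> A" "x = (\<Sum>a\<in>A0. r a * \<phi> a)"
      using x by (rule ideal_gen_imageE)
    have "x = (\<Sum>a\<in>A. (if a \<in> A0 then r a else 0) * \<phi> a)"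
      unfolding r(3) using finA r(2) by (intro sum.mono_neutral_cong_left) auto
    then show ?thesis by (intro exI[of _ "\<lambda>a. if a \<in> A0 then r a else 0"])
  qed
  have lower: "card E \<le> card G"
    if G: "G \<subseteq> quot_carrier ?L N" "finite G" "quot_span N G = quot_carrier ?L N" for G
  proof (rule ccontr)
    assume "\<not> card E \<le> card G"
    then have lt: "card G < card E" by simp
    have "\<forall>B\<in>G. \<exists>\<rho>. B = (\<Sum>a\<in>A. \<rho> a * \<phi> a) +o N"
      using G(1) rep unfolding quot_carrier_def by blast
    then obtain \<rho> where \<rho>: "\<And>B. B \<in> G \<Longrightarrow> B = (\<Sum>a\<in>A. \<rho> B a * \<phi> a) +o N" by metis
    obtain \<kappa> where \<kappa>: "\<exists>e\<in>E. \<kappa> e \<noteq> 0" "\<forall>B\<in>G. (\<Sum>e\<in>E. \<kappa> e * ?c (\<rho> B e)) = 0"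
      using exists_nontrivial_solution[OF G(2) finE lt, of "\<lambda>B e. ?c (\<rho> B e)"] by blast
    \<comment> \<open>The kernel of the functional. A representation of \<open>x\<close> need not be
      unique, but by \<open>ind\<close> the constant terms of its coefficients are.\<close>
    let ?K = "{x. \<exists>\<rho>. x = (\<Sum>a\<in>A. \<rho> a * \<phi> a) \<and> (\<Sum>e\<in>E. \<kappa> e * ?c (\<rho> e)) = 0}"
    have K: "is_ideal ?K"
    proof (rule ring_ideal.subspaceI)
      show "0 \<in> ?K" by (intro CollectI exI[of _ "\<lambda>_. 0"]) simp
    next
      fix x y assume "x \<in> ?K" "y \<in> ?K"
      then obtain r s where "x = (\<Sum>a\<in>A. r a * \<phi> a)" "(\<Sum>e\<in>E. \<kappa> e * ?c (r e)) = 0"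
        "y = (\<Sum>a\<in>A. s a * \<phi> a)" "(\<Sum>e\<in>E. \<kappa> e * ?c (s e)) = 0" by blast
      then show "x + y \<in> ?K"
        by (intro CollectI exI[of _ "\<lambda>a. r a + s a"])
          (simp add: distrib_right distrib_left sum.distrib lookup_add)
    next
      fix q x assume "x \<in> ?K"
      then obtain r where "x = (\<Sum>a\<in>A. r a * \<phi> a)" "(\<Sum>e\<in>E. \<kappa> e * ?c (r e)) = 0" by blast
      then show "q * x \<in> ?K"
        by (intro CollectI exI[of _ "\<lambda>a. q * r a"])
          (simp add: sum_distrib_left mult.assoc lookup_mult_0 mult.left_commute[of _ "?c q"]
            flip: sum_distrib_left)
    qed
    have NK: "N \<subseteq> ?K"
    proof
      fix x assume "x \<in> N"
      then obtain r where "x = (\<Sum>a\<in>A. r a * \<phi> a)" "\<forall>a\<in>E. ?c (r a) = 0" using N_sub by blast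
      then show "x \<in> ?K" by (intro CollectI exI[of _ r]) simp
    qed
    have GK: "B \<subseteq> ?K" if "B \<in> G" for B
    proof
      fix x assume "x \<in> B"
      then obtain y where "y \<in> N" "x = (\<Sum>a\<in>A. \<rho> B a * \<phi> a) + y"
        using \<rho>[OF \<open>B \<in> G\<close>] by (auto simp: elt_set_plus_def)
      moreover have "(\<Sum>a\<in>A. \<rho> B a * \<phi> a) \<in> ?K" using \<kappa>(2) that by blast
      ultimately show "x \<in> ?K" using NK ring_ideal.subspace_add[OF K] by blast
    qed
    obtain e where e: "e \<in> E" "\<kappa> e \<noteq> 0" using \<kappa>(1) by blast
    have "\<phi> e +o N \<in> quot_span N G" unfolding G(3) quot_carrier_def
      using e E by (intro imageI ring_ideal.span_base) auto
    then have "\<phi> e +o N \<subseteq> ?K" by (rule quot_span_sub[OF K NK GK, rotated])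
    then have "\<phi> e \<in> ?K" using coset_self[OF N] by blast
    then obtain r where r: "\<phi> e = (\<Sum>a\<in>A. r a * \<phi> a)" "(\<Sum>e\<in>E. \<kappa> e * ?c (r e)) = 0" by blast
    have eA: "e \<in> A" using e E by blast
    \<comment> \<open>The difference of two representations of \<open>\<phi> e\<close>. It fixes the
      constant terms of \<open>r\<close>, so the functional has the value
      \<open>\<kappa> e \<noteq> 0\<close> at \<open>\<phi> e\<close>.\<close>
    let ?r = "\<lambda>a. r a - (if a = e then 1 else 0)"
    have "(\<Sum>a\<in>A. ?r a * \<phi> a) = (\<Sum>a\<in>A. r a * \<phi> a) - (\<Sum>a\<in>A. if a = e then \<phi> a else 0)"
      unfolding sum_subtractf[symmetric] by (intro sum.cong) (auto simp: left_diff_distrib)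
    also have "\<dots> = 0" using r(1) finA eA by simp
    finally have r0: "(\<Sum>a\<in>A. ?r a * \<phi> a) = 0" .
    have "?c (?r a) = 0" if "a \<in> A" for a by (rule ind[of ?r a, OF r0 that])
    then have "?c (r a) = (if a = e then 1 else 0)" if "a \<in> A" for a
      using that by (cases "a = e") (force simp: lookup_minus)+
    then have "(\<Sum>a\<in>E. \<kappa> a * ?c (r a)) = (\<Sum>a\<in>E. if a = e then \<kappa> a else 0)"
      using E by (intro sum.cong) auto
    then show False using r(2) finE e by simp
  qed
  define G where "G = (\<lambda>e. \<phi> e +o N) ` E"
  have finG: "finite G" unfolding G_def using finE by simp
  have GL: "G \<subseteq> quot_carrier ?L N"
    unfolding G_def quot_carrier_def using E by (auto intro!: imageI ring_ideal.span_base)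
  have "x +o N \<in> quot_span N G" if "x \<in> ?L" for x
    using that
  proof (induction rule: ring_ideal.span_induct_alt)
    case base
    then show ?case by (simp only: coset_zero quot_span.zero)
  next
    case (step q y z)
    then obtain a where a: "a \<in> A" "y = \<phi> a" by blast
    have "y +o N \<in> quot_span N G"
    proof (cases "a \<in> E")
      case True
      then show ?thesis using a by (intro quot_span.gen) (auto simp: G_def)
    next
      case False
      then have "y +o N = 0 +o N" using N_sup a by (intro coset_cong[OF N]) auto
      then show ?thesis by (simp only: coset_zero quot_span.zero)
    qed
    then have "coset_scale N q (y +o N) + (z +o N) \<in> quot_span N G"
      using step(2) by (intro quot_span.add quot_span.scale)
    then show ?case by (simp only: coset_scale_coset[OF N] coset_add[OF N])
  qed
  then have span: "quot_span N G = quot_carrier ?L N"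
    using quot_span_cosets[OF N _ GL] by (auto simp: quot_carrier_def)
  have "card G \<le> card E" unfolding G_def using finE by (rule card_image_le)
  then have "card G = card E" using lower[OF GL finG span] by simp
  then show ?thesis
    unfolding min_gens_quot_def using GL finG span lower by (intro Least_equality) blast+
qed

section \<open>Counting the minimal generators\<close>

text \<open>The exponents in \<open>min_exps F c M\<close> with support \<open>E\<close>, where \<open>p = card F - c\<close>.\<close>

definition supp_exps :: "nat \<Rightarrow> 'a set \<Rightarrow> nat \<Rightarrow> ('a \<Rightarrow> nat) set" where
  "supp_exps p E N = (if E = {} then (if N = 0 then {\<lambda>_. 0} else {}) else
    {e. (\<forall>j. j \<notin> E \<longrightarrow> e j = 0) \<and> (\<forall>j\<in>E. 0 < e j) \<and>
      (\<exists>t. (\<forall>j\<in>E. e j \<le> t) \<and> p < card {j\<in>E. e j = t} \<and> sum e E = N + p * t)})"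

lemma supp_expsE:
  assumes "e \<in> supp_exps p E N" "E \<noteq> {}"
  obtains t where "\<And>j. j \<notin> E \<Longrightarrow> e j = 0" "\<And>j. j \<in> E \<Longrightarrow> 0 < e j" "\<And>j. j \<in> E \<Longrightarrow> e j \<le> t"
    "p < card {j\<in>E. e j = t}" "sum e E = N + p * t"
  using assms by (auto simp: supp_exps_def)

lemma supp_expsI:
  assumes "E \<noteq> {}" "\<And>j. j \<notin> E \<Longrightarrow> e j = 0" "\<And>j. j \<in> E \<Longrightarrow> 0 < e j" "\<And>j. j \<in> E \<Longrightarrow> e j \<le> t"
    "p < card {j\<in>E. e j = t}" "sum e E = N + p * t"
  shows "e \<in> supp_exps p E N"
proof -
  have "\<exists>t. (\<forall>j\<in>E. e j \<le> t) \<and> p < card {j\<in>E. e j = t} \<and> sum e E = N + p * t"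
    using assms(4-6) by (intro exI[of _ t]) simp
  then show ?thesis using assms(1-3) by (simp add: supp_exps_def)
qed

lemma supp_exps_support:
  assumes "e \<in> supp_exps p E N"
  shows "{j. 0 < e j} = E"
  using assms by (auto simp: supp_exps_def split: if_splits)

lemma supp_exps_small:
  assumes "E \<noteq> {}" "finite E" "card E \<le> p"
  shows "supp_exps p E N = {}"
proof -
  have False if "e \<in> supp_exps p E N" for e
  proof -
    obtain t where "p < card {j\<in>E. e j = t}" by (rule supp_expsE[OF \<open>e \<in> _\<close> assms(1)]) blast
    moreover have "card {j\<in>E. e j = t} \<le> card E" using assms by (intro card_mono) auto
    ultimately show False using assms(3) by simp
  qed
  then show ?thesis by blast
qed

lemma sum_ge_top:
  fixes e :: "'a \<Rightarrow> nat"
  assumes "finite E" "p < card {j\<in>E. e j = t}"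
  shows "Suc p * t \<le> sum e E"
proof -
  have "Suc p * t \<le> card {j\<in>E. e j = t} * t" using assms(2) by (intro mult_right_mono) auto
  also have "\<dots> = sum e {j\<in>E. e j = t}" by simp
  also have "\<dots> \<le> sum e E" using assms(1) by (intro sum_mono2) auto
  finally show ?thesis .
qed

text \<open>Subtracting the least value \<open>x\<close> leaves an exponent with smaller support.\<close>

lemma supp_exps_rec:
  assumes E: "finite E" "card E = p + \<beta>" "0 < \<beta>"
  shows "supp_exps p E N = (\<Union>x\<in>{x\<in>{1..N}. x * \<beta> \<le> N}. \<Union>E'\<in>Pow E - {E}.
    (\<lambda>e j. e j + (if j \<in> E then x else 0)) ` supp_exps p E' (N - x * \<beta>))" (is "_ = ?R")
proof (intro equalityI subsetI)
  have ne: "E \<noteq> {}" using E by auto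
  fix e assume e: "e \<in> supp_exps p E N"
  obtain t where t: "\<And>j. j \<notin> E \<Longrightarrow> e j = 0" "\<And>j. j \<in> E \<Longrightarrow> 0 < e j" "\<And>j. j \<in> E \<Longrightarrow> e j \<le> t"
    "p < card {j\<in>E. e j = t}" "sum e E = N + p * t" by (rule supp_expsE[OF e ne]) blast
  define x where "x = Min (e ` E)"
  have xmin: "x \<le> e j" if "j \<in> E" for j unfolding x_def using that E by (intro Min_le) auto
  have "x \<in> e ` E" unfolding x_def using ne E by (intro Min_in) auto
  then obtain i where i: "i \<in> E" "e i = x" by auto
  have x0: "0 < x" using i t(2) by auto
  define e' where "e' j = e j - x" for j
  define E' where "E' = {j\<in>E. x < e j}"
  have E'E: "E' \<subseteq> E" "E' \<noteq> E" using i by (auto simp: E'_def)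
  have xt: "x \<le> t" using i t(3) by auto
  have "sum e' E = sum e E - sum (\<lambda>_. x) E"
    unfolding e'_def using xmin by (intro sum_subtractf_nat) auto
  moreover have "sum (\<lambda>_. x) E \<le> sum e E" using xmin by (intro sum_mono)
  \<comment> \<open>Each of the \<open>p + \<beta>\<close> entries on \<open>E\<close> loses
    \<open>x\<close>; lowering \<open>t\<close> by \<open>x\<close> accounts for \<open>p\<close> of
    them, and the other \<open>\<beta>\<close> are charged to \<open>N\<close>.\<close>
  ultimately have s: "sum e' E + x * \<beta> = N + p * (t - x)"
    using t(5) E(2) xt by (simp add: algebra_simps diff_mult_distrib2)
  have eq_t: "{j\<in>E. e' j = t - x} = {j\<in>E. e j = t}" using xmin xt by (force simp: e'_def)
  \<comment> \<open>More than \<open>p\<close> entries equal \<open>t - x\<close>, so the sum of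
    \<open>e'\<close> is at least \<open>p (t - x)\<close>, which rules out
    \<open>N < x * \<beta>\<close>.\<close>
  have ge: "Suc p * (t - x) \<le> sum e' E" by (rule sum_ge_top) (use E eq_t t in auto)
  have xN: "x * \<beta> \<le> N" using s ge by simp
  have "x \<le> x * \<beta>" using E(3) by simp
  then have "x \<le> N" using xN by (rule order_trans)
  then have xr: "x \<in> {x\<in>{1..N}. x * \<beta> \<le> N}" using xN x0 by simp
  have sE: "sum e' E' = sum e' E" unfolding E'_def using E by (intro sum.mono_neutral_left) (auto simp: e'_def)
  have s': "sum e' E' = (N - x * \<beta>) + p * (t - x)" using s xN sE by simp
  have e0: "e' j = 0" if "j \<notin> E'" for j using that t(1) by (auto simp: e'_def E'_def)
  have "e' \<in> supp_exps p E' (N - x * \<beta>)"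
  proof (cases "E' = {}")
    \<comment> \<open>Nothing remains if \<open>e\<close> is constant on \<open>E\<close>. This ends
      the recursion, and is why \<open>supp_exps\<close> treats the empty support separately: no
      level set there could have more than \<open>p\<close> elements.\<close>
    case True
    then have "t - x = 0" using s' ge sE by simp
    then have "N - x * \<beta> = 0" using s' True by simp
    moreover have "e' = (\<lambda>_. 0)" using e0 True by auto
    ultimately show ?thesis using True by (simp add: supp_exps_def)
  next
    case False
    have lt: "x < t"
    proof -
      obtain j where "j \<in> E'" using False by auto
      then show ?thesis using t(3)[of j] by (auto simp: E'_def)
    qed
    have "{j\<in>E'. e' j = t - x} = {j\<in>E. e' j = t - x}" using lt by (auto simp: E'_def e'_def)
    then have "p < card {j\<in>E'. e' j = t - x}" using eq_t t(4) by simp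
    then show ?thesis using False e0 s' t(3)
      by (intro supp_expsI[where t = "t - x"]) (auto simp: E'_def e'_def intro: diff_le_mono)
  qed
  moreover have "e = (\<lambda>j. e' j + (if j \<in> E then x else 0))"
    using xmin t(1) by (auto simp: e'_def fun_eq_iff)
  ultimately show "e \<in> ?R" using xr E'E by blast
next
  have ne: "E \<noteq> {}" using E by auto
  fix e assume "e \<in> ?R"
  then obtain x E' e' where x: "1 \<le> x" "x * \<beta> \<le> N" and E': "E' \<subseteq> E" "E' \<noteq> E"
    and e': "e' \<in> supp_exps p E' (N - x * \<beta>)" and e: "e = (\<lambda>j. e' j + (if j \<in> E then x else 0))" by auto
  have finE': "finite E'" using E E' finite_subset by auto
  have e'0: "e' j = 0" if "j \<notin> E'" for j using supp_exps_support[OF e'] that by auto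
  have "\<exists>t. (\<forall>j\<in>E. e' j \<le> t) \<and> p < card {j\<in>E. e' j = t} \<and> sum e' E = (N - x * \<beta>) + p * t"
  proof (cases "E' = {}")
    case True
    then have "e' = (\<lambda>_. 0)" "N - x * \<beta> = 0" using e' by (auto simp: supp_exps_def split: if_splits)
    then show ?thesis using E by (intro exI[of _ 0]) simp
  next
    case False
    obtain t where t: "\<And>j. j \<in> E' \<Longrightarrow> 0 < e' j" "\<And>j. j \<in> E' \<Longrightarrow> e' j \<le> t"
      "p < card {j\<in>E'. e' j = t}" "sum e' E' = (N - x * \<beta>) + p * t"
      by (rule supp_expsE[OF e' False]) blast
    have "e' j \<le> t" for j using t(2) e'0 by (cases "j \<in> E'") auto
    moreover have "card {j\<in>E'. e' j = t} \<le> card {j\<in>E. e' j = t}" using E E' by (intro card_mono) auto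
    moreover have "sum e' E = sum e' E'" using E E' e'0 by (intro sum.mono_neutral_right) auto
    ultimately show ?thesis using t by (intro exI[of _ t]) auto
  qed
  then obtain t where t: "\<And>j. j \<in> E \<Longrightarrow> e' j \<le> t" "p < card {j\<in>E. e' j = t}"
    "sum e' E = (N - x * \<beta>) + p * t" by blast
  have "sum e E = sum e' E + card E * x" unfolding e by (simp add: sum.distrib)
  also have "\<dots> = N + p * (t + x)" using t(3) x E by (simp add: algebra_simps)
  finally have "sum e E = N + p * (t + x)" .
  moreover have "{j\<in>E. e j = t + x} = {j\<in>E. e' j = t}" unfolding e by auto
  moreover have "e' j = 0" if "j \<notin> E" for j using that E' by (intro e'0) auto
  ultimately show "e \<in> supp_exps p E N"
    using ne t(1,2) x(1) by (intro supp_expsI[where t = "t + x"]) (simp_all add: e)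
qed

lemma finite_supp_exps:
  assumes "finite E"
  shows "finite (supp_exps p E N)"
  using assms
proof (induction "card E" arbitrary: E N rule: less_induct)
  case less
  show ?case
  proof (cases "E = {} \<or> card E \<le> p")
    case True
    have "finite (supp_exps p {} N)" by (simp add: supp_exps_def)
    then show ?thesis using True supp_exps_small[of E p N] less.prems by (cases "E = {}") auto
  next
    case False
    then have "card E = p + (card E - p)" "0 < card E - p" by auto
    from supp_exps_rec[OF less.prems this] show ?thesis
    proof (rule ssubst, intro finite_UN_I finite_imageI)
      fix x E' assume "E' \<in> Pow E - {E}"
      then show "finite (supp_exps p E' (N - x * (card E - p)))"
        using less.prems by (intro less.hyps psubset_card_mono) (auto intro: finite_subset)
    qed (use less.prems in auto)
  qed
qed

lemma card_supp_exps_rec: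
  assumes E: "finite E" "card E = p + \<beta>" "0 < \<beta>"
  shows "card (supp_exps p E N) =
    (\<Sum>x\<in>{x\<in>{1..N}. x * \<beta> \<le> N}. \<Sum>E'\<in>Pow E - {E}. card (supp_exps p E' (N - x * \<beta>)))"
proof -
  let ?X = "{x\<in>{1..N}. x * \<beta> \<le> N}" and ?f = "\<lambda>x e j. e j + (if j \<in> E then x else (0::nat))"
  let ?S = "\<lambda>x E'. ?f x ` supp_exps p E' (N - x * \<beta>)"
  have inj: "inj (?f x)" for x by (rule injI) (auto simp: fun_eq_iff)
  have fin: "finite E'" if "E' \<in> Pow E - {E}" for E' using that E finite_subset by auto
  \<comment> \<open>The parameters are recovered from \<open>e\<close>: \<open>x\<close> is its least value on \<open>E\<close>, and \<open>E'\<close> is where it is larger.\<close>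
  have x_eq: "x = x'" if "e \<in> ?S x E'" "e \<in> ?S x' E''" "E' \<in> Pow E - {E}" "E'' \<in> Pow E - {E}"
    for x x' E' E'' e
  proof -
    have *: "x \<le> x'" if S: "e \<in> ?S x E'" "e \<in> ?S x' E''" "E'' \<in> Pow E - {E}" for x x' E' E''
    proof -
      obtain i where "i \<in> E" "i \<notin> E''" using S(3) by auto
      from S(1,2) obtain g h where gh: "e = ?f x g" "e = ?f x' h" "h \<in> supp_exps p E'' (N - x' * \<beta>)" by blast
      have "h i = 0" using supp_exps_support[OF gh(3)] \<open>i \<notin> E''\<close> by auto
      then show ?thesis using fun_cong[OF gh(1), of i] fun_cong[OF gh(2), of i] \<open>i \<in> E\<close> by simp
    qed
    show ?thesis using *[OF that(1,2,4)] *[OF that(2,1,3)] by simp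
  qed
  have E_eq: "E' = E''" if "e \<in> ?S x E'" "e \<in> ?S x E''" for x E' E'' e
  proof -
    obtain g h where gh: "g \<in> supp_exps p E' (N - x * \<beta>)" "h \<in> supp_exps p E'' (N - x * \<beta>)"
      "?f x g = ?f x h" using \<open>e \<in> ?S x E'\<close> \<open>e \<in> ?S x E''\<close> by blast
    then have "g = h" by (auto simp: fun_eq_iff)
    then show ?thesis using supp_exps_support[OF gh(1)] supp_exps_support[OF gh(2)] by simp
  qed
  have "card (supp_exps p E N) = card (\<Union>x\<in>?X. \<Union>E'\<in>Pow E - {E}. ?S x E')"
    by (simp only: supp_exps_rec[OF E])
  also have "\<dots> = (\<Sum>x\<in>?X. card (\<Union>E'\<in>Pow E - {E}. ?S x E'))"
  proof (rule card_UN_disjoint)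
    show "\<forall>x\<in>?X. finite (\<Union>E'\<in>Pow E - {E}. ?S x E')"
      using E fin by (intro ballI finite_UN_I finite_imageI finite_supp_exps) auto
    show "\<forall>x\<in>?X. \<forall>x'\<in>?X. x \<noteq> x' \<longrightarrow>
        (\<Union>E'\<in>Pow E - {E}. ?S x E') \<inter> (\<Union>E'\<in>Pow E - {E}. ?S x' E') = {}"
    proof (intro ballI impI equals0I)
      fix x x' e assume "x \<noteq> x'" "e \<in> (\<Union>E'\<in>Pow E - {E}. ?S x E') \<inter> (\<Union>E'\<in>Pow E - {E}. ?S x' E')"
      then obtain E' E'' where "E' \<in> Pow E - {E}" "E'' \<in> Pow E - {E}" "e \<in> ?S x E'" "e \<in> ?S x' E''" by blast
      then show False using x_eq \<open>x \<noteq> x'\<close> by blast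
    qed
  qed auto
  also have "\<dots> = (\<Sum>x\<in>?X. \<Sum>E'\<in>Pow E - {E}. card (?S x E'))"
  proof (intro sum.cong refl card_UN_disjoint)
    fix x
    show "finite (Pow E - {E})" using E by simp
    show "\<forall>E'\<in>Pow E - {E}. finite (?S x E')"
      using fin by (intro ballI finite_imageI finite_supp_exps)
    show "\<forall>E'\<in>Pow E - {E}. \<forall>E''\<in>Pow E - {E}. E' \<noteq> E'' \<longrightarrow> ?S x E' \<inter> ?S x E'' = {}"
      using E_eq by blast
  qed
  also have "\<dots> = (\<Sum>x\<in>?X. \<Sum>E'\<in>Pow E - {E}. card (supp_exps p E' (N - x * \<beta>)))"
    by (intro sum.cong refl card_image inj_on_subset[OF inj]) auto
  finally show ?thesis .
qed

section \<open>Solutions of the Diophantine equation and chains of level sets\<close>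

lemma sum_group_max:
  fixes g :: "nat set \<Rightarrow> nat"
  shows "(\<Sum>B\<in>Pow {1..n} - {{}}. g B) = (\<Sum>\<beta>=1..n. \<Sum>B\<in>Pow {1..\<beta> - 1}. g (insert \<beta> B))"
proof (induction n)
  case (Suc n)
  have "Pow {1..Suc n} - {{}} = (Pow {1..n} - {{}}) \<union> insert (Suc n) ` Pow {1..n}"
    by (simp add: atLeastAtMostSuc_conv Pow_insert) blast
  moreover have "sum g ((Pow {1..n} - {{}}) \<union> insert (Suc n) ` Pow {1..n}) =
      sum g (Pow {1..n} - {{}}) + sum g (insert (Suc n) ` Pow {1..n})"
    by (intro sum.union_disjoint) auto
  moreover have "sum g (insert (Suc n) ` Pow {1..n}) = (\<Sum>B\<in>Pow {1..n}. g (insert (Suc n) B))"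
  proof (rule sum.reindex_cong)
    show "inj_on (insert (Suc n)) (Pow {1..n})"
    proof (rule inj_onI)
      fix A B assume "A \<in> Pow {1..n}" "B \<in> Pow {1..n}" "insert (Suc n) A = insert (Suc n) B"
      moreover from this have "Suc n \<notin> A" "Suc n \<notin> B" by auto
      ultimately show "A = B" by (simp add: insert_ident)
    qed
  qed auto
  ultimately show ?case using Suc.IH by simp
qed simp

lemma sorted_list_of_set_insert_max:
  assumes "finite B" "\<forall>b\<in>B. b < (\<beta>::nat)"
  shows "sorted_list_of_set (insert \<beta> B) = sorted_list_of_set B @ [\<beta>]"
proof (rule sorted_distinct_set_unique)
  show "sorted (sorted_list_of_set B @ [\<beta>])"
    using assms by (auto simp: sorted_append less_imp_le)
qed (use assms in \<open>auto simp del: sorted_list_of_set_insert_remove\<close>)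

lemma dioph_sum_append:
  fixes bs ys :: "nat list"
  assumes "length ys = length bs"
  shows "(\<Sum>i<length (bs @ [\<beta>]). (bs @ [\<beta>]) ! i * (ys @ [x]) ! i) = (\<Sum>i<length bs. bs ! i * ys ! i) + \<beta> * x"
  using assms by (simp add: nth_append)

lemma dioph_solutions_insert_max:
  assumes "finite B" "\<forall>b\<in>B. b < \<beta>" "0 < \<beta>"
  shows "dioph_solutions (insert \<beta> B) N =
    (\<Union>x\<in>{x\<in>{1..N}. x * \<beta> \<le> N}. (\<lambda>ys. ys @ [x]) ` dioph_solutions B (N - x * \<beta>))" (is "_ = ?R")
proof (intro equalityI subsetI)
  let ?bs = "sorted_list_of_set B"
  fix xs assume "xs \<in> dioph_solutions (insert \<beta> B) N"
  then have xs: "length xs = Suc (length ?bs)" "\<forall>x\<in>set xs. 0 < x"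
    "(\<Sum>i<length (?bs @ [\<beta>]). (?bs @ [\<beta>]) ! i * xs ! i) = N"
    using sorted_list_of_set_insert_max[OF assms(1,2)]
    by (simp_all add: dioph_solutions_def Let_def del: sorted_list_of_set_insert_remove length_sorted_list_of_set)
  obtain ys x where ys: "xs = ys @ [x]" using xs(1) by (cases xs rule: rev_cases) auto
  have l: "length ys = length ?bs" using xs(1) ys by simp
  have s: "(\<Sum>i<length ?bs. ?bs ! i * ys ! i) + \<beta> * x = N"
    using xs(3) dioph_sum_append[OF l, of \<beta> x] by (simp only: ys)
  have "0 < x" using xs(2) ys by simp
  moreover have le: "x * \<beta> \<le> N" unfolding s[symmetric] by simp
  moreover have "x \<le> N" using assms(3) le by (intro order_trans[OF _ le]) simp
  ultimately have "x \<in> {x\<in>{1..N}. x * \<beta> \<le> N}" by simp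
  moreover have "ys \<in> dioph_solutions B (N - x * \<beta>)"
    using l xs(2) ys s by (auto simp: dioph_solutions_def Let_def mult.commute)
  ultimately show "xs \<in> ?R" using ys by blast
next
  let ?bs = "sorted_list_of_set B"
  fix xs assume "xs \<in> ?R"
  then obtain x ys where x: "1 \<le> x" "x * \<beta> \<le> N" and ys: "ys \<in> dioph_solutions B (N - x * \<beta>)"
    and xs: "xs = ys @ [x]" by auto
  have l: "length ys = length ?bs" and p: "\<forall>y\<in>set ys. 0 < y"
    and s: "(\<Sum>i<length ?bs. ?bs ! i * ys ! i) = N - x * \<beta>"
    using ys by (auto simp: dioph_solutions_def Let_def)
  have "(\<Sum>i<length (?bs @ [\<beta>]). (?bs @ [\<beta>]) ! i * xs ! i) = N"
    unfolding xs dioph_sum_append[OF l] s using x(2) by (simp add: mult.commute)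
  then show "xs \<in> dioph_solutions (insert \<beta> B) N"
    unfolding dioph_solutions_def Let_def sorted_list_of_set_insert_max[OF assms(1,2)]
    using l p x xs by simp
qed

lemma finite_dioph_solutions:
  assumes "finite B" "0 \<notin> B"
  shows "finite (dioph_solutions B N)"
proof (rule finite_subset)
  let ?bs = "sorted_list_of_set B"
  show "dioph_solutions B N \<subseteq> {xs. set xs \<subseteq> {..N} \<and> length xs = length ?bs}"
  proof
    fix xs assume "xs \<in> dioph_solutions B N"
    then have xs: "length xs = length ?bs" "(\<Sum>i<length ?bs. ?bs ! i * xs ! i) = N"
      by (auto simp: dioph_solutions_def Let_def)
    have "xs ! i \<le> N" if i: "i < length xs" for i
    proof -
      have "?bs ! i \<in> B" using i xs(1) assms(1) by (metis nth_mem set_sorted_list_of_set)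
      then have "0 < ?bs ! i" using assms(2) by (cases "?bs ! i") auto
      then have "xs ! i \<le> ?bs ! i * xs ! i" by simp
      also have "\<dots> \<le> N" unfolding xs(2)[symmetric] using i xs(1) by (intro member_le_sum) auto
      finally show ?thesis .
    qed
    then show "xs \<in> {xs. set xs \<subseteq> {..N} \<and> length xs = length ?bs}"
      using xs(1) by (auto simp: in_set_conv_nth)
  qed
qed (rule finite_lists_length_eq, simp)

lemma card_dioph_solutions_insert_max:
  assumes "finite B" "\<forall>b\<in>B. b < \<beta>" "0 < \<beta>" "0 \<notin> B"
  shows "card (dioph_solutions (insert \<beta> B) N) =
    (\<Sum>x\<in>{x\<in>{1..N}. x * \<beta> \<le> N}. card (dioph_solutions B (N - x * \<beta>)))"
proof -
  have inj: "inj_on (\<lambda>ys. ys @ [x]) S" for x :: nat and S by (auto intro: inj_onI)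
  have "card (dioph_solutions (insert \<beta> B) N) =
      (\<Sum>x\<in>{x\<in>{1..N}. x * \<beta> \<le> N}. card ((\<lambda>ys. ys @ [x]) ` dioph_solutions B (N - x * \<beta>)))"
    unfolding dioph_solutions_insert_max[OF assms(1-3)]
    by (rule card_UN_disjoint) (auto intro: finite_dioph_solutions[OF assms(1,4)])
  then show ?thesis by (simp only: card_image[OF inj])
qed

lemma dioph_solutions_empty: "dioph_solutions {} N = (if N = 0 then {[]} else {})"
  by (auto simp: dioph_solutions_def)

text \<open>The number of chains of sets of sizes \<open>p + b_1 < ... < p + b_h\<close> whose
  largest set is fixed: each set arises from the next larger one by removing
  \<open>b_i - b_(i-1)\<close> elements.\<close>

definition chain_binoms :: "nat \<Rightarrow> nat set \<Rightarrow> nat" where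
  "chain_binoms p B = (let bs = sorted_list_of_set B in
     (\<Prod>i = 1..<length bs. (p + bs ! i) choose (bs ! i - bs ! (i - 1))))"

lemma binom_product_eq:
  "binom_product s c B = (s choose (c - last (sorted_list_of_set B))) * chain_binoms (s - c) B"
  by (simp add: binom_product_def chain_binoms_def Let_def)

lemma chain_binoms_insert_max:
  assumes "finite B" "\<forall>b\<in>B. b < \<beta>" "B \<noteq> {}"
  shows "chain_binoms p (insert \<beta> B) =
    ((p + \<beta>) choose (\<beta> - last (sorted_list_of_set B))) * chain_binoms p B"
proof -
  let ?bs = "sorted_list_of_set B"
  have ne: "?bs \<noteq> []" using assms by simp
  have "(\<Prod>i = 1..<length (?bs @ [\<beta>]). (p + (?bs @ [\<beta>]) ! i) choose ((?bs @ [\<beta>]) ! i - (?bs @ [\<beta>]) ! (i - 1))) =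
    (\<Prod>i = 1..<length ?bs. (p + (?bs @ [\<beta>]) ! i) choose ((?bs @ [\<beta>]) ! i - (?bs @ [\<beta>]) ! (i - 1))) *
    ((p + \<beta>) choose (\<beta> - (?bs @ [\<beta>]) ! (length ?bs - 1)))"
    using ne by (simp add: prod.atLeastLessThan_Suc Suc_le_eq del: length_sorted_list_of_set)
  also have "(?bs @ [\<beta>]) ! (length ?bs - 1) = last ?bs"
    using ne by (simp add: nth_append last_conv_nth del: length_sorted_list_of_set)
  also have "(\<Prod>i = 1..<length ?bs. (p + (?bs @ [\<beta>]) ! i) choose ((?bs @ [\<beta>]) ! i - (?bs @ [\<beta>]) ! (i - 1))) =
      (\<Prod>i = 1..<length ?bs. (p + ?bs ! i) choose (?bs ! i - ?bs ! (i - 1)))"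
    by (intro prod.cong refl) (auto simp: nth_append)
  finally show ?thesis
    unfolding chain_binoms_def Let_def sorted_list_of_set_insert_max[OF assms(1,2)] by (simp add: mult.commute)
qed

lemma last_sorted_insert_max:
  assumes "finite B" "\<forall>b\<in>B. b < \<beta>"
  shows "last (sorted_list_of_set (insert \<beta> B)) = (\<beta> :: nat)"
  by (simp add: sorted_list_of_set_insert_max[OF assms] del: sorted_list_of_set_insert_remove)

text \<open>An exponent is a sum of indicator functions of nested sets of sizes
  \<open>p + b_i\<close> with coefficients \<open>x_i > 0\<close>. Its maximum \<open>t\<close> is
  the sum of the \<open>x_i\<close> and its total is the sum of the \<open>(p + b_i) x_i\<close>, so
  a total of \<open>N + p t\<close> means exactly the Diophantine equation. Here the support, of
  size \<open>p + \<beta>\<close>, is fixed.\<close>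

definition chain_count :: "nat \<Rightarrow> nat \<Rightarrow> nat \<Rightarrow> nat" where
  "chain_count p \<beta> N = (\<Sum>B\<in>Pow {1..\<beta> - 1}. card (dioph_solutions (insert \<beta> B) N) * chain_binoms p (insert \<beta> B))"

text \<open>In the summand for \<open>x\<close>, the largest element \<open>\<beta>\<close> has
  coefficient \<open>x\<close>. The 1 stands for \<open>\<beta>\<close> alone, and
  \<open>\<beta>'\<close> is the next largest element otherwise.\<close>

lemma chain_count_rec:
  assumes "0 < \<beta>"
  shows "chain_count p \<beta> N = (\<Sum>x\<in>{x\<in>{1..N}. x * \<beta> \<le> N}.
    (if N - x * \<beta> = 0 then 1 else 0) +
    (\<Sum>\<beta>'=1..\<beta> - 1. ((p + \<beta>) choose (\<beta> - \<beta>')) * chain_count p \<beta>' (N - x * \<beta>)))"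
proof -
  let ?X = "{x\<in>{1..N}. x * \<beta> \<le> N}"
  have fin: "finite B" "\<forall>b\<in>B. b < \<beta>" "0 \<notin> B" if "B \<in> Pow {1..\<beta> - 1}" for B
    using that assms finite_subset by fastforce+
  have "chain_count p \<beta> N = (\<Sum>B\<in>Pow {1..\<beta> - 1}. \<Sum>x\<in>?X.
      card (dioph_solutions B (N - x * \<beta>)) * chain_binoms p (insert \<beta> B))"
    unfolding chain_count_def
    by (intro sum.cong refl)
      (simp only: card_dioph_solutions_insert_max[OF fin(1,2) assms fin(3)] sum_distrib_right)
  also have "\<dots> = (\<Sum>x\<in>?X. \<Sum>B\<in>Pow {1..\<beta> - 1}.
      card (dioph_solutions B (N - x * \<beta>)) * chain_binoms p (insert \<beta> B))"
    by (rule sum.swap)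
  also have "\<dots> = (\<Sum>x\<in>?X. (if N - x * \<beta> = 0 then 1 else 0) +
    (\<Sum>\<beta>'=1..\<beta> - 1. ((p + \<beta>) choose (\<beta> - \<beta>')) * chain_count p \<beta>' (N - x * \<beta>)))"
  proof (intro sum.cong refl)
    fix x
    let ?K = "N - x * \<beta>"
    let ?g = "\<lambda>B. card (dioph_solutions B ?K) * chain_binoms p (insert \<beta> B)"
    have "sum ?g (Pow {1..\<beta> - 1}) = ?g {} + sum ?g (Pow {1..\<beta> - 1} - {{}})"
      by (intro sum.remove) auto
    also have "?g {} = (if ?K = 0 then 1 else 0)"
      by (simp add: dioph_solutions_empty chain_binoms_def)
    also have "sum ?g (Pow {1..\<beta> - 1} - {{}}) = (\<Sum>\<beta>'=1..\<beta> - 1. \<Sum>B\<in>Pow {1..\<beta>' - 1}. ?g (insert \<beta>' B))"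
      by (rule sum_group_max)
    also have "\<dots> = (\<Sum>\<beta>'=1..\<beta> - 1. ((p + \<beta>) choose (\<beta> - \<beta>')) * chain_count p \<beta>' ?K)"
    proof (intro sum.cong refl)
      fix \<beta>' assume \<beta>': "\<beta>' \<in> {1..\<beta> - 1}"
      have "?g (insert \<beta>' B) = ((p + \<beta>) choose (\<beta> - \<beta>')) *
          (card (dioph_solutions (insert \<beta>' B) ?K) * chain_binoms p (insert \<beta>' B))"
        if B: "B \<in> Pow {1..\<beta>' - 1}" for B
      proof -
        have B': "finite B" "\<forall>b\<in>B. b < \<beta>'" using B \<beta>' finite_subset by fastforce+
        have "chain_binoms p (insert \<beta> (insert \<beta>' B)) =
            ((p + \<beta>) choose (\<beta> - last (sorted_list_of_set (insert \<beta>' B)))) * chain_binoms p (insert \<beta>' B)"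
          using B' \<beta>' by (intro chain_binoms_insert_max) fastforce+
        then show ?thesis by (simp only: last_sorted_insert_max[OF B'] mult.left_commute)
      qed
      then show "(\<Sum>B\<in>Pow {1..\<beta>' - 1}. ?g (insert \<beta>' B)) =
          ((p + \<beta>) choose (\<beta> - \<beta>')) * chain_count p \<beta>' ?K"
        unfolding chain_count_def sum_distrib_left by (intro sum.cong refl)
    qed
    finally show "sum ?g (Pow {1..\<beta> - 1}) = (if ?K = 0 then 1 else 0) +
      (\<Sum>\<beta>'=1..\<beta> - 1. ((p + \<beta>) choose (\<beta> - \<beta>')) * chain_count p \<beta>' ?K)" .
  qed
  finally show ?thesis .
qed

text \<open>\<open>S\<close> is left open because two families are summed: the proper nonempty
  subsets of a support, and all nonempty subsets of \<open>F\<close>.\<close>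

lemma sum_subsets_by_card:
  fixes g :: "'a set \<Rightarrow> nat"
  assumes E: "finite E" and small: "\<And>E'. E' \<subseteq> E \<Longrightarrow> E' \<noteq> {} \<Longrightarrow> card E' \<le> p \<Longrightarrow> g E' = 0"
    and big: "\<And>E'. E' \<subseteq> E \<Longrightarrow> E' \<noteq> {} \<Longrightarrow> card E' > p + b \<Longrightarrow> E' \<notin> S"
    and eq: "\<And>E' \<beta>. E' \<in> S \<Longrightarrow> \<beta> \<in> {1..b} \<Longrightarrow> card E' = p + \<beta> \<Longrightarrow> g E' = h \<beta>"
    and S: "S \<subseteq> Pow E - {{}}" "\<And>E'. E' \<subseteq> E \<Longrightarrow> card E' \<in> {p + 1..p + b} \<Longrightarrow> E' \<in> S"
  shows "sum g S = (\<Sum>\<beta>=1..b. (card E choose (p + \<beta>)) * h \<beta>)"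
proof -
  let ?T = "\<lambda>\<beta>. {E'. E' \<subseteq> E \<and> card E' = p + \<beta>}"
  have "sum g S = sum g (\<Union>\<beta>\<in>{1..b}. ?T \<beta>)"
  proof (rule sum.mono_neutral_right)
    show "finite S" using E S(1) by (meson finite_Diff finite_Pow_iff finite_subset)
    show "(\<Union>\<beta>\<in>{1..b}. ?T \<beta>) \<subseteq> S" using S(2) by auto
    show "\<forall>E'\<in>S - (\<Union>\<beta>\<in>{1..b}. ?T \<beta>). g E' = 0"
    proof
      fix E' assume E': "E' \<in> S - (\<Union>\<beta>\<in>{1..b}. ?T \<beta>)"
      then have sub: "E' \<subseteq> E" "E' \<noteq> {}" using S(1) by auto
      show "g E' = 0"
      proof (cases "card E' \<le> p")
        case False
        then have "card E' = p + (card E' - p)" "1 \<le> card E' - p" by auto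
        moreover have "card E' \<le> p + b" using big[OF sub] E' by (meson DiffD1 not_le)
        ultimately have "E' \<in> (\<Union>\<beta>\<in>{1..b}. ?T \<beta>)" using sub(1) by (intro UN_I[of "card E' - p"]) auto
        then show ?thesis using E' by blast
      qed (use small sub in auto)
    qed
  qed
  also have "\<dots> = (\<Sum>\<beta>=1..b. sum g (?T \<beta>))"
    using E by (intro sum.UNION_disjoint) auto
  also have "\<dots> = (\<Sum>\<beta>=1..b. (card E choose (p + \<beta>)) * h \<beta>)"
  proof (intro sum.cong refl)
    fix \<beta> assume \<beta>: "\<beta> \<in> {1..b}"
    have "sum g (?T \<beta>) = (\<Sum>E'\<in>?T \<beta>. h \<beta>)"
    proof (intro sum.cong refl)
      fix E' assume E': "E' \<in> ?T \<beta>"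
      then have "E' \<in> S" using \<beta> by (intro S(2)) auto
      then show "g E' = h \<beta>" using E' \<beta> by (intro eq) auto
    qed
    then show "sum g (?T \<beta>) = (card E choose (p + \<beta>)) * h \<beta>"
      using n_subsets[OF E, of "p + \<beta>"] by simp
  qed
  finally show ?thesis .
qed

text \<open>Both sides satisfy the same recursion: choosing a smaller support of size
  \<open>p + \<beta>'\<close> amounts to choosing the \<open>\<beta> - \<beta>'\<close> removed
  elements.\<close>

lemma card_supp_exps:
  fixes E :: "'a set"
  assumes "finite E" "card E = p + \<beta>" "0 < \<beta>"
  shows "card (supp_exps p E N) = chain_count p \<beta> N"
  using assms
proof (induction \<beta> arbitrary: E N rule: less_induct)
  case (less \<beta>)
  note E = less.prems
  have ne: "E \<noteq> {}" using E by auto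
  have "(\<Sum>E'\<in>Pow E - {E}. card (supp_exps p E' K)) =
    (if K = 0 then 1 else 0) + (\<Sum>\<beta>'=1..\<beta> - 1. ((p + \<beta>) choose (\<beta> - \<beta>')) * chain_count p \<beta>' K)" for K
  proof -
    let ?g = "\<lambda>E' :: 'a set. card (supp_exps p E' K)"
    have "sum ?g (Pow E - {E}) = ?g {} + sum ?g (Pow E - {E} - {{}})"
      using E(1) ne by (intro sum.remove[of "Pow E - {E}" "{}" ?g]) auto
    moreover have "?g {} = (if K = 0 then 1 else 0)" by (simp add: supp_exps_def)
    moreover have "sum ?g (Pow E - {E} - {{}}) =
        (\<Sum>\<beta>'=1..\<beta> - 1. (card E choose (p + \<beta>')) * chain_count p \<beta>' K)"
    proof (rule sum_subsets_by_card[OF E(1)])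
      fix E' assume E': "E' \<subseteq> E" "E' \<noteq> {}"
      show "?g E' = 0" if "card E' \<le> p"
        using supp_exps_small[OF E'(2) finite_subset[OF E'(1) E(1)] that] by simp
      show "E' \<notin> Pow E - {E} - {{}}" if "card E' > p + (\<beta> - 1)"
      proof -
        have "card E \<le> card E'" using that E by simp
        then have "E' = E" using E' E(1) by (metis card_seteq)
        then show ?thesis by simp
      qed
    next
      fix E' \<beta>' assume "E' \<in> Pow E - {E} - {{}}" "\<beta>' \<in> {1..\<beta> - 1}" "card E' = p + \<beta>'"
      then show "?g E' = chain_count p \<beta>' K"
        using E(1) by (intro less.IH) (auto intro: finite_subset)
    next
      fix E' assume "E' \<subseteq> E" "card E' \<in> {p + 1..p + (\<beta> - 1)}"
      then show "E' \<in> Pow E - {E} - {{}}" using E by auto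
    qed auto
    moreover have "(card E choose (p + \<beta>')) = ((p + \<beta>) choose (\<beta> - \<beta>'))" if "\<beta>' \<in> {1..\<beta> - 1}" for \<beta>'
    proof -
      have "\<beta>' \<le> \<beta>" using that by auto
      then show ?thesis using E(2) binomial_symmetric[of "p + \<beta>'" "p + \<beta>"] by simp
    qed
    ultimately show ?thesis by simp
  qed
  then show ?case unfolding card_supp_exps_rec[OF E] chain_count_rec[OF E(3)] by (simp only:)
qed

text \<open>The exponents are sorted by support. The first factor of \<open>binom_product\<close>
  counts the supports through their complements, of size \<open>c - b_h\<close>.\<close>

lemma card_min_exps:
  assumes F: "finite F" "c \<le> card F" and M: "0 < M"
  shows "card (min_exps F c M) =
    (\<Sum>B\<in>Pow {1..c} - {{}}. card (dioph_solutions B M) * binom_product (card F) c B)"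
proof -
  define p where "p = card F - c"
  have cardF: "card F = p + c" using F by (simp add: p_def)
  have "min_exps F c M = (\<Union>E\<in>Pow F - {{}}. supp_exps p E M)"
  proof (intro equalityI subsetI)
    fix e assume "e \<in> min_exps F c M"
    then obtain t where t: "\<And>j. j \<notin> F \<Longrightarrow> e j = 0" "\<And>j. j \<in> F \<Longrightarrow> e j \<le> t"
      "p < card {j\<in>F. e j = t}" "sum e F = M + p * t" by (auto simp: min_exps_def p_def)
    let ?E = "{j\<in>F. 0 < e j}"
    \<comment> \<open>Only for positive \<open>t\<close> do the entries equal to \<open>t\<close>
      lie in the support.\<close>
    have "t \<noteq> 0"
    proof
      assume "t = 0"
      then have "sum e F = 0" using t(2) by (intro sum.neutral) auto
      then show False using t(4) M by simp
    qed
    then have eq: "{j\<in>?E. e j = t} = {j\<in>F. e j = t}" by auto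
    have "?E \<noteq> {}" using t(3) eq by (metis (no_types, lifting) Collect_empty_eq card.empty empty_iff not_less_zero)
    moreover have "sum e ?E = sum e F" using F by (intro sum.mono_neutral_left) auto
    ultimately have "e \<in> supp_exps p ?E M"
      using t eq by (intro supp_expsI[where t = t]) auto
    then show "e \<in> (\<Union>E\<in>Pow F - {{}}. supp_exps p E M)"
      using \<open>?E \<noteq> {}\<close> by (intro UN_I[of ?E]) auto
  next
    fix e assume "e \<in> (\<Union>E\<in>Pow F - {{}}. supp_exps p E M)"
    then obtain E where E: "E \<subseteq> F" "E \<noteq> {}" "e \<in> supp_exps p E M" by blast
    obtain t where t: "\<And>j. j \<notin> E \<Longrightarrow> e j = 0" "\<And>j. j \<in> E \<Longrightarrow> e j \<le> t"
      "p < card {j\<in>E. e j = t}" "sum e E = M + p * t" by (rule supp_expsE[OF E(3,2)]) blast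
    have "e j \<le> t" for j using t(1,2)[of j] by (cases "j \<in> E") auto
    moreover have "card {j\<in>E. e j = t} \<le> card {j\<in>F. e j = t}" using E F by (intro card_mono) auto
    moreover have "sum e F = sum e E" using E F t(1) by (intro sum.mono_neutral_right) auto
    ultimately show "e \<in> min_exps F c M"
      using t E unfolding min_exps_def p_def[symmetric] by (auto intro!: exI[of _ t])
  qed
  moreover have "card (\<Union>E\<in>Pow F - {{}}. supp_exps p E M) = (\<Sum>E\<in>Pow F - {{}}. card (supp_exps p E M))"
  proof (rule card_UN_disjoint)
    show "finite (Pow F - {{}})" using F by simp
    show "\<forall>E\<in>Pow F - {{}}. finite (supp_exps p E M)"
      using F by (auto intro: finite_supp_exps finite_subset)
    show "\<forall>E\<in>Pow F - {{}}. \<forall>E'\<in>Pow F - {{}}. E \<noteq> E' \<longrightarrow> supp_exps p E M \<inter> supp_exps p E' M = {}"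
      using supp_exps_support by blast
  qed
  moreover have "(\<Sum>E\<in>Pow F - {{}}. card (supp_exps p E M)) =
      (\<Sum>\<beta>=1..c. (card F choose (p + \<beta>)) * chain_count p \<beta> M)"
  proof (rule sum_subsets_by_card[OF F(1)])
    show "card (supp_exps p E M) = 0" if "E \<subseteq> F" "E \<noteq> {}" "card E \<le> p" for E
      using supp_exps_small[OF that(2) finite_subset[OF that(1) F(1)] that(3)] by simp
    show "E \<notin> Pow F - {{}}" if "E \<subseteq> F" "E \<noteq> {}" "card E > p + c" for E
      using that card_mono[OF F(1), of E] cardF by simp
    show "card (supp_exps p E M) = chain_count p \<beta> M"
      if "E \<in> Pow F - {{}}" "\<beta> \<in> {1..c}" "card E = p + \<beta>" for E \<beta>
      using that F by (intro card_supp_exps) (auto intro: finite_subset)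
  qed auto
  moreover have "(\<Sum>B\<in>Pow {1..c} - {{}}. card (dioph_solutions B M) * binom_product (card F) c B) =
      (\<Sum>\<beta>=1..c. (card F choose (p + \<beta>)) * chain_count p \<beta> M)"
    unfolding sum_group_max
  proof (intro sum.cong refl)
    fix \<beta> assume \<beta>: "\<beta> \<in> {1..c}"
    have "(card F choose (c - \<beta>)) = (card F choose (p + \<beta>))"
      using \<beta> cardF binomial_symmetric[of "p + \<beta>" "card F"] by simp
    moreover have "binom_product (card F) c (insert \<beta> B) = (card F choose (c - \<beta>)) * chain_binoms p (insert \<beta> B)"
      if "B \<in> Pow {1..\<beta> - 1}" for B
    proof -
      have B': "finite B" "\<forall>b\<in>B. b < \<beta>" using that \<beta> finite_subset by fastforce+
      show ?thesis by (simp only: binom_product_eq last_sorted_insert_max[OF B'] p_def)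
    qed
    ultimately show "(\<Sum>B\<in>Pow {1..\<beta> - 1}. card (dioph_solutions (insert \<beta> B) M) * binom_product (card F) c (insert \<beta> B)) =
        (card F choose (p + \<beta>)) * chain_count p \<beta> M"
      unfolding chain_count_def sum_distrib_left by (intro sum.cong refl) (simp add: mult.left_commute)
  qed
  ultimately show ?thesis by simp
qed

section \<open>The symbolic defect\<close>

lemma nfold_sum:
  assumes "\<And>e. e \<in> X \<Longrightarrow> sum e F = a" "y \<in> nfold X m"
  shows "sum y F = m * a"
  using assms(2)
proof (induction m arbitrary: y)
  case (Suc m)
  then obtain g h where "y = (\<lambda>j. g j + h j)" "g \<in> X" "h \<in> nfold X m" by auto
  then show ?case using assms(1)[of g] Suc.IH[of h] by (simp add: sum.distrib)
qed simp

lemma nfold_SucI: "x \<in> X \<Longrightarrow> y \<in> nfold X m \<Longrightarrow> (\<lambda>j. x j + y j) \<in> nfold X (Suc m)"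
  by auto

lemma nfold_multiple: "x \<in> X \<Longrightarrow> (\<lambda>j. m * x j) \<in> nfold X m"
proof (induction m)
  case (Suc m)
  then have "(\<lambda>j. x j + m * x j) \<in> nfold X (Suc m)" by auto
  then show ?case by simp
qed simp

section \<open>The ideal for \<open>a = k b\<close> as a \<open>b\<close>-th power\<close>

lemma nfold_fold_exps:
  assumes "y \<in> nfold (fold_exps k 1 F) b"
  shows "y \<in> fold_exps (k * b) b F"
  using assms
proof (induction b arbitrary: y)
  case 0
  then show ?case by (simp add: fold_exps_def)
next
  case (Suc b)
  then obtain g h where gh: "y = (\<lambda>j. g j + h j)" "g \<in> fold_exps k 1 F" "h \<in> nfold (fold_exps k 1 F) b"
    by auto
  have h: "h \<in> fold_exps (k * b) b F" by (rule Suc.IH[OF gh(3)])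
  have "y j \<le> Suc b" if "j \<in> F" for j
  proof -
    have "g j \<le> 1" "h j \<le> b" using gh(2) h that by (auto simp: fold_exps_def)
    then show ?thesis unfolding gh(1) by simp
  qed
  moreover have "sum y F = k * Suc b"
    using gh(2) h unfolding gh(1) by (simp add: fold_exps_def sum.distrib)
  ultimately show ?case by (simp add: fold_exps_def)
qed

text \<open>A 0/1 exponent of sum \<open>k\<close> is split off. Its support \<open>S\<close> must
  contain all entries equal to \<open>b + 1\<close>, so that the rest is bounded by
  \<open>b\<close>, and only positive entries. Comparing sums gives
  \<open>card ?A \<le> k \<le> card ?B\<close>, so such an \<open>S\<close> exists.\<close>

lemma fold_exps_nfold:
  assumes "finite F" "e \<in> fold_exps (k * b) b F"
  shows "\<exists>y\<in>nfold (fold_exps k 1 F) b. \<forall>j\<in>F. y j = e j"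
  using assms(2)
proof (induction b arbitrary: e)
  case 0
  then show ?case by (auto simp: fold_exps_def)
next
  case (Suc b)
  then have le: "\<And>j. j \<in> F \<Longrightarrow> e j \<le> Suc b" and sum: "sum e F = k * Suc b" by (auto simp: fold_exps_def)
  let ?A = "{j\<in>F. e j = Suc b}" and ?B = "{j\<in>F. 0 < e j}"
  have "card ?A * Suc b = sum e ?A" by simp
  also have "\<dots> \<le> sum e F" using assms(1) by (intro sum_mono2) auto
  finally have "card ?A \<le> k" unfolding sum by (simp only: mult_le_cancel2)
  moreover have "sum e F = sum e ?B" using assms(1) by (intro sum.mono_neutral_right) auto
  then have "k * Suc b \<le> card ?B * Suc b" using sum_bounded_above[of ?B e "Suc b"] le sum by simp
  then have "k \<le> card ?B" by (simp only: mult_le_cancel2)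
  moreover have "?A \<subseteq> ?B" "finite ?B" using assms(1) by auto
  ultimately have "\<exists>S. ?A \<subseteq> S \<and> S \<subseteq> ?B \<and> card S = k" by (rule exists_subset_between)
  then obtain S where "?A \<subseteq> S \<and> S \<subseteq> ?B \<and> card S = k" ..
  then have S: "?A \<subseteq> S" "S \<subseteq> ?B" "card S = k" by simp_all
  let ?x = "\<lambda>j. if j \<in> S then 1 else (0::nat)" and ?e = "\<lambda>j. e j - (if j \<in> S then 1 else 0)"
  have SF: "S \<subseteq> F" using S by auto
  have "sum ?x F = sum ?x S" using assms(1) SF by (intro sum.mono_neutral_right) auto
  then have sx: "sum ?x F = k" using S by simp
  then have x: "?x \<in> fold_exps k 1 F" by (simp add: fold_exps_def)
  have xe: "?x j \<le> e j" for j
  proof (cases "j \<in> S")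
    case True
    then have "0 < e j" using S(2) by blast
    then show ?thesis by simp
  qed simp
  have "sum ?e F = sum e F - sum ?x F" using xe by (intro sum_subtractf_nat) auto
  then have "sum ?e F = k * b" using sx sum by simp
  moreover have "?e j \<le> b" if "j \<in> F" for j
    using le[OF that] S that by (cases "e j = Suc b") (auto simp: le_Suc_eq)
  ultimately have "?e \<in> fold_exps (k * b) b F" by (simp add: fold_exps_def)
  then obtain y where y: "y \<in> nfold (fold_exps k 1 F) b" "\<forall>j\<in>F. y j = ?e j" using Suc.IH by blast
  have "(\<lambda>j. ?x j + y j) \<in> nfold (fold_exps k 1 F) (Suc b)" using x y(1) by (rule nfold_SucI)
  moreover have "\<forall>j\<in>F. ?x j + y j = e j"
  proof
    fix j assume "j \<in> F"
    from bspec[OF y(2) this] have "y j = e j - ?x j" .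
    then show "?x j + y j = e j" using xe[of j] by (simp only: le_add_diff_inverse)
  qed
  ultimately show ?case by (intro bexI[of _ "\<lambda>j. ?x j + y j"])
qed

lemma fold_ideal_multiple:
  assumes "finite F"
  shows "fold_ideal (k * b) b F = ideal_power (fold_ideal k 1 F) b"
proof -
  have "mon F ` fold_exps (k * b) b F = mon F ` nfold (fold_exps k 1 F) b"
  proof (intro equalityI image_subsetI)
    fix e assume "e \<in> fold_exps (k * b) b F"
    then obtain y where "y \<in> nfold (fold_exps k 1 F) b" "\<forall>j\<in>F. y j = e j"
      using fold_exps_nfold[OF assms] by blast
    moreover from this have "mon F y = mon F e" by (intro mon_cong) auto
    ultimately show "mon F e \<in> mon F ` nfold (fold_exps k 1 F) b" by (metis imageI)
  next
    fix y assume "y \<in> nfold (fold_exps k 1 F) b"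
    then show "mon F y \<in> mon F ` fold_exps (k * b) b F" using nfold_fold_exps by blast
  qed
  then show ?thesis by (simp only: fold_ideal_eq ideal_power_mon)
qed

text \<open>If the generator \<open>e\<close> below \<open>y\<close> belongs to \<open>E\<close>, it
  is strictly smaller somewhere on \<open>F\<close>, so the quotient monomial has a factor from
  \<open>F\<close> and constant term 0.\<close>

lemma mon_in_min_gens:
  fixes F :: "('v, 'k::field) mpoly set"
  assumes "star F c" and const: "\<And>f. f \<in> F \<Longrightarrow> Poly_Mapping.lookup f 0 = 0"
    and M: "0 < M" "0 < c" and y: "y \<in> star.expo F c M"
    and ne: "\<And>e. e \<in> E \<Longrightarrow> \<exists>j\<in>F. y j \<noteq> e j"
  shows "\<exists>\<rho>. mon F y = (\<Sum>e\<in>min_exps F c M. \<rho> e * mon F e) \<and> (\<forall>e\<in>E. Poly_Mapping.lookup (\<rho> e) 0 = 0)"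
proof -
  interpret star F c by fact
  obtain e where e: "e \<in> min_exps F c M" "\<forall>j\<in>F. e j \<le> y j" using min_exps_below[OF y M] by blast
  let ?q = "mon F (\<lambda>j. y j - e j)"
  let ?\<rho> = "\<lambda>a. if a = e then ?q else 0"
  have "mon F y = ?q * mon F e" using e(2) by (intro mon_le) auto
  also have "\<dots> = (\<Sum>a\<in>min_exps F c M. if a = e then ?q * mon F a else 0)"
    using finite_min_exps[OF finF c_le] e(1) by simp
  also have "\<dots> = (\<Sum>a\<in>min_exps F c M. ?\<rho> a * mon F a)" by (intro sum.cong) auto
  finally have eq: "mon F y = (\<Sum>a\<in>min_exps F c M. ?\<rho> a * mon F a)" .
  have "Poly_Mapping.lookup ?q 0 = 0" if "e \<in> E"
  proof -
    obtain j where j: "j \<in> F" "e j < y j" using ne[OF \<open>e \<in> E\<close>] e(2) by (metis le_neq_implies_less)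
    then have "\<exists>r. ?q = r * j ^ 1" using finF by (intro mon_mem_factor) auto
    then obtain r where "?q = r * j ^ 1" ..
    then show ?thesis using const[OF j(1)] by (simp add: lookup_mult_0)
  qed
  then show ?thesis using eq by (intro exI[of _ ?\<rho>]) auto
qed

text \<open>\<open>E\<close> plays the part of the minimal generators that survive in the quotient.
  In \<open>ne\<close>, exponents are compared on \<open>F\<close> only, since those in
  \<open>fold_exps\<close> are arbitrary elsewhere.\<close>

lemma sdefect_fold_ideal:
  fixes F :: "('v::{finite,linorder}, 'k::field) mpoly set"
  assumes gen: "generic_forms n F" "finite F" "n + 1 \<le> card F" and n: "card (UNIV :: 'v set) = n + 1"
    and c: "1 \<le> c" "c \<le> n" and \<mu>: "1 \<le> \<mu>" "\<mu> \<le> b" and a: "a = b * (card F - c) + \<mu>" and m: "0 < m"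
    and E: "E \<subseteq> min_exps F c (m * \<mu>)"
    and ne: "\<And>e y. e \<in> E \<Longrightarrow> y \<in> nfold (fold_exps a b F) m \<Longrightarrow> \<exists>j\<in>F. y j \<noteq> e j"
    and top: "\<And>e. e \<in> min_exps F c (m * \<mu>) - E \<Longrightarrow> e \<in> nfold (fold_exps a b F) m"
  shows "sdefect (fold_ideal a b F) m = card E"
proof -
  have st: "star F c" using gen c by (intro generic_forms_star) auto
  interpret star F c by (rule st)
  let ?M = "m * \<mu>" and ?Y = "nfold (fold_exps a b F) m"
  have M: "0 < ?M" "0 < c" using m \<mu> c by auto
  have const: "Poly_Mapping.lookup f 0 = 0" if "f \<in> F" for f
    using generic_forms_homogeneous[OF gen(1) that] lookup_0_homogeneous by blast
  have Im: "ideal_power (fold_ideal a b F) m = ideal_gen (mon F ` ?Y)"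
    by (simp add: fold_ideal_eq ideal_power_mon)
  have "symbolic_power (fold_ideal a b F) m = ideal_gen (mon F ` min_exps F c ?M)"
    unfolding symbolic_power_fold_ideal[OF gen n c(2) \<mu> a] by (rule star_ideal_eq_min_exps[OF M])
  then have "sdefect (fold_ideal a b F) m = min_gens_quot (ideal_gen (mon F ` min_exps F c ?M)) (ideal_gen (mon F ` ?Y))"
    by (simp only: sdefect_def Im)
  also have "\<dots> = card E"
  proof (rule min_gens_quot_eq_card)
    show "finite (min_exps F c ?M)" by (rule finite_min_exps[OF finF c_le])
    show "Poly_Mapping.lookup (\<rho> e) 0 = 0"
      if rel: "(\<Sum>e\<in>min_exps F c ?M. \<rho> e * mon F e) = 0" and e: "e \<in> min_exps F c ?M" for \<rho> e
    proof -
      obtain D where D: "D \<subseteq> F" "\<rho> e \<in> ideal_gen D" using min_exps_relation[OF rel e] by blast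
      show ?thesis by (rule lookup_0_ideal_gen[OF const D(2)]) (use D(1) in blast)
    qed
    show "\<exists>\<rho>. x = (\<Sum>a\<in>min_exps F c ?M. \<rho> a * mon F a) \<and> (\<forall>a\<in>E. Poly_Mapping.lookup (\<rho> a) 0 = 0)"
      if "x \<in> ideal_gen (mon F ` ?Y)" for x
      using that
    proof (induction rule: ring_ideal.span_induct_alt)
      case base
      show ?case by (intro exI[of _ "\<lambda>_. 0"]) simp
    next
      case (step q x z)
      then obtain y where y: "y \<in> ?Y" "x = mon F y" by blast
      have "y \<in> expo ?M" unfolding expo_def
      proof (intro CollectI allI impI)
        fix C assume C: "C \<subseteq> F" "card C = c"
        show "?M \<le> sum y C"
          using fold_exps_sum_ge[OF gen(2) _ C] a by (intro nfold_sum_ge[OF _ y(1)]) auto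
      qed
      from mon_in_min_gens[OF st const M this ne[OF _ y(1)]]
      obtain \<rho> where \<rho>: "mon F y = (\<Sum>e\<in>min_exps F c ?M. \<rho> e * mon F e)"
        "\<forall>e\<in>E. Poly_Mapping.lookup (\<rho> e) 0 = 0" by blast
      obtain \<sigma> where \<sigma>: "z = (\<Sum>e\<in>min_exps F c ?M. \<sigma> e * mon F e)"
        "\<forall>e\<in>E. Poly_Mapping.lookup (\<sigma> e) 0 = 0" using step(2) by blast
      have "q * x + z = (\<Sum>e\<in>min_exps F c ?M. (q * \<rho> e + \<sigma> e) * mon F e)"
        unfolding y(2) \<rho>(1) \<sigma>(1) by (simp add: sum_distrib_left sum.distrib distrib_right mult.assoc)
      then show ?case using \<rho>(2) \<sigma>(2)
        by (intro exI[of _ "\<lambda>e. q * \<rho> e + \<sigma> e"]) (simp add: lookup_add lookup_mult_0)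
    qed
    show "mon F e \<in> ideal_gen (mon F ` ?Y)" if "e \<in> min_exps F c ?M - E" for e
      using top[OF that] by (intro ring_ideal.span_base imageI)
  qed (use E in auto)
  finally show ?thesis .
qed

theorem theorem5p7:
  fixes a b n s m d c0 \<mu>0 :: nat
    and F :: "('v::{finite,linorder}, 'k::field) mpoly set"
  assumes "infinite (UNIV :: 'k set)"
    and "card (UNIV :: 'v set) = n + 1"
    and "0 < a" and "0 < b" and "0 < n" and "0 < s" and "0 < m"
    and "n + 1 \<le> s"
    and "b * (s - n) + 1 \<le> a" and "a \<le> s * b"
    and "c0 = s - (a - 1) div b"
    and "\<mu>0 = a - b * (s - c0)"
    and "finite F" and "card F = s"
    and "generic_forms n F"
    and "0 < d" and "\<forall>f\<in>F. homogeneous d f"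
  shows "(\<not> b dvd a \<longrightarrow>
            sdefect (fold_ideal a b F) m =
              (\<Sum>B \<in> Pow {1..c0} - {{}}.
                 card (dioph_solutions B (m * \<mu>0)) * binom_product s c0 B)) \<and>
         (\<forall>k. a = k * b \<longrightarrow>
            fold_ideal a b F = ideal_power (fold_ideal (s - c0 + 1) 1 F) b \<and>
            \<mu>0 = b \<and>
            int (sdefect (fold_ideal a b F) m) =
              int (\<Sum>B \<in> Pow {1..c0} - {{}}.
                 card (dioph_solutions B (m * b)) * binom_product s c0 B)
              - int (s choose (c0 - 1)))"
proof -
  \<comment> \<open>The number \<open>s - c0\<close> of forms outside a subset of size
    \<open>c0\<close>. The lower bound on \<open>a\<close> becomes \<open>s - n \<le> q\<close>,
    that is, \<open>c0 \<le> n\<close>.\<close>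
  define q where "q = (a - 1) div b"
  have q1: "s - n \<le> q" using assms(4,9) unfolding q_def by (simp add: less_eq_div_iff_mult_less_eq mult.commute)
  have q2: "q < s"
  proof -
    have "a - 1 < s * b" using assms(3,10) by simp
    then show ?thesis unfolding q_def by (rule less_mult_imp_div_less)
  qed
  have c0: "c0 = s - q" "1 \<le> c0" "c0 \<le> n" "s - c0 = q" using q1 q2 assms(8,11) by (auto simp: q_def)
  have aq: "a - 1 = b * q + (a - 1) mod b" unfolding q_def by simp
  have mub: "(a - 1) mod b < b" using assms(4) by simp
  have mu: "\<mu>0 = (a - 1) mod b + 1" using aq assms(3,12) c0(4) by simp
  have \<mu>: "1 \<le> \<mu>0" "\<mu>0 \<le> b" using mu mub by auto
  have a_eq: "a = b * (card F - c0) + \<mu>0" using aq mu assms(3,14) c0(4) by simp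
  have gen: "generic_forms n F" "finite F" "n + 1 \<le> card F" using assms by auto
  \<comment> \<open>Positivity of \<open>q\<close> allows \<open>t\<close> to be read off from the
    total in \<open>t_eq\<close>.\<close>
  have q0: "0 < q" using q1 assms(8) by simp
  have cF: "c0 \<le> card F" "card F - c0 = q" using c0 assms(8,14) by auto
  let ?M = "m * \<mu>0" and ?A = "min_exps F c0 (m * \<mu>0)" and ?Y = "nfold (fold_exps a b F) m"
  have M: "0 < ?M" using \<mu> assms(7) by simp
  have cardA: "card ?A = (\<Sum>B \<in> Pow {1..c0} - {{}}. card (dioph_solutions B ?M) * binom_product s c0 B)"
    using card_min_exps[OF gen(2) cF(1) M] assms(14) by simp
  \<comment> \<open>Comparing degrees, an exponent of \<open>I^m\<close> can only be minimal if its maximum \<open>t\<close> is \<open>m * b\<close>.\<close>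
  have t_eq: "t = m * b" if y: "y \<in> ?Y" "\<forall>j\<in>F. y j = e j" and e: "sum e F = ?M + q * t" for y e t
  proof -
    have "sum y F = m * a" by (rule nfold_sum[OF _ y(1)]) (simp add: fold_exps_def)
    moreover have "sum y F = sum e F" using y(2) by (intro sum.cong) auto
    \<comment> \<open>Since \<open>a = b q + \<mu>0\<close>, the total \<open>m a\<close> equals
      \<open>m \<mu>0 + q m b\<close>.\<close>
    ultimately have "q * t = q * (m * b)" using e a_eq cF(2) by (simp add: algebra_simps)
    then show ?thesis using q0 by simp
  qed
  have low: "\<exists>t. (\<forall>j\<in>F. e j \<le> t) \<and> q < card {j\<in>F. e j = t} \<and> sum e F = ?M + q * t \<and> t \<le> ?M" if "e \<in> ?A" for e
  proof -
    obtain t where t: "\<forall>j\<in>F. e j \<le> t" "q < card {j\<in>F. e j = t}" "sum e F = ?M + q * t"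
      using \<open>e \<in> ?A\<close> unfolding min_exps_def cF(2) by blast
    \<comment> \<open>At least \<open>q + 1\<close> entries equal \<open>t\<close>, so
      \<open>(q + 1) t\<close> is at most the total \<open>m \<mu>0 + q t\<close>.\<close>
    have "Suc q * t \<le> sum e F" by (rule sum_ge_top[OF gen(2) t(2)])
    then have "t \<le> ?M" using t(3) by simp
    then show ?thesis using t by blast
  qed
  have parta: "sdefect (fold_ideal a b F) m = card ?A" if nd: "\<not> b dvd a"
  proof (rule sdefect_fold_ideal[OF gen assms(2) c0(2,3) \<mu> a_eq assms(7)])
    \<comment> \<open>For \<open>\<mu>0 < b\<close>, the bound \<open>t \<le> m \<mu>0\<close> is
      incompatible with \<open>t = m b\<close>.\<close>
    have "\<mu>0 \<noteq> b" using nd a_eq by auto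
    then have lt: "?M < m * b" using \<mu> assms(7) by simp
    show "\<exists>j\<in>F. y j \<noteq> e j" if e: "e \<in> ?A" and y: "y \<in> ?Y" for e y
    proof (rule ccontr)
      assume "\<not> ?thesis"
      then have eq: "\<forall>j\<in>F. y j = e j" by blast
      obtain t where "sum e F = ?M + q * t" "t \<le> ?M" using low[OF e] by blast
      moreover from this(1) have "t = m * b" by (rule t_eq[OF y eq])
      ultimately show False using lt by simp
    qed
  qed auto
  have partb: "fold_ideal a b F = ideal_power (fold_ideal (s - c0 + 1) 1 F) b \<and> \<mu>0 = b \<and>
      int (sdefect (fold_ideal a b F) m) = int (card ?A) - int (s choose (c0 - 1))" if k: "a = k * b" for k
  proof -
    have "b dvd \<mu>0"
    proof -
      have "b dvd b * (card F - c0) + \<mu>0" using a_eq k by (metis dvd_triv_right)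
      then show ?thesis by (simp add: dvd_add_right_iff)
    qed
    then have mb: "\<mu>0 = b" using \<mu> by (simp add: dvd_imp_le le_antisym)
    have "k * b = (q + 1) * b" using a_eq k mb cF(2) by (simp add: algebra_simps)
    then have kq: "k = q + 1" using assms(4) by (simp only: mult_cancel2) simp
    have fold: "fold_ideal a b F = ideal_power (fold_ideal (s - c0 + 1) 1 F) b"
      using fold_ideal_multiple[OF gen(2), of k b] k kq c0(4) by simp
    let ?e = "\<lambda>S j. if j \<in> S then m * b else 0"
    \<comment> \<open>These are the \<open>m b\<close>-th powers of the squarefree products of
      \<open>q + 1 = s - c0 + 1\<close> forms, the minimal generators that lie in
      \<open>I^m\<close>.\<close>
    define T where "T = ?e ` {S. S \<subseteq> F \<and> card S = q + 1}"
    have sum_e: "sum (?e S) F = card S * (m * b)" if "S \<subseteq> F" for S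
    proof -
      have "sum (?e S) F = sum (?e S) S" using that gen(2) by (intro sum.mono_neutral_right) auto
      then show ?thesis by simp
    qed
    have TA: "T \<subseteq> ?A" unfolding T_def
    proof (intro image_subsetI)
      fix S assume "S \<in> {S. S \<subseteq> F \<and> card S = q + 1}"
      then have S: "S \<subseteq> F" "card S = q + 1" by auto
      have "0 < m * b" using assms(4,7) by simp
      then have "{j\<in>F. ?e S j = m * b} = S" using S(1) by auto
      then show "?e S \<in> ?A" unfolding min_exps_def cF(2) using S sum_e[OF S(1)] mb
        by (intro CollectI conjI exI[of _ "m * b"]) auto
    qed
    have TY: "e \<in> ?Y" if "e \<in> T" for e
    proof -
      obtain S where S: "S \<subseteq> F" "card S = q + 1" "e = ?e S" using \<open>e \<in> T\<close> unfolding T_def by blast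
      let ?x = "\<lambda>j. if j \<in> S then b else 0"
      have "sum ?x F = sum ?x S" using S(1) gen(2) by (intro sum.mono_neutral_right) auto
      then have "?x \<in> fold_exps a b F" using S(2) k kq by (simp add: fold_exps_def)
      then have "(\<lambda>j. m * ?x j) \<in> ?Y" by (rule nfold_multiple)
      moreover have "(\<lambda>j. m * ?x j) = e" unfolding S(3) by auto
      ultimately show ?thesis by simp
    qed
    have inT: "e \<in> T" if e: "e \<in> ?A" and y: "y \<in> ?Y" "\<forall>j\<in>F. y j = e j" for e y
    proof -
      have e0: "e j = 0" if "j \<notin> F" for j using e that by (simp add: min_exps_def)
      obtain t where t: "\<forall>j\<in>F. e j \<le> t" "q < card {j\<in>F. e j = t}" "sum e F = ?M + q * t"
        using low[OF e] by blast
      have tm: "t = m * b" by (rule t_eq[OF y t(3)])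
      let ?S = "{j\<in>F. e j = t}"
      \<comment> \<open>The total \<open>(q + 1) t\<close> is used up by the more than
        \<open>q\<close> entries equal to \<open>t\<close>: there are exactly \<open>q + 1\<close>
        of them, and all others vanish.\<close>
      have s1: "sum e F = Suc q * t" using t(3) tm mb by simp
      have "sum e F = sum e (F - ?S) + sum e ?S" using gen(2) by (intro sum.subset_diff) auto
      moreover have "sum e ?S = card ?S * t" by simp
      moreover have "t > 0" using tm assms(4,7) by simp
      ultimately have "card ?S * t \<le> Suc q * t" using s1 by simp
      then have "card ?S \<le> Suc q" using \<open>t > 0\<close> by (simp only: mult_le_cancel2)
      then have cS: "card ?S = q + 1" using t(2) by simp
      then have "sum e (F - ?S) = 0"
        using s1 \<open>sum e F = sum e (F - ?S) + sum e ?S\<close> \<open>sum e ?S = card ?S * t\<close> by simp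
      then have z: "\<forall>j\<in>F - ?S. e j = 0" by (simp only: sum_eq_0_iff finite_Diff[OF gen(2)])
      have "e = ?e ?S"
      proof
        fix j
        show "e j = ?e ?S j"
        proof (cases "j \<in> ?S")
          case True
          then show ?thesis using tm by simp
        next
          case False
          then have "e j = 0" using z e0[of j] by blast
          then show ?thesis using False by (simp only: if_False)
        qed
      qed
      then show ?thesis unfolding T_def using cS by blast
    qed
    have "sdefect (fold_ideal a b F) m = card (?A - T)"
    proof (rule sdefect_fold_ideal[OF gen assms(2) c0(2,3) \<mu> a_eq assms(7)])
      show "\<exists>j\<in>F. y j \<noteq> e j" if "e \<in> ?A - T" "y \<in> ?Y" for e y using inT that by blast
      show "e \<in> ?Y" if "e \<in> ?A - (?A - T)" for e using TY that by blast
    qed auto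
    moreover have finT: "finite T" unfolding T_def using gen(2) by simp
    moreover have "card T = s choose (c0 - 1)"
    proof -
      have "inj_on ?e {S. S \<subseteq> F \<and> card S = q + 1}"
      proof (rule inj_onI)
        fix S S' assume "?e S = ?e S'"
        then have "(j \<in> S) = (j \<in> S')" for j
          using fun_cong[of "?e S" "?e S'" j] assms(4,7) by (auto split: if_splits)
        then show "S = S'" by blast
      qed
      then have "card T = s choose (q + 1)"
        unfolding T_def using n_subsets[OF gen(2), of "q + 1"] assms(14) by (simp add: card_image)
      also have "\<dots> = s choose (c0 - 1)" using binomial_symmetric[of "q + 1" s] q2 c0(1) by simp
      finally show ?thesis .
    qed
    moreover have "card T \<le> card ?A" using finite_min_exps[OF gen(2) cF(1)] TA by (rule card_mono)
    ultimately have "int (sdefect (fold_ideal a b F) m) = int (card ?A) - int (s choose (c0 - 1))"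
      using card_Diff_subset[OF finT TA] by simp
    then show ?thesis using fold mb by blast
  qed
  show ?thesis
  proof (rule conjI; intro impI allI)
    assume "\<not> b dvd a"
    from parta[OF this] show "sdefect (fold_ideal a b F) m =
        (\<Sum>B \<in> Pow {1..c0} - {{}}. card (dioph_solutions B ?M) * binom_product s c0 B)"
      by (simp only: cardA)
  next
    fix k assume "a = k * b"
    note pb = partb[OF this]
    then have mb: "\<mu>0 = b" by blast
    from pb have "int (sdefect (fold_ideal a b F) m) = int (card ?A) - int (s choose (c0 - 1))" by blast
    then have "int (sdefect (fold_ideal a b F) m) =
        int (\<Sum>B \<in> Pow {1..c0} - {{}}. card (dioph_solutions B (m * b)) * binom_product s c0 B)
        - int (s choose (c0 - 1))" by (simp only: cardA[unfolded mb] mb)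
    with pb show "fold_ideal a b F = ideal_power (fold_ideal (s - c0 + 1) 1 F) b \<and> \<mu>0 = b \<and>
        int (sdefect (fold_ideal a b F) m) =
        int (\<Sum>B \<in> Pow {1..c0} - {{}}. card (dioph_solutions B (m * b)) * binom_product s c0 B)
        - int (s choose (c0 - 1))" by blast
  qed
qed

end
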